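(* Let $G$ be a finite group, let $\mathsf{S}$ be a supercharacter theory of $G$, and let $M\le N$ be $\mathsf{S}$-normal subgroups of $G$. The following are equivalent: (1) $\mathsf{S}$ is a $\Delta$-product over $M$ and $N$; (2) for each $g\in G\setminus N$ and for each supercharacter $\chi\in\mathrm{Irr}(\mathsf{S})$ not containing $M$ in its kernel, $\chi(g)=0$; (3) $\mathbf{V}(\mathsf{S}\mid M)\le N$.
   Context: All groups are finite. For $X\subseteq\mathrm{Irr}(G)$ write $\sigma_X=\sum_{\xi\in X}\xi(1)\xi$. A supercharacter theory $\mathsf{S}$ of $G$ is a subspace of the space of complex class functions of $G$ that is a unital subalgebra both for the pointwise product and for the convolution product $(\alpha\ast\beta)(g)=\frac{1}{|G|}\sum_{x\in G}\alpha(xg)\beta(x^{-1})$ (so it contains both identity elements). Equivalently, it is given by a partition $\mathrm{Cl}(\mathsf{S})$ of $G$ into "$\mathsf{S}$-classes" (superclasses) with $\{1\}\in\mathrm{Cl}(\mathsf{S})$, together with a partition $\mathcal{X}$ of $\mathrm{Irr}(G)$ with $|\mathcal{X}|=|\mathrm{Cl}(\mathsf{S})|$, such that each $\sigma_X$ ($X\in\mathcal{X}$) is constant on each $\mathsf{S}$-class; the subspace is the span of the $\sigma_X$. The set of supercharacters ($\mathsf{S}$-irreducible characters) is $\mathrm{Irr}(\mathsf{S})=\{\sigma_X: X\in\mathcal{X}\}$. A subgroup $N\le G$ is $\mathsf{S}$-normal if it is a union of $\mathsf{S}$-classes (it is then normal in $G$). For $\mathsf{S}$-normal $N$: $\mathsf{S}_N$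 is the supercharacter theory of $N$ whose classes are the $\mathsf{S}$-classes contained in $N$; $\mathsf{S}_{G/N}$ is the supercharacter theory of $G/N$ whose classes are the images of the $\mathsf{S}$-classes under $G\to G/N$ and whose supercharacters are the $\chi\in\mathrm{Irr}(\mathsf{S})$ with $N\subseteq\ker\chi$, viewed as characters of $G/N$. $\mathrm{Irr}(\mathsf{S}\mid N)$ is the set of $\chi\in\mathrm{Irr}(\mathsf{S})$ with $N\nsubseteq\ker\chi$, and $\mathbf{V}(\mathsf{S}\mid N)$ is the subgroup of $G$ generated by all $g\in G$ for which there exists $\chi\in\mathrm{Irr}(\mathsf{S}\mid N)$ with $\chi(g)\ne0$. For $\mathsf{S}$-normal $M\le N$, $\mathsf{S}$ is a $\Delta$-product over $M$ and $N$ if $\mathsf{S}=\mathsf{S}_N\mathop{\Delta}\mathsf{S}_{G/M}$, where the latter is the supercharacter theory of $G$ whose classes are the $\mathsf{S}_N$-classes together with the preimages in $G$ of the $\mathsf{S}_{G/M}$-classes not contained in $N/M$; equivalently, every $\mathsf{S}$-class lying outside $N$ is a union of cosets of $M$. *)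

theory Defs
  imports
    Complex_Main
    "HOL-Library.Function_Algebras"
    "HOL-Library.Disjoint_Sets"
    "HOL-Algebra.Coset"
    "HOL-Algebra.Generated_Groups"
    "Jordan_Normal_Form.VS_Connect"
begin

interpretation cfun: vector_space "\<lambda>(c::complex) (f::'a \<Rightarrow> complex) x. c * f x"
  by unfold_locales (auto simp: algebra_simps)


subsection \<open>Irreducible characters\<close>

text \<open>Complex representations are given by matrices. All functions on a group (characters, class
  functions) are functions on the whole type that vanish outside the carrier, so that each function
  on the group has exactly one such extension.\<close>

definition representation ::
    "('a, 'b) monoid_scheme \<Rightarrow> nat \<Rightarrow> ('a \<Rightarrow> complex mat) \<Rightarrow> bool" where
  "representation G n \<rho> \<longleftrightarrow>
     (\<forall>g\<in>carrier G. \<rho> g \<in> carrier_mat n n) \<and>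
     \<rho> \<one>\<^bsub>G\<^esub> = 1\<^sub>m n \<and>
     (\<forall>g\<in>carrier G. \<forall>h\<in>carrier G. \<rho> (g \<otimes>\<^bsub>G\<^esub> h) = \<rho> g * \<rho> h)"

definition irreducible_representation ::
    "('a, 'b) monoid_scheme \<Rightarrow> nat \<Rightarrow> ('a \<Rightarrow> complex mat) \<Rightarrow> bool" where
  "irreducible_representation G n \<rho> \<longleftrightarrow>
     representation G n \<rho> \<and> n > 0 \<and>
     (\<forall>W. VectorSpace.subspace class_ring W (module_vec TYPE(complex) n) \<longrightarrow>
          (\<forall>g\<in>carrier G. \<forall>w\<in>W. \<rho> g *\<^sub>v w \<in> W) \<longrightarrow>
          W = {0\<^sub>v n} \<or> W = carrier_vec n)"

definition character_of ::
    "('a, 'b) monoid_scheme \<Rightarrow> nat \<Rightarrow> ('a \<Rightarrow> complex mat) \<Rightarrow> 'a \<Rightarrow> complex" where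
  "character_of G n \<rho> g = (if g \<in> carrier G then \<Sum>i<n. \<rho> g $$ (i, i) else 0)"

definition Irr :: "('a, 'b) monoid_scheme \<Rightarrow> ('a \<Rightarrow> complex) set" where
  "Irr G = {character_of G n \<rho> | n \<rho>. irreducible_representation G n \<rho>}"

definition char_kernel :: "('a, 'b) monoid_scheme \<Rightarrow> ('a \<Rightarrow> complex) \<Rightarrow> 'a set" where
  "char_kernel G \<chi> = {g \<in> carrier G. \<chi> g = \<chi> \<one>\<^bsub>G\<^esub>}"

definition sigma_char ::
    "('a, 'b) monoid_scheme \<Rightarrow> ('a \<Rightarrow> complex) set \<Rightarrow> 'a \<Rightarrow> complex" where
  "sigma_char G X g = (\<Sum>\<xi>\<in>X. \<xi> \<one>\<^bsub>G\<^esub> * \<xi> g)"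


subsection \<open>Supercharacter theories\<close>

definition class_functions :: "('a, 'b) monoid_scheme \<Rightarrow> ('a \<Rightarrow> complex) set" where
  "class_functions G = {f. (\<forall>g. g \<notin> carrier G \<longrightarrow> f g = 0) \<and>
     (\<forall>g\<in>carrier G. \<forall>h\<in>carrier G. f (h \<otimes>\<^bsub>G\<^esub> g \<otimes>\<^bsub>G\<^esub> inv\<^bsub>G\<^esub> h) = f g)}"

definition convolution ::
    "('a, 'b) monoid_scheme \<Rightarrow> ('a \<Rightarrow> complex) \<Rightarrow> ('a \<Rightarrow> complex) \<Rightarrow> 'a \<Rightarrow> complex" where
  "convolution G \<alpha> \<beta> g =
     (if g \<in> carrier G
      then (\<Sum>x\<in>carrier G. \<alpha> (x \<otimes>\<^bsub>G\<^esub> g) * \<beta> (inv\<^bsub>G\<^esub> x)) / of_nat (Coset.order G)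
      else 0)"

text \<open>The last two functions below are the units: the constant function 1 for the pointwise
  product, and, because of the normalising factor in the convolution, the order of the group times
  the indicator function of the identity for the convolution product.\<close>

definition supercharacter_theory ::
    "('a, 'b) monoid_scheme \<Rightarrow> ('a \<Rightarrow> complex) set \<Rightarrow> bool" where
  "supercharacter_theory G S \<longleftrightarrow>
     S \<subseteq> class_functions G \<and> cfun.subspace S \<and>
     (\<forall>\<alpha>\<in>S. \<forall>\<beta>\<in>S. (\<lambda>g. \<alpha> g * \<beta> g) \<in> S) \<and>
     (\<forall>\<alpha>\<in>S. \<forall>\<beta>\<in>S. convolution G \<alpha> \<beta> \<in> S) \<and>
     (\<lambda>g. if g \<in> carrier G then 1 else 0) \<in> S \<and>
     (\<lambda>g. if g = \<one>\<^bsub>G\<^esub> then of_nat (Coset.order G) else 0) \<in> S"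

definition supercharacter_partitions ::
    "('a, 'b) monoid_scheme \<Rightarrow> ('a \<Rightarrow> complex) set \<Rightarrow>
     'a set set \<Rightarrow> ('a \<Rightarrow> complex) set set \<Rightarrow> bool" where
  "supercharacter_partitions G S \<K> \<X> \<longleftrightarrow>
     partition_on (carrier G) \<K> \<and> {\<one>\<^bsub>G\<^esub>} \<in> \<K> \<and>
     partition_on (Irr G) \<X> \<and> card \<X> = card \<K> \<and>
     (\<forall>X\<in>\<X>. \<forall>K\<in>\<K>. \<forall>g\<in>K. \<forall>h\<in>K. sigma_char G X g = sigma_char G X h) \<and>
     S = cfun.span (sigma_char G ` \<X>)"

text \<open>For a finite group, each supercharacter theory \<open>S\<close> determines the two partitions uniquely.
  The superclasses are the maximal sets on which every member of \<open>S\<close> is constant; dually, the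
  partition of the irreducible characters comes from the algebra structure of \<open>S\<close> under
  convolution.\<close>

definition superclasses ::
    "('a, 'b) monoid_scheme \<Rightarrow> ('a \<Rightarrow> complex) set \<Rightarrow> 'a set set" where
  "superclasses G S = (THE \<K>. \<exists>\<X>. supercharacter_partitions G S \<K> \<X>)"

definition irr_blocks ::
    "('a, 'b) monoid_scheme \<Rightarrow> ('a \<Rightarrow> complex) set \<Rightarrow> ('a \<Rightarrow> complex) set set" where
  "irr_blocks G S = (THE \<X>. \<exists>\<K>. supercharacter_partitions G S \<K> \<X>)"

definition supercharacters ::
    "('a, 'b) monoid_scheme \<Rightarrow> ('a \<Rightarrow> complex) set \<Rightarrow> ('a \<Rightarrow> complex) set" where
  "supercharacters G S = sigma_char G ` irr_blocks G S"

text \<open>By the equality of the cardinalities of the two partitions, a supercharacter theory is the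
  space of all class functions that are constant on its superclasses. So this is the supercharacter
  theory with superclasses \<open>\<K>\<close> whenever there is one.\<close>

definition theory_of_classes ::
    "('a, 'b) monoid_scheme \<Rightarrow> 'a set set \<Rightarrow> ('a \<Rightarrow> complex) set" where
  "theory_of_classes G \<K> =
     {f \<in> class_functions G. \<forall>K\<in>\<K>. \<forall>g\<in>K. \<forall>h\<in>K. f g = f h}"


subsection \<open>Supernormal subgroups and \<open>\<Delta>\<close>-products\<close>

definition supernormal ::
    "('a, 'b) monoid_scheme \<Rightarrow> ('a \<Rightarrow> complex) set \<Rightarrow> 'a set \<Rightarrow> bool" where
  "supernormal G S N \<longleftrightarrow> subgroup N G \<and> (\<exists>\<C>\<subseteq>superclasses G S. N = \<Union>\<C>)"

definition restricted_theory ::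
    "('a, 'b) monoid_scheme \<Rightarrow> ('a \<Rightarrow> complex) set \<Rightarrow> 'a set \<Rightarrow> ('a \<Rightarrow> complex) set" where
  "restricted_theory G S N =
     theory_of_classes (G\<lparr>carrier := N\<rparr>) {K \<in> superclasses G S. K \<subseteq> N}"

definition quotient_theory ::
    "('a, 'b) monoid_scheme \<Rightarrow> ('a \<Rightarrow> complex) set \<Rightarrow> 'a set \<Rightarrow> ('a set \<Rightarrow> complex) set" where
  "quotient_theory G S N =
     theory_of_classes (G Mod N) ((\<lambda>K. (\<lambda>g. N #>\<^bsub>G\<^esub> g) ` K) ` superclasses G S)"

text \<open>Here \<open>U\<close> is a theory of \<open>N\<close> and \<open>V\<close> a theory of \<open>G Mod M\<close>. An element of \<open>G Mod M\<close> is a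
  coset, so the preimage in \<open>G\<close> of a set of such elements is its union.\<close>

definition Delta_product ::
    "('a, 'b) monoid_scheme \<Rightarrow> 'a set \<Rightarrow> 'a set \<Rightarrow>
     ('a \<Rightarrow> complex) set \<Rightarrow> ('a set \<Rightarrow> complex) set \<Rightarrow> ('a \<Rightarrow> complex) set" where
  "Delta_product G M N U V =
     theory_of_classes G
       (superclasses (G\<lparr>carrier := N\<rparr>) U \<union>
        {\<Union>C | C. C \<in> superclasses (G Mod M) V \<and> \<not> C \<subseteq> (\<lambda>g. M #>\<^bsub>G\<^esub> g) ` N})"

definition is_Delta_product ::
    "('a, 'b) monoid_scheme \<Rightarrow> ('a \<Rightarrow> complex) set \<Rightarrow> 'a set \<Rightarrow> 'a set \<Rightarrow> bool" where
  "is_Delta_product G S M N \<longleftrightarrow>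
     S = Delta_product G M N (restricted_theory G S N) (quotient_theory G S M)"

definition supercharacters_over ::
    "('a, 'b) monoid_scheme \<Rightarrow> ('a \<Rightarrow> complex) set \<Rightarrow> 'a set \<Rightarrow> ('a \<Rightarrow> complex) set" where
  "supercharacters_over G S N = {\<chi> \<in> supercharacters G S. \<not> N \<subseteq> char_kernel G \<chi>}"

definition vanishing_off ::
    "('a, 'b) monoid_scheme \<Rightarrow> ('a \<Rightarrow> complex) set \<Rightarrow> 'a set \<Rightarrow> 'a set" where
  "vanishing_off G S N =
     generate G {g \<in> carrier G. \<exists>\<chi>\<in>supercharacters_over G S N. \<chi> g \<noteq> 0}"

end

theory Submission
  imports Defs "Jordan_Normal_Form.Spectral_Radius"
begin

text \<open>A supercharacter theory \<open>S\<close> is a function algebra in two ways. Under the pointwise product it is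
  the space of all functions that are constant on the superclasses. Under convolution it is, by
  Fourier inversion, the space of all functions on the irreducible characters that are constant on
  the blocks of the other partition; the indicator functions of these blocks correspond to the
  supercharacters, so each supercharacter spans an ideal of \<open>S\<close> under convolution, and the
  supercharacters together span \<open>S\<close>.

  The equivalence rests on the operator that sums a function over the cosets of \<open>M\<close>. Up to a scalar
  it is convolution with the indicator function of \<open>M\<close>, which lies in \<open>S\<close>; hence it maps a
  supercharacter \<open>\<chi>\<close> to a scalar multiple of \<open>\<chi>\<close>. As summing twice multiplies the sum by the order
  of \<open>M\<close>, the scalar is that order or zero. In the first case \<open>\<chi>\<close> is constant on cosets of \<open>M\<close>, in the
  second its sum over every coset is zero, and evaluation at the identity shows that the first case
  means that \<open>M\<close> lies in the kernel of \<open>\<chi>\<close> (\<open>supercharacter_coset_dichotomy\<close>).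

  Both the \<open>\<Delta>\<close>-product condition and the vanishing condition are therefore equivalent to the
  following: off \<open>N\<close>, every member of \<open>S\<close> is constant on the cosets of \<open>M\<close>. If this holds, then a
  supercharacter whose coset sums are zero has zero values off \<open>N\<close>; conversely it is enough to test
  the spanning set of supercharacters, each of which is constant on all cosets of \<open>M\<close> or zero off \<open>N\<close>
  (\<open>vanishing_iff_constant_on_cosets\<close>). For the \<open>\<Delta>\<close>-product, the superclasses of the restricted theory
  and of the quotient theory are computed as the superclasses inside \<open>N\<close> and the images of all
  superclasses; the condition then says that each superclass outside \<open>N\<close> is a union of cosets
  (\<open>Delta_product_iff_constant_on_cosets\<close>). The subgroup generated by the places where the relevant
  supercharacters do not vanish lies in \<open>N\<close> exactly when these places do.

  Superclasses and supercharacters are defined as the unique pair of partitions attached to \<open>S\<close>, so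
  existence and uniqueness of this pair must be proved. This needs the classical theory of
  characters: Schur's lemma, the orthogonality relations in the form \<open>convolution_Irr\<close>, and the fact
  that irreducible characters separate class functions (\<open>class_function_eq_zero\<close>). Existence follows
  by applying \<open>function_algebra_block_functions\<close> to both algebra structures; uniqueness is a count of
  dimensions.\<close>


section \<open>Schur's lemma and the orthogonality relations\<close>

text \<open>Irreducibility quantifies over submodules of a module record; this reduces them to plain closure
  conditions on sets of vectors.\<close>

lemma subspace_module_vec_iff:
  "VectorSpace.subspace class_ring W (module_vec TYPE('f::field) n) \<longleftrightarrow>
     W \<subseteq> carrier_vec n \<and> 0\<^sub>v n \<in> W \<and> (\<forall>v\<in>W. \<forall>w\<in>W. v + w \<in> W) \<and>
     (\<forall>c. \<forall>v\<in>W. c \<cdot>\<^sub>v v \<in> W)"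
  unfolding VectorSpace.subspace_def submodule_def module_vec_simps
  by (simp add: vec_vs vec_module) blast

lemma mult_mat_vec_entry:
  assumes "A \<in> carrier_mat n m" "v \<in> carrier_vec m" "i < n"
  shows "(A *\<^sub>v v) $ i = (\<Sum>k<m. A $$ (i, k) * v $ k)"
  using assms by (auto simp: scalar_prod_def atLeast0LessThan intro!: sum.cong)

lemma mult_mat_entry:
  assumes "A \<in> carrier_mat n m" "B \<in> carrier_mat m p" "i < n" "j < p"
  shows "(A * B) $$ (i, j) = (\<Sum>k<m. A $$ (i, k) * B $$ (k, j))"
  using assms by (auto simp: scalar_prod_def atLeast0LessThan intro!: sum.cong)

lemma representation_carrier:
  "representation G n \<rho> \<Longrightarrow> g \<in> carrier G \<Longrightarrow> \<rho> g \<in> carrier_mat n n"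
  by (simp add: representation_def)

lemma representation_mult_entry:
  assumes "representation G n \<rho>" "g \<in> carrier G" "h \<in> carrier G" "i < n" "j < n"
  shows "\<rho> (g \<otimes>\<^bsub>G\<^esub> h) $$ (i, j) = (\<Sum>k<n. \<rho> g $$ (i, k) * \<rho> h $$ (k, j))"
  using assms mult_mat_entry[of "\<rho> g" n n "\<rho> h" n i j] by (simp add: representation_def)

lemma irreducible_representation_subspace:
  assumes "irreducible_representation G n \<rho>"
    and "W \<subseteq> carrier_vec n" "0\<^sub>v n \<in> W"
    and "\<And>v w. v \<in> W \<Longrightarrow> w \<in> W \<Longrightarrow> v + w \<in> W"
    and "\<And>c v. v \<in> W \<Longrightarrow> c \<cdot>\<^sub>v v \<in> W"
    and "\<And>g w. g \<in> carrier G \<Longrightarrow> w \<in> W \<Longrightarrow> \<rho> g *\<^sub>v w \<in> W"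
  shows "W = {0\<^sub>v n} \<or> W = carrier_vec n"
proof -
  have "VectorSpace.subspace class_ring W (module_vec TYPE(complex) n)"
    using assms(2-5) by (simp add: subspace_module_vec_iff)
  moreover have "\<forall>g\<in>carrier G. \<forall>w\<in>W. \<rho> g *\<^sub>v w \<in> W" using assms(6) by simp
  ultimately show ?thesis using assms(1) by (simp add: irreducible_representation_def)
qed

text \<open>The kernel and the image of an intertwiner are invariant, so a nonzero intertwiner is
  bijective. A right inverse \<open>B\<close> is then two-sided, and the trace of \<open>\<rho> g = \<rho> g * A * B = A * \<sigma> g * B\<close>
  is that of \<open>\<sigma> g * (B * A) = \<sigma> g\<close>.\<close>

lemma Schur_intertwiner:
  assumes \<rho>: "irreducible_representation G n \<rho>" and \<sigma>: "irreducible_representation G m \<sigma>"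
    and A: "A \<in> carrier_mat n m"
    and comm: "\<And>g. g \<in> carrier G \<Longrightarrow> \<rho> g * A = A * \<sigma> g"
    and nz: "A \<noteq> 0\<^sub>m n m"
  shows "character_of G n \<rho> = character_of G m \<sigma>"
proof -
  have \<rho>c: "\<rho> g \<in> carrier_mat n n" if "g \<in> carrier G" for g
    using \<rho> that by (auto simp: irreducible_representation_def representation_def)
  have \<sigma>c: "\<sigma> g \<in> carrier_mat m m" if "g \<in> carrier G" for g
    using \<sigma> that by (auto simp: irreducible_representation_def representation_def)
  have swap: "\<rho> g *\<^sub>v (A *\<^sub>v v) = A *\<^sub>v (\<sigma> g *\<^sub>v v)" if "g \<in> carrier G" "v \<in> carrier_vec m" for g v
  proof -
    have "\<rho> g *\<^sub>v (A *\<^sub>v v) = (\<rho> g * A) *\<^sub>v v"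
      by (rule assoc_mult_mat_vec[OF \<rho>c[OF that(1)] A that(2), symmetric])
    also have "\<dots> = A *\<^sub>v (\<sigma> g *\<^sub>v v)"
      unfolding comm[OF that(1)] by (rule assoc_mult_mat_vec[OF A \<sigma>c[OF that(1)] that(2)])
    finally show ?thesis .
  qed
  have "\<exists>i<n. \<exists>j<m. A $$ (i, j) \<noteq> 0"
  proof (rule ccontr)
    assume "\<not> ?thesis"
    then have "A = 0\<^sub>m n m" using A by (intro eq_matI) auto
    then show False using nz by contradiction
  qed
  then obtain i j where ij: "i < n" "j < m" "A $$ (i, j) \<noteq> 0" by blast
  have "(A *\<^sub>v unit_vec m j) $ i = A $$ (i, j)"
    using A ij by simp
  then have Anz: "A *\<^sub>v unit_vec m j \<noteq> 0\<^sub>v n"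
    using ij by auto
  define ker where "ker = {v \<in> carrier_vec m. A *\<^sub>v v = 0\<^sub>v n}"
  have "ker = {0\<^sub>v m} \<or> ker = carrier_vec m"
  proof (rule irreducible_representation_subspace[OF \<sigma>])
    show "\<sigma> g *\<^sub>v w \<in> ker" if "g \<in> carrier G" "w \<in> ker" for g w
    proof -
      have w: "w \<in> carrier_vec m" "A *\<^sub>v w = 0\<^sub>v n" using that(2) by (simp_all add: ker_def)
      have "\<rho> g *\<^sub>v 0\<^sub>v n = 0\<^sub>v n" using \<rho>c[OF that(1)] by (intro eq_vecI) simp_all
      then have "A *\<^sub>v (\<sigma> g *\<^sub>v w) = 0\<^sub>v n" using swap[OF that(1) w(1)] w(2) by simp
      then show ?thesis using \<sigma>c[OF that(1)] w(1) by (simp add: ker_def)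
    qed
    show "v + w \<in> ker" if "v \<in> ker" "w \<in> ker" for v w
      using that by (simp add: ker_def mult_add_distrib_mat_vec[OF A])
    show "c \<cdot>\<^sub>v v \<in> ker" if "v \<in> ker" for c v
    proof -
      have "c \<cdot>\<^sub>v 0\<^sub>v n = 0\<^sub>v n" by (rule eq_vecI) simp_all
      then show ?thesis using that by (simp add: ker_def mult_mat_vec[OF A])
    qed
    show "0\<^sub>v m \<in> ker" using A by (auto simp: ker_def)
  qed (simp add: ker_def)
  moreover have "unit_vec m j \<notin> ker" using Anz by (auto simp: ker_def)
  ultimately have ker: "ker = {0\<^sub>v m}" by (metis unit_vec_carrier)
  define im where "im = (\<lambda>v. A *\<^sub>v v) ` carrier_vec m"
  have "im = {0\<^sub>v n} \<or> im = carrier_vec n"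
  proof (rule irreducible_representation_subspace[OF \<rho>])
    show "im \<subseteq> carrier_vec n" using A by (auto simp: im_def)
    show "0\<^sub>v n \<in> im" unfolding im_def using A by (intro image_eqI[of _ _ "0\<^sub>v m"]) auto
    show "v + w \<in> im" if "v \<in> im" "w \<in> im" for v w
    proof -
      from that obtain v' w' where "v' \<in> carrier_vec m" "w' \<in> carrier_vec m"
        "v = A *\<^sub>v v'" "w = A *\<^sub>v w'" by (auto simp: im_def)
      then show ?thesis unfolding im_def using A
        by (intro image_eqI[of _ _ "v' + w'"]) (auto simp: mult_add_distrib_mat_vec)
    qed
    show "c \<cdot>\<^sub>v v \<in> im" if "v \<in> im" for c v
    proof -
      from that obtain v' where "v' \<in> carrier_vec m" "v = A *\<^sub>v v'" by (auto simp: im_def)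
      then show ?thesis unfolding im_def using A
        by (intro image_eqI[of _ _ "c \<cdot>\<^sub>v v'"]) (auto simp: mult_mat_vec)
    qed
    show "\<rho> g *\<^sub>v w \<in> im" if "g \<in> carrier G" "w \<in> im" for g w
    proof -
      from that(2) obtain w' where "w' \<in> carrier_vec m" "w = A *\<^sub>v w'" by (auto simp: im_def)
      then show ?thesis unfolding im_def using swap[OF that(1)] \<sigma>c[OF that(1)]
        by (intro image_eqI[of _ _ "\<sigma> g *\<^sub>v w'"]) auto
    qed
  qed
  moreover have "A *\<^sub>v unit_vec m j \<in> im" unfolding im_def by simp
  ultimately have im: "im = carrier_vec n" using Anz by (metis singletonD)
  define w where "w k = (SOME v. v \<in> carrier_vec m \<and> A *\<^sub>v v = unit_vec n k)" for k
  have w: "w k \<in> carrier_vec m" "A *\<^sub>v w k = unit_vec n k" for k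
  proof -
    have "unit_vec n k \<in> im" using im by simp
    then have "\<exists>v. v \<in> carrier_vec m \<and> A *\<^sub>v v = unit_vec n k" by (auto simp: im_def)
    from someI_ex[OF this] show "w k \<in> carrier_vec m" "A *\<^sub>v w k = unit_vec n k"
      by (auto simp: w_def)
  qed
  \<comment> \<open>a right inverse of \<open>A\<close>, assembled from preimages of the unit vectors\<close>
  define B where "B = mat m n (\<lambda>(i, k). w k $ i)"
  have B: "B \<in> carrier_mat m n" by (simp add: B_def)
  have AB: "A * B = 1\<^sub>m n"
  proof (rule eq_matI)
    fix i k assume "i < dim_row (1\<^sub>m n)" "k < dim_col (1\<^sub>m n)"
    then have ik: "i < n" "k < n" by auto
    have "(A * B) $$ (i, k) = (A *\<^sub>v w k) $ i"
      using ik w(1)[of k] unfolding mult_mat_entry[OF A B ik] mult_mat_vec_entry[OF A w(1) ik(1)]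
      by (intro sum.cong) (auto simp: B_def)
    then show "(A * B) $$ (i, k) = 1\<^sub>m n $$ (i, k)" using ik by (simp add: w(2))
  qed (use A B in auto)
  have inj: "v = v'" if "v \<in> carrier_vec m" "v' \<in> carrier_vec m" "A *\<^sub>v v = A *\<^sub>v v'" for v v'
  proof -
    have "A *\<^sub>v (v - v') = 0\<^sub>v n"
      using that A by (simp add: mult_minus_distrib_mat_vec[OF A] minus_cancel_vec)
    then have "v - v' \<in> ker" using that by (simp add: ker_def)
    then have "v - v' = 0\<^sub>v m" using ker by simp
    then have z: "(v - v') $ i = 0" if "i < m" for i using that by simp
    show ?thesis
    proof (rule eq_vecI)
      fix i assume "i < dim_vec v'"
      then show "v $ i = v' $ i" using z[of i] that(1,2) by simp
    qed (use that(1,2) in simp)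
  qed
  have BA: "B * A = 1\<^sub>m m"
  proof (rule mat_col_eqI)
    fix k assume "k < dim_col (1\<^sub>m m)"
    then have k: "k < m" by simp
    have "col (B * A) k = col (1\<^sub>m m) k"
    proof (rule inj)
      have "A *\<^sub>v col (B * A) k = col (A * (B * A)) k"
        using A B k by (intro col_mult2[symmetric]) auto
      also have "A * (B * A) = A * 1\<^sub>m m"
        using A AB by (simp add: assoc_mult_mat[OF A B A, symmetric])
      also have "col (A * 1\<^sub>m m) k = A *\<^sub>v col (1\<^sub>m m) k"
        using A k by (intro col_mult2) auto
      finally show "A *\<^sub>v col (B * A) k = A *\<^sub>v col (1\<^sub>m m) k" .
    qed (use A B k in auto)
    then show "col (B * A) k = col (1\<^sub>m m) k" .
  qed (use A B in auto)
  show ?thesis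
  proof
    fix g
    show "character_of G n \<rho> g = character_of G m \<sigma> g"
    proof (cases "g \<in> carrier G")
      case True
      note c = \<rho>c[OF True] \<sigma>c[OF True]
      have "\<rho> g = \<rho> g * A * B"
        using c A by (simp add: assoc_mult_mat[OF c(1) A B] AB)
      also have "\<dots> = A * (\<sigma> g * B)"
        using c A B by (simp add: comm[OF True] assoc_mult_mat[of _ n m _ m _ n])
      finally have r: "\<rho> g = A * (\<sigma> g * B)" .
      have s: "\<sigma> g = (\<sigma> g * B) * A"
        using c by (simp add: assoc_mult_mat[OF c(2) B A] BA)
      have SB: "\<sigma> g * B \<in> carrier_mat m n" using c B by simp
      have rd: "\<rho> g $$ (i, i) = (\<Sum>k<m. A $$ (i, k) * (\<sigma> g * B) $$ (k, i))" if "i < n" for i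
        using mult_mat_entry[OF A SB that that] r by metis
      have sd: "(\<Sum>i<n. (\<sigma> g * B) $$ (k, i) * A $$ (i, k)) = \<sigma> g $$ (k, k)" if "k < m" for k
        using mult_mat_entry[OF SB A that that] s by metis
      have "(\<Sum>i<n. \<rho> g $$ (i, i)) = (\<Sum>i<n. \<Sum>k<m. A $$ (i, k) * (\<sigma> g * B) $$ (k, i))"
        by (rule sum.cong[OF refl]) (rule rd, blast)
      also have "\<dots> = (\<Sum>k<m. \<Sum>i<n. A $$ (i, k) * (\<sigma> g * B) $$ (k, i))"
        by (rule sum.swap)
      also have "\<dots> = (\<Sum>k<m. \<Sum>i<n. (\<sigma> g * B) $$ (k, i) * A $$ (i, k))"
        by (simp only: mult.commute)
      also have "\<dots> = (\<Sum>k<m. \<sigma> g $$ (k, k))"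
        by (rule sum.cong[OF refl]) (rule sd, blast)
      finally show ?thesis using True by (simp add: character_of_def)
    qed (simp add: character_of_def)
  qed
qed

text \<open>An eigenspace of \<open>A\<close> is invariant because \<open>A\<close> commutes with the representation, and it is not
  zero, so it is everything.\<close>

lemma Schur_scalar:
  assumes \<rho>: "irreducible_representation G n \<rho>" and A: "A \<in> carrier_mat n n"
    and comm: "\<And>g. g \<in> carrier G \<Longrightarrow> \<rho> g * A = A * \<rho> g"
  obtains c where "A = c \<cdot>\<^sub>m 1\<^sub>m n"
proof -
  have \<rho>c: "\<rho> g \<in> carrier_mat n n" if "g \<in> carrier G" for g
    using \<rho> that by (auto simp: irreducible_representation_def representation_def)
  have "n > 0" using \<rho> by (simp add: irreducible_representation_def)
  then obtain c where "eigenvalue A c"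
    using spectrum_non_empty[OF A] by (auto simp: spectrum_def)
  then obtain v where v: "v \<in> carrier_vec n" "v \<noteq> 0\<^sub>v n" "A *\<^sub>v v = c \<cdot>\<^sub>v v"
    using A by (auto simp: eigenvalue_def eigenvector_def)
  define E where "E = {w \<in> carrier_vec n. A *\<^sub>v w = c \<cdot>\<^sub>v w}"
  have "E = {0\<^sub>v n} \<or> E = carrier_vec n"
  proof (rule irreducible_representation_subspace[OF \<rho>])
    show "\<rho> g *\<^sub>v w \<in> E" if "g \<in> carrier G" "w \<in> E" for g w
    proof -
      have w: "w \<in> carrier_vec n" "A *\<^sub>v w = c \<cdot>\<^sub>v w" using that(2) by (auto simp: E_def)
      have "A *\<^sub>v (\<rho> g *\<^sub>v w) = (A * \<rho> g) *\<^sub>v w"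
        using A \<rho>c[OF that(1)] w by (metis assoc_mult_mat_vec)
      also have "\<dots> = (\<rho> g * A) *\<^sub>v w" using comm that(1) by simp
      also have "\<dots> = \<rho> g *\<^sub>v (c \<cdot>\<^sub>v w)"
        using A \<rho>c[OF that(1)] w by (metis assoc_mult_mat_vec)
      also have "\<dots> = c \<cdot>\<^sub>v (\<rho> g *\<^sub>v w)"
        using \<rho>c[OF that(1)] w by (simp add: mult_mat_vec)
      finally show ?thesis using \<rho>c[OF that(1)] w by (simp add: E_def)
    qed
  qed (use A in \<open>auto simp: E_def mult_add_distrib_mat_vec mult_mat_vec smult_add_distrib_vec
        smult_smult_assoc mult.commute\<close>)
  moreover have "v \<in> E" using v by (simp add: E_def)
  ultimately have E: "E = carrier_vec n" using v(2) by auto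
  have "A = c \<cdot>\<^sub>m 1\<^sub>m n"
  proof (rule eq_matI)
    fix i j assume "i < dim_row (c \<cdot>\<^sub>m 1\<^sub>m n)" "j < dim_col (c \<cdot>\<^sub>m 1\<^sub>m n)"
    then have ij: "i < n" "j < n" by auto
    have "unit_vec n j \<in> E" using E by simp
    then have "(A *\<^sub>v unit_vec n j) $ i = (c \<cdot>\<^sub>v unit_vec n j) $ i" by (simp add: E_def)
    then show "A $$ (i, j) = (c \<cdot>\<^sub>m 1\<^sub>m n) $$ (i, j)" using A ij by auto
  qed (use A in auto)
  then show thesis by (rule that)
qed


locale finite_group = group G for G (structure) +
  assumes finite_carrier [simp]: "finite (carrier G)"
begin

lemma order_nonzero [simp]: "Coset.order G \<noteq> 0"
proof -
  have "card (carrier G) \<noteq> 0" using one_closed by auto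
  then show ?thesis by (simp add: Coset.order_def)
qed

lemma sum_left_translate:
  "g \<in> carrier G \<Longrightarrow> (\<Sum>x\<in>carrier G. f (g \<otimes> x)) = (\<Sum>x\<in>carrier G. f x)"
  by (rule sum.reindex_bij_witness[of _ "\<lambda>x. inv g \<otimes> x" "\<lambda>x. g \<otimes> x"])
     (auto simp: m_assoc[symmetric])

lemma sum_right_translate:
  "g \<in> carrier G \<Longrightarrow> (\<Sum>x\<in>carrier G. f (x \<otimes> g)) = (\<Sum>x\<in>carrier G. f x)"
  by (rule sum.reindex_bij_witness[of _ "\<lambda>x. x \<otimes> inv g" "\<lambda>x. x \<otimes> g"])
     (auto simp: m_assoc)

lemma inv_mult_cancel: "x \<in> carrier G \<Longrightarrow> g \<in> carrier G \<Longrightarrow> inv (g \<otimes> x) \<otimes> g = inv x"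
  by (simp add: inv_mult_group m_assoc)

text \<open>The matrix \<open>A\<close> is the sum of \<open>\<rho> x * E * \<sigma> (inv x)\<close> over the group, where \<open>E\<close> is the elementary
  matrix with its entry 1 in position \<open>(b, c)\<close>. Multiplication by \<open>\<rho> g\<close> on the left is absorbed by the
  substitution of \<open>g \<otimes> x\<close> for \<open>x\<close>. Schur's lemma, applied to all these averages, gives the
  orthogonality of matrix entries below.\<close>

lemma averaged_matrix_intertwines:
  assumes \<rho>: "representation G n \<rho>" and \<sigma>: "representation G m \<sigma>"
    and bc: "b < n" "c < m" and g: "g \<in> carrier G"
  defines "A \<equiv> mat n m (\<lambda>(i, j). \<Sum>x\<in>carrier G. \<rho> x $$ (i, b) * \<sigma> (inv x) $$ (c, j))"
  shows "\<rho> g * A = A * \<sigma> g"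
proof -
  have A: "A \<in> carrier_mat n m" by (simp add: A_def)
  note c = representation_carrier[OF \<rho> g] representation_carrier[OF \<sigma> g]
  show ?thesis
  proof (rule eq_matI)
    fix i j assume "i < dim_row (A * \<sigma> g)" "j < dim_col (A * \<sigma> g)"
    then have ij: "i < n" "j < m" using A c by auto
    have "(\<rho> g * A) $$ (i, j) =
        (\<Sum>k<n. \<rho> g $$ (i, k) * (\<Sum>x\<in>carrier G. \<rho> x $$ (k, b) * \<sigma> (inv x) $$ (c, j)))"
      unfolding mult_mat_entry[OF c(1) A ij] using ij by (intro sum.cong) (auto simp: A_def)
    also have "\<dots> = (\<Sum>k<n. \<Sum>x\<in>carrier G. \<rho> g $$ (i, k) * \<rho> x $$ (k, b) * \<sigma> (inv x) $$ (c, j))"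
      by (simp add: sum_distrib_left mult.assoc)
    also have "\<dots> = (\<Sum>x\<in>carrier G. \<Sum>k<n. \<rho> g $$ (i, k) * \<rho> x $$ (k, b) * \<sigma> (inv x) $$ (c, j))"
      by (rule sum.swap)
    also have "\<dots> = (\<Sum>x\<in>carrier G. \<rho> (g \<otimes> x) $$ (i, b) * \<sigma> (inv (g \<otimes> x) \<otimes> g) $$ (c, j))"
      using ij bc g
      by (intro sum.cong) (auto simp: representation_mult_entry[OF \<rho>] sum_distrib_right inv_mult_cancel)
    also have "\<dots> = (\<Sum>x\<in>carrier G. \<rho> x $$ (i, b) * \<sigma> (inv x \<otimes> g) $$ (c, j))"
      by (rule sum_left_translate[OF g])
    also have "\<dots> = (\<Sum>x\<in>carrier G. \<Sum>k<m. \<rho> x $$ (i, b) * \<sigma> (inv x) $$ (c, k) * \<sigma> g $$ (k, j))"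
      using ij bc g
      by (intro sum.cong) (auto simp: representation_mult_entry[OF \<sigma>] sum_distrib_left mult.assoc)
    also have "\<dots> = (\<Sum>k<m. \<Sum>x\<in>carrier G. \<rho> x $$ (i, b) * \<sigma> (inv x) $$ (c, k) * \<sigma> g $$ (k, j))"
      by (rule sum.swap)
    also have "\<dots> = (A * \<sigma> g) $$ (i, j)"
      unfolding mult_mat_entry[OF A c(2) ij] using ij
      by (intro sum.cong) (auto simp: A_def sum_distrib_right)
    finally show "(\<rho> g * A) $$ (i, j) = (A * \<sigma> g) $$ (i, j)" .
  qed (use A c in auto)
qed

lemma matrix_orthogonality_distinct:
  assumes \<rho>: "irreducible_representation G n \<rho>" and \<sigma>: "irreducible_representation G m \<sigma>"
    and neq: "character_of G n \<rho> \<noteq> character_of G m \<sigma>"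
    and "i < n" "b < n" "c < m" "j < m"
  shows "(\<Sum>x\<in>carrier G. \<rho> x $$ (i, b) * \<sigma> (inv x) $$ (c, j)) = 0"
proof -
  define A where "A = mat n m (\<lambda>(i, j). \<Sum>x\<in>carrier G. \<rho> x $$ (i, b) * \<sigma> (inv x) $$ (c, j))"
  have "A = 0\<^sub>m n m"
  proof (rule ccontr)
    assume "A \<noteq> 0\<^sub>m n m"
    moreover have "\<rho> g * A = A * \<sigma> g" if "g \<in> carrier G" for g
      unfolding A_def using assms that
      by (intro averaged_matrix_intertwines) (auto simp: irreducible_representation_def)
    ultimately show False
      using Schur_intertwiner[OF \<rho> \<sigma>, of A] neq by (simp add: A_def)
  qed
  then have "A $$ (i, j) = 0" using assms by simp
  then show ?thesis using assms by (simp add: A_def)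
qed

lemma matrix_orthogonality_same:
  assumes \<rho>: "irreducible_representation G n \<rho>"
    and ind: "i < n" "b < n" "c < n" "j < n"
  shows "(\<Sum>x\<in>carrier G. \<rho> x $$ (i, b) * \<rho> (inv x) $$ (c, j)) =
    (if i = j \<and> b = c then of_nat (Coset.order G) / of_nat n else 0)"
proof -
  have rep: "representation G n \<rho>" and n: "n > 0"
    using \<rho> by (auto simp: irreducible_representation_def)
  define A where "A = mat n n (\<lambda>(i, j). \<Sum>x\<in>carrier G. \<rho> x $$ (i, b) * \<rho> (inv x) $$ (c, j))"
  have "A \<in> carrier_mat n n" by (simp add: A_def)
  moreover have "\<rho> g * A = A * \<rho> g" if "g \<in> carrier G" for g
    unfolding A_def using rep ind that by (intro averaged_matrix_intertwines)
  ultimately obtain \<mu> where A: "A = \<mu> \<cdot>\<^sub>m 1\<^sub>m n" by (rule Schur_scalar[OF \<rho>])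
  \<comment> \<open>the scalar is found by comparing traces\<close>
  have "of_nat n * \<mu> = (\<Sum>k<n. A $$ (k, k))" by (simp add: A)
  also have "\<dots> = (\<Sum>k<n. \<Sum>x\<in>carrier G. \<rho> x $$ (k, b) * \<rho> (inv x) $$ (c, k))"
    by (simp add: A_def)
  also have "\<dots> = (\<Sum>x\<in>carrier G. \<Sum>k<n. \<rho> (inv x) $$ (c, k) * \<rho> x $$ (k, b))"
    by (subst sum.swap) (simp add: mult.commute)
  also have "\<dots> = (\<Sum>x\<in>carrier G. \<rho> (inv x \<otimes> x) $$ (c, b))"
    using ind by (intro sum.cong refl representation_mult_entry[OF rep, symmetric]) auto
  also have "\<dots> = (if b = c then of_nat (Coset.order G) else 0)"
    using rep ind by (simp add: representation_def Coset.order_def)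
  finally have "\<mu> = (if b = c then of_nat (Coset.order G) / of_nat n else 0)"
    using n by (auto simp: field_simps)
  moreover have "A $$ (i, j) = (if i = j then \<mu> else 0)" using ind by (simp add: A)
  ultimately show ?thesis using ind by (simp add: A_def split: if_splits)
qed

lemma IrrE:
  assumes "\<chi> \<in> Irr G"
  obtains n \<rho> where "irreducible_representation G n \<rho>" "\<chi> = character_of G n \<rho>"
    "n > 0" "\<chi> \<one> = of_nat n"
proof -
  from assms obtain n \<rho> where r: "irreducible_representation G n \<rho>" "\<chi> = character_of G n \<rho>"
    by (auto simp: Irr_def)
  moreover from r have "n > 0" "\<chi> \<one> = of_nat n"
    by (auto simp: irreducible_representation_def representation_def character_of_def)
  ultimately show thesis by (rule that)
qed

lemma Irr_one_nonzero: "\<chi> \<in> Irr G \<Longrightarrow> \<chi> \<one> \<noteq> 0"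
  by (auto elim: IrrE)

text \<open>Expand \<open>\<chi> (x \<otimes> g)\<close> into matrix entries of \<open>x\<close> and \<open>g\<close>; the orthogonality relations for
  the matrix entries then leave the trace of the matrix of \<open>g\<close>, or nothing.\<close>

lemma convolution_Irr:
  assumes \<chi>: "\<chi> \<in> Irr G" and \<psi>: "\<psi> \<in> Irr G"
  shows "convolution G \<chi> \<psi> = (\<lambda>g. if \<chi> = \<psi> then \<chi> g / \<chi> \<one> else 0)"
proof
  fix g
  from \<chi> obtain n \<rho> where \<rho>: "irreducible_representation G n \<rho>" "\<chi> = character_of G n \<rho>"
    "n > 0" "\<chi> \<one> = of_nat n" by (rule IrrE)
  obtain m \<sigma> where \<sigma>: "irreducible_representation G m \<sigma>" "\<psi> = character_of G m \<sigma>"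
    and same: "\<chi> = \<psi> \<Longrightarrow> m = n \<and> \<sigma> = \<rho>"
  proof (cases "\<chi> = \<psi>")
    case True
    then show thesis using \<rho> that by blast
  next
    case False
    from \<psi> obtain m \<sigma> where "irreducible_representation G m \<sigma>" "\<psi> = character_of G m \<sigma>"
      by (rule IrrE)
    then show thesis using False that by blast
  qed
  have rep: "representation G n \<rho>" using \<rho>(1) by (simp add: irreducible_representation_def)
  show "convolution G \<chi> \<psi> g = (if \<chi> = \<psi> then \<chi> g / \<chi> \<one> else 0)"
  proof (cases "g \<in> carrier G")
    case g: True
    have "(\<Sum>x\<in>carrier G. \<chi> (x \<otimes> g) * \<psi> (inv x)) =
        (\<Sum>x\<in>carrier G. \<Sum>i<n. \<Sum>k<n. \<Sum>j<m. \<rho> g $$ (k, i) * (\<rho> x $$ (i, k) * \<sigma> (inv x) $$ (j, j)))"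
      using g by (intro sum.cong refl)
        (simp add: \<rho>(2) \<sigma>(2) character_of_def representation_mult_entry[OF rep]
          sum_distrib_left sum_distrib_right mult_ac)
    also have "\<dots> = (\<Sum>i<n. \<Sum>x\<in>carrier G. \<Sum>k<n. \<Sum>j<m. \<rho> g $$ (k, i) * (\<rho> x $$ (i, k) * \<sigma> (inv x) $$ (j, j)))"
      by (rule sum.swap)
    also have "\<dots> = (\<Sum>i<n. \<Sum>k<n. \<Sum>x\<in>carrier G. \<Sum>j<m. \<rho> g $$ (k, i) * (\<rho> x $$ (i, k) * \<sigma> (inv x) $$ (j, j)))"
      by (intro sum.cong refl sum.swap)
    also have "\<dots> = (\<Sum>i<n. \<Sum>k<n. \<Sum>j<m. \<Sum>x\<in>carrier G. \<rho> g $$ (k, i) * (\<rho> x $$ (i, k) * \<sigma> (inv x) $$ (j, j)))"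
      by (intro sum.cong refl sum.swap)
    also have "\<dots> = (\<Sum>i<n. \<Sum>k<n. \<Sum>j<m. \<rho> g $$ (k, i) * (\<Sum>x\<in>carrier G. \<rho> x $$ (i, k) * \<sigma> (inv x) $$ (j, j)))"
      by (simp add: sum_distrib_left)
    also have "\<dots> = (if \<chi> = \<psi> then of_nat (Coset.order G) * \<chi> g / \<chi> \<one> else 0)"
    proof (cases "\<chi> = \<psi>")
      case True
      then have ms: "m = n" "\<sigma> = \<rho>" using same by auto
      have "(\<Sum>i<n. \<Sum>k<n. \<Sum>j<n. \<rho> g $$ (k, i) * (\<Sum>x\<in>carrier G. \<rho> x $$ (i, k) * \<rho> (inv x) $$ (j, j)))
          = (\<Sum>i<n. \<Sum>k<n. \<Sum>j<n. if i = j \<and> k = j then \<rho> g $$ (k, i) * (of_nat (Coset.order G) / of_nat n) else 0)"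
        by (intro sum.cong refl) (simp add: matrix_orthogonality_same[OF \<rho>(1)])
      also have "\<dots> = (\<Sum>i<n. \<Sum>k<n. if k = i then \<rho> g $$ (k, i) * (of_nat (Coset.order G) / of_nat n) else 0)"
      proof (intro sum.cong refl)
        fix i k assume "i \<in> {..<n}" "k \<in> {..<n}"
        then show "(\<Sum>j<n. if i = j \<and> k = j then \<rho> g $$ (k, i) * (of_nat (Coset.order G) / of_nat n) else 0)
          = (if k = i then \<rho> g $$ (k, i) * (of_nat (Coset.order G) / of_nat n) else 0)"
          by (cases "k = i") auto
      qed
      also have "\<dots> = (\<Sum>i<n. \<rho> g $$ (i, i) * (of_nat (Coset.order G) / of_nat n))"
        by simp
      also have "\<dots> = of_nat (Coset.order G) * \<chi> g / \<chi> \<one>"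
        using g unfolding \<rho>(4) unfolding \<rho>(2) by (simp add: character_of_def sum_divide_distrib sum_distrib_left mult_ac)
      finally show ?thesis using True by (simp add: ms)
    next
      case False
      then show ?thesis using \<rho>(2) \<sigma>(2)
        by (simp add: matrix_orthogonality_distinct[OF \<rho>(1) \<sigma>(1)])
    qed
    finally show ?thesis using g by (simp add: convolution_def)
  next
    case False
    then have "\<chi> g = 0" by (simp add: \<rho>(2) character_of_def)
    then show ?thesis using False by (auto simp: convolution_def)
  qed
qed

end


section \<open>Finite-dimensional spaces of functions\<close>

lemma sum_fun_apply: "(\<Sum>i\<in>A. F i) x = (\<Sum>i\<in>A. F i x)"
  for F :: "'i \<Rightarrow> 'a \<Rightarrow> 'c::comm_monoid_add"
  by (induction A rule: infinite_finite_induct) auto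

definition funs_on :: "'a set \<Rightarrow> ('a \<Rightarrow> complex) set" where
  "funs_on A = {f. \<forall>x. x \<notin> A \<longrightarrow> f x = 0}"

lemma funs_on_subset_span:
  assumes "finite A"
  shows "funs_on A \<subseteq> cfun.span ((\<lambda>a x. if x = a then 1 else 0) ` A)"
proof
  fix f assume f: "f \<in> funs_on A"
  have "f = (\<Sum>a\<in>A. (\<lambda>x. f a * (if x = a then 1 else 0)))"
  proof
    fix x
    have "(\<Sum>a\<in>A. f a * (if x = a then 1 else 0)) = (\<Sum>a\<in>A. if x = a then f a else 0)"
      by (intro sum.cong) auto
    then show "f x = (\<Sum>a\<in>A. (\<lambda>x. f a * (if x = a then 1 else 0))) x"
      using f assms by (simp add: sum_fun_apply funs_on_def)
  qed
  also have "\<dots> \<in> cfun.span ((\<lambda>a x. if x = a then 1 else 0) ` A)"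
    by (intro cfun.span_sum cfun.span_scale cfun.span_base) auto
  finally show "f \<in> cfun.span ((\<lambda>a x. if x = a then 1 else 0) ` A)" .
qed

text \<open>All dimensions are taken inside the infinite-dimensional space of all functions on a type, so
  finiteness is imposed by a finite spanning set \<open>C\<close>.\<close>

lemma subspace_subset_if_dim_le:
  assumes U: "cfun.subspace U" "U \<subseteq> W" and W: "W \<subseteq> cfun.span C" "finite C"
    and dim: "cfun.dim W \<le> cfun.dim U"
  shows "W \<subseteq> U"
proof
  fix w assume w: "w \<in> W"
  obtain B where B: "B \<subseteq> U" "cfun.independent B" "U \<subseteq> cfun.span B" "card B = cfun.dim U"
    by (rule cfun.basis_exists)
  obtain D where D: "D \<subseteq> W" "cfun.independent D" "W \<subseteq> cfun.span D" "card D = cfun.dim W"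
    by (rule cfun.basis_exists)
  have fin: "finite D"
    using cfun.independent_span_bound[OF W(2) D(2) subset_trans[OF D(1) W(1)]] by simp
  have "w \<in> cfun.span B"
  proof (rule ccontr)
    assume nw: "w \<notin> cfun.span B"
    then have "cfun.independent (insert w B)" using B(2) by (rule cfun.independent_insertI)
    moreover have "insert w B \<subseteq> cfun.span D" using B(1) U(2) w D(3) by blast
    ultimately have "finite (insert w B) \<and> card (insert w B) \<le> card D"
      by (rule cfun.independent_span_bound[OF fin])
    moreover have "w \<notin> B" using nw cfun.span_base by blast
    moreover have "finite B" using \<open>finite (insert w B) \<and> _\<close> by simp
    ultimately show False using B(4) D(4) dim by simp
  qed
  then show "w \<in> U" using cfun.span_minimal[OF B(1) U(1)] by blast
qed

text \<open>A basis listed by numbers, so that linear maps can be written as matrices.\<close>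

lemma subspace_coordinates:
  assumes W: "cfun.subspace W" "W \<subseteq> cfun.span C" "finite C"
  obtains n :: nat and b :: "nat \<Rightarrow> 'a \<Rightarrow> complex"
  where "W = range (\<lambda>c x. \<Sum>i<n. c i * b i x)"
    and "\<And>c. (\<lambda>x. \<Sum>i<n. c i * b i x) = (\<lambda>x. 0) \<Longrightarrow> \<forall>i<n. c i = 0"
proof -
  obtain B where B: "B \<subseteq> W" "cfun.independent B" "W \<subseteq> cfun.span B" "card B = cfun.dim W"
    by (rule cfun.basis_exists)
  have fin: "finite B"
    using cfun.independent_span_bound[OF W(3) B(2) subset_trans[OF B(1) W(2)]] by simp
  obtain b where b: "bij_betw b {..<card B} B"
    using ex_bij_betw_nat_finite[OF fin] unfolding atLeast0LessThan by blast
  have comb: "(\<Sum>v\<in>B. (\<lambda>x. u v * v x)) = (\<lambda>x. \<Sum>i<card B. u (b i) * b i x)" for u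
  proof
    fix x
    show "(\<Sum>v\<in>B. (\<lambda>x. u v * v x)) x = (\<Sum>i<card B. u (b i) * b i x)"
      unfolding sum_fun_apply by (rule sum.reindex_bij_betw[OF b, symmetric])
  qed
  define inv_b where "inv_b = the_inv_into {..<card B} b"
  have inv_b: "inv_b (b i) = i" if "i < card B" for i
    unfolding inv_b_def using b that by (intro the_inv_into_f_f) (auto simp: bij_betw_def)
  have spanB: "W = cfun.span B"
    using B(3) cfun.span_minimal[OF B(1) W(1)] by (rule subset_antisym)
  show thesis
  proof (rule that)
    show "W = range (\<lambda>c x. \<Sum>i<card B. c i * b i x)"
    proof
      show "W \<subseteq> range (\<lambda>c x. \<Sum>i<card B. c i * b i x)"
      proof
        fix w assume "w \<in> W"
        then obtain u where "w = (\<Sum>v\<in>B. (\<lambda>x. u v * v x))"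
          unfolding spanB cfun.span_finite[OF fin] by (rule rangeE)
        then show "w \<in> range (\<lambda>c x. \<Sum>i<card B. c i * b i x)"
          unfolding comb by (intro image_eqI[of _ _ "\<lambda>i. u (b i)"]) simp_all
      qed
      show "range (\<lambda>c x. \<Sum>i<card B. c i * b i x) \<subseteq> W"
      proof
        fix w assume "w \<in> range (\<lambda>c x. \<Sum>i<card B. c i * b i x)"
        then obtain c where "w = (\<lambda>x. \<Sum>i<card B. c i * b i x)" by blast
        also have "\<dots> = (\<Sum>v\<in>B. (\<lambda>x. c (inv_b v) * v x))"
          unfolding comb by (simp add: inv_b)
        finally show "w \<in> W" unfolding spanB cfun.span_finite[OF fin]
          by (intro image_eqI[of _ _ "\<lambda>v. c (inv_b v)"]) simp_all
      qed
    qed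
    show "\<forall>i<card B. c i = 0" if "(\<lambda>x. \<Sum>i<card B. c i * b i x) = (\<lambda>x. 0)" for c
    proof -
      have "(\<Sum>v\<in>B. (\<lambda>x. c (inv_b v) * v x)) = 0"
        unfolding comb using that by (simp add: inv_b zero_fun_def)
      then have c0: "c (inv_b v) = 0" if "v \<in> B" for v
        using cfun.independentD[OF B(2) fin subset_refl _ that, of "\<lambda>v. c (inv_b v)"] by simp
      show ?thesis
      proof (intro allI impI)
        fix i assume i: "i < card B"
        then have "b i \<in> B" using b by (auto simp: bij_betw_def)
        from c0[OF this] show "c i = 0" by (simp add: inv_b[OF i])
      qed
    qed
  qed
qed


section \<open>The irreducible characters span the class functions\<close>

context finite_group
begin

text \<open>The matrices \<open>\<rho> g\<close> describe \<open>R g\<close> in a basis of \<open>W\<close>. An invariant subspace of the coordinate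
  space is mapped by the coordinate isomorphism \<open>\<Psi>\<close> to an invariant subspace of \<open>W\<close>, which is
  trivial by minimality.\<close>

lemma irreducible_representation_on_minimal_subspace:
  fixes R :: "'a \<Rightarrow> ('x \<Rightarrow> complex) \<Rightarrow> 'x \<Rightarrow> complex"
  assumes W: "cfun.subspace W" "W \<subseteq> cfun.span C" "finite C" "W \<noteq> {\<lambda>x. 0}"
    and inv: "\<And>g w. g \<in> carrier G \<Longrightarrow> w \<in> W \<Longrightarrow> R g w \<in> W"
    and min: "\<And>U. cfun.subspace U \<Longrightarrow> U \<subseteq> W \<Longrightarrow> (\<And>g u. g \<in> carrier G \<Longrightarrow> u \<in> U \<Longrightarrow> R g u \<in> U) \<Longrightarrow>
       U = {\<lambda>x. 0} \<or> U = W"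
    and lin: "\<And>g n (c :: nat \<Rightarrow> complex) b. g \<in> carrier G \<Longrightarrow>
       R g (\<lambda>x. \<Sum>i<n. c i * b i x) = (\<lambda>x. \<Sum>i<n. c i * R g (b i) x)"
    and R_one: "\<And>w. w \<in> W \<Longrightarrow> R \<one> w = w"
    and R_mult: "\<And>g h w. g \<in> carrier G \<Longrightarrow> h \<in> carrier G \<Longrightarrow> R (g \<otimes> h) w = R g (R h w)"
  obtains n \<rho> b where "irreducible_representation G n \<rho>"
    and "W = range (\<lambda>c x. \<Sum>i<n. c i * b i x)"
    and "\<And>g j x. g \<in> carrier G \<Longrightarrow> j < n \<Longrightarrow> R g (b j) x = (\<Sum>i<n. \<rho> g $$ (i, j) * b i x)"
proof -
  obtain n :: nat and b :: "nat \<Rightarrow> 'x \<Rightarrow> complex" where b: "W = range (\<lambda>c x. \<Sum>i<n. c i * b i x)"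
    and ind: "\<And>c. (\<lambda>x. \<Sum>i<n. c i * b i x) = (\<lambda>x. 0) \<Longrightarrow> \<forall>i<n. c i = 0"
    by (rule subspace_coordinates[OF W(1-3)]) (rule that)
  define \<Psi> where "\<Psi> c = (\<lambda>x. \<Sum>i<n. c i * b i x)" for c
  have \<Psi>W: "\<Psi> c \<in> W" for c by (auto simp: b \<Psi>_def)
  have inj: "c i = d i" if "\<Psi> c = \<Psi> d" "i < n" for c d i
  proof -
    have "(\<lambda>x. \<Sum>i<n. (c i - d i) * b i x) = (\<lambda>x. 0)"
      using that(1) by (simp add: \<Psi>_def fun_eq_iff left_diff_distrib sum_subtractf)
    from ind[OF this] show ?thesis using that(2) by simp
  qed
  have b\<Psi>: "b j = \<Psi> (\<lambda>i. if i = j then 1 else 0)" if "j < n" for j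
  proof
    fix x
    have "(\<Sum>i<n. (if i = j then 1 else 0) * b i x) = (\<Sum>i<n. if i = j then b i x else 0)"
      by (intro sum.cong) auto
    then show "b j x = \<Psi> (\<lambda>i. if i = j then 1 else 0) x" using that by (simp add: \<Psi>_def)
  qed
  have bW: "b j \<in> W" if "j < n" for j using b\<Psi>[OF that] \<Psi>W by simp
  define co where "co g j = (SOME c. R g (b j) = \<Psi> c)" for g j
  have co: "R g (b j) = \<Psi> (co g j)" if "g \<in> carrier G" "j < n" for g j
  proof -
    have "R g (b j) \<in> range \<Psi>"
      using inv[OF that(1) bW[OF that(2)]] unfolding b \<Psi>_def .
    then show ?thesis unfolding co_def by (metis (mono_tags) rangeE someI)
  qed
  define \<rho> where "\<rho> g = mat n n (\<lambda>(i, j). co g j i)" for g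
  have \<rho>c: "\<rho> g \<in> carrier_mat n n" for g by (simp add: \<rho>_def)
  have Rb: "R g (b j) x = (\<Sum>i<n. \<rho> g $$ (i, j) * b i x)" if "g \<in> carrier G" "j < n" for g j x
    using co[OF that] that by (simp add: \<Psi>_def \<rho>_def)
  have act: "R g (\<Psi> c) = \<Psi> (\<lambda>i. \<Sum>j<n. \<rho> g $$ (i, j) * c j)" if g: "g \<in> carrier G" for g c
  proof
    fix x
    have "R g (\<Psi> c) x = (\<Sum>j<n. c j * R g (b j) x)"
      unfolding \<Psi>_def lin[OF g] ..
    also have "\<dots> = (\<Sum>j<n. \<Sum>i<n. \<rho> g $$ (i, j) * c j * b i x)"
      by (intro sum.cong refl) (simp add: Rb[OF g] sum_distrib_left mult_ac)
    also have "\<dots> = (\<Sum>i<n. \<Sum>j<n. \<rho> g $$ (i, j) * c j * b i x)" by (rule sum.swap)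
    also have "\<dots> = \<Psi> (\<lambda>i. \<Sum>j<n. \<rho> g $$ (i, j) * c j) x"
      by (simp add: \<Psi>_def sum_distrib_right)
    finally show "R g (\<Psi> c) x = \<Psi> (\<lambda>i. \<Sum>j<n. \<rho> g $$ (i, j) * c j) x" .
  qed
  have rep: "representation G n \<rho>"
    unfolding representation_def
  proof (intro conjI ballI)
    show "\<rho> \<one> = 1\<^sub>m n"
    proof (rule eq_matI)
      fix i j assume "i < dim_row (1\<^sub>m n)" "j < dim_col (1\<^sub>m n)"
      then have ij: "i < n" "j < n" by auto
      have "\<Psi> (co \<one> j) = \<Psi> (\<lambda>i. if i = j then 1 else 0)"
        using co[OF one_closed ij(2)] R_one[OF bW[OF ij(2)]] b\<Psi>[OF ij(2)] by simp
      from inj[OF this ij(1)] show "\<rho> \<one> $$ (i, j) = 1\<^sub>m n $$ (i, j)"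
        using ij by (simp add: \<rho>_def)
    qed (simp_all add: \<rho>_def)
    show "\<rho> (g \<otimes> h) = \<rho> g * \<rho> h" if gh: "g \<in> carrier G" "h \<in> carrier G" for g h
    proof (rule eq_matI)
      fix i j assume "i < dim_row (\<rho> g * \<rho> h)" "j < dim_col (\<rho> g * \<rho> h)"
      then have ij: "i < n" "j < n" by (auto simp: \<rho>_def)
      have "\<Psi> (co (g \<otimes> h) j) = R g (\<Psi> (co h j))"
        using co[OF m_closed[OF gh] ij(2)] co[OF gh(2) ij(2)] R_mult[OF gh] by simp
      also have "\<dots> = \<Psi> (\<lambda>i. \<Sum>k<n. \<rho> g $$ (i, k) * co h j k)" by (rule act[OF gh(1)])
      finally have "co (g \<otimes> h) j i = (\<Sum>k<n. \<rho> g $$ (i, k) * co h j k)"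
        by (rule inj[OF _ ij(1)])
      then show "\<rho> (g \<otimes> h) $$ (i, j) = (\<rho> g * \<rho> h) $$ (i, j)"
        unfolding mult_mat_entry[OF \<rho>c \<rho>c ij] using ij by (simp add: \<rho>_def)
    qed (simp_all add: \<rho>_def)
  qed (simp add: \<rho>_def)
  have n: "n > 0"
  proof (rule ccontr)
    assume "\<not> n > 0"
    then have "W = {\<lambda>x. 0}" by (auto simp: b)
    then show False using W(4) by contradiction
  qed
  have irr: "irreducible_representation G n \<rho>"
    unfolding irreducible_representation_def subspace_module_vec_iff
  proof (intro conjI allI impI rep n)
    fix V assume V: "V \<subseteq> carrier_vec n \<and> 0\<^sub>v n \<in> V \<and> (\<forall>v\<in>V. \<forall>w\<in>V. v + w \<in> V) \<and>
        (\<forall>c. \<forall>v\<in>V. c \<cdot>\<^sub>v v \<in> V)"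
      and Vinv: "\<forall>g\<in>carrier G. \<forall>w\<in>V. \<rho> g *\<^sub>v w \<in> V"
    have Vc: "v \<in> carrier_vec n" if "v \<in> V" for v using V that by blast
    define U where "U = (\<lambda>v. \<Psi> (\<lambda>i. v $ i)) ` V"
    have \<Psi>cong: "\<Psi> c = \<Psi> d" if "\<And>i. i < n \<Longrightarrow> c i = d i" for c d
      using that by (simp add: \<Psi>_def)
    have zero: "\<Psi> (\<lambda>i. 0\<^sub>v n $ i) = (\<lambda>x. 0)" by (simp add: \<Psi>_def)
    have "U = {\<lambda>x. 0} \<or> U = W"
    proof (rule min)
      show "cfun.subspace U"
      proof (rule cfun.subspaceI)
        show "0 \<in> U" unfolding U_def zero_fun_def
          by (rule image_eqI[of _ _ "0\<^sub>v n"]) (use V zero in auto)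
        show "u + w \<in> U" if "u \<in> U" "w \<in> U" for u w
        proof -
          from that obtain v v' where v: "v \<in> V" "v' \<in> V"
            and "u = \<Psi> (\<lambda>i. v $ i)" "w = \<Psi> (\<lambda>i. v' $ i)" by (auto simp: U_def)
          then have "u + w = \<Psi> (\<lambda>i. v $ i + v' $ i)"
            by (simp add: \<Psi>_def fun_eq_iff distrib_right sum.distrib)
          also have "\<dots> = \<Psi> (\<lambda>i. (v + v') $ i)"
            using Vc[OF v(1)] Vc[OF v(2)] by (intro \<Psi>cong) simp
          finally show ?thesis using V v by (auto simp: U_def)
        qed
        show "(\<lambda>x. c * u x) \<in> U" if "u \<in> U" for c u
        proof -
          from that obtain v where v: "v \<in> V" and "u = \<Psi> (\<lambda>i. v $ i)" by (auto simp: U_def)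
          then have "(\<lambda>x. c * u x) = \<Psi> (\<lambda>i. c * v $ i)"
            by (simp add: \<Psi>_def fun_eq_iff sum_distrib_left mult.assoc)
          also have "\<dots> = \<Psi> (\<lambda>i. (c \<cdot>\<^sub>v v) $ i)"
            using Vc[OF v(1)] by (intro \<Psi>cong) simp
          finally show ?thesis using V v by (auto simp: U_def)
        qed
      qed
      show "U \<subseteq> W" using \<Psi>W by (auto simp: U_def)
      show "R g u \<in> U" if g: "g \<in> carrier G" and "u \<in> U" for g u
      proof -
        from that obtain v where v: "v \<in> V" and u: "u = \<Psi> (\<lambda>i. v $ i)" by (auto simp: U_def)
        have "R g u = \<Psi> (\<lambda>i. (\<rho> g *\<^sub>v v) $ i)"
          unfolding u act[OF g] by (intro \<Psi>cong mult_mat_vec_entry[OF \<rho>c Vc[OF v], symmetric])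
        then show ?thesis using Vinv g v by (auto simp: U_def)
      qed
    qed
    then show "V = {0\<^sub>v n} \<or> V = carrier_vec n"
    proof
      assume U0: "U = {\<lambda>x. 0}"
      have "v = 0\<^sub>v n" if "v \<in> V" for v
      proof (rule eq_vecI)
        fix i assume "i < dim_vec (0\<^sub>v n)"
        moreover have "\<Psi> (\<lambda>i. v $ i) = \<Psi> (\<lambda>i. 0\<^sub>v n $ i)"
          using U0 that unfolding zero by (auto simp: U_def)
        ultimately show "v $ i = 0\<^sub>v n $ i" by (intro inj) simp_all
      qed (use Vc[OF that] in simp)
      then show ?thesis using V by blast
    next
      assume UW: "U = W"
      have "v \<in> V" if v: "v \<in> carrier_vec n" for v
      proof -
        have "\<Psi> (\<lambda>i. v $ i) \<in> U" unfolding UW by (rule \<Psi>W)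
        then obtain v' where v': "v' \<in> V" "\<Psi> (\<lambda>i. v $ i) = \<Psi> (\<lambda>i. v' $ i)"
          by (auto simp: U_def)
        have "v = v'" using inj[OF v'(2)] Vc[OF v'(1)] v by (intro eq_vecI) simp_all
        then show ?thesis using v'(1) by simp
      qed
      then show ?thesis using V by blast
    qed
  qed
  show thesis by (rule that[OF irr b Rb])
qed

text \<open>A class function is central in the group algebra: conjugation by \<open>g\<close> permutes the summands.\<close>

lemma class_function_commute:
  assumes "f \<in> class_functions G" "g \<in> carrier G"
  shows "(\<Sum>y\<in>carrier G. f y * F (inv y \<otimes> g)) = (\<Sum>y\<in>carrier G. f y * F (g \<otimes> inv y))"
proof (rule sum.reindex_bij_witness[of _ "\<lambda>y. g \<otimes> y \<otimes> inv g" "\<lambda>y. inv g \<otimes> y \<otimes> g"])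
  fix y assume y: "y \<in> carrier G"
  have conj: "f (h \<otimes> y \<otimes> inv h) = f y" if "h \<in> carrier G" for h
    using assms(1) y that by (simp add: class_functions_def)
  have "f (inv g \<otimes> y \<otimes> g) = f y" using conj[of "inv g"] assms(2) by simp
  moreover have "g \<otimes> inv (inv g \<otimes> y \<otimes> g) = inv y \<otimes> g"
    using y assms(2) by (simp add: inv_mult_group m_assoc[symmetric])
  ultimately show "f (inv g \<otimes> y \<otimes> g) * F (g \<otimes> inv (inv g \<otimes> y \<otimes> g)) = f y * F (inv y \<otimes> g)"
    by simp
next
  have "g \<otimes> (inv g \<otimes> a) = a" "inv g \<otimes> (g \<otimes> a) = a" if "a \<in> carrier G" for a
    using assms(2) that by (simp_all add: m_assoc[symmetric])
  then show "g \<otimes> (inv g \<otimes> a \<otimes> g) \<otimes> inv g = a" "inv g \<otimes> (g \<otimes> a \<otimes> inv g) \<otimes> g = a"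
    if "a \<in> carrier G" for a
    using assms(2) that by (simp_all add: m_assoc)
qed (use assms(2) in simp_all)

text \<open>The right regular representation, on functions that vanish outside the carrier.\<close>

definition right_translate :: "'a \<Rightarrow> ('a \<Rightarrow> complex) \<Rightarrow> 'a \<Rightarrow> complex" where
  "right_translate g a x = (if x \<in> carrier G then a (x \<otimes> g) else 0)"

text \<open>This is the sum of \<open>f y\<close> times right translation by \<open>inv y\<close>, that is, the action of \<open>f\<close> as an
  element of the group algebra in the right regular representation.\<close>

definition convolution_op :: "('a \<Rightarrow> complex) \<Rightarrow> ('a \<Rightarrow> complex) \<Rightarrow> 'a \<Rightarrow> complex" where
  "convolution_op f a x = (if x \<in> carrier G then \<Sum>y\<in>carrier G. f y * a (x \<otimes> inv y) else 0)"

lemma convolution_op_commutes: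
  assumes f: "f \<in> class_functions G" and g: "g \<in> carrier G"
  shows "convolution_op f (right_translate g a) = right_translate g (convolution_op f a)"
proof
  fix x
  show "convolution_op f (right_translate g a) x = right_translate g (convolution_op f a) x"
  proof (cases "x \<in> carrier G")
    case x: True
    have "convolution_op f (right_translate g a) x = (\<Sum>y\<in>carrier G. f y * a (x \<otimes> (inv y \<otimes> g)))"
      using x g by (simp add: convolution_op_def right_translate_def m_assoc)
    also have "\<dots> = (\<Sum>y\<in>carrier G. f y * a (x \<otimes> (g \<otimes> inv y)))"
      by (rule class_function_commute[OF f g])
    also have "\<dots> = right_translate g (convolution_op f a) x"
      using x g by (simp add: convolution_op_def right_translate_def m_assoc)
    finally show ?thesis .
  qed (simp add: convolution_op_def right_translate_def)
qed

text \<open>For the standard Hermitian form the adjoint \<open>Ts\<close> of this operator is again a combination of right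
  translations. So the operator is normal, and a normal operator has the same kernel as its
  square.\<close>

lemma convolution_op_kernel_square:
  assumes f: "f \<in> class_functions G" and a: "a \<in> funs_on (carrier G)"
    and zero: "convolution_op f (convolution_op f a) = (\<lambda>x. 0)"
  shows "convolution_op f a = (\<lambda>x. 0)"
proof -
  define ip where "ip u v = (\<Sum>x\<in>carrier G. u x * cnj (v x))" for u v :: "'a \<Rightarrow> complex"
  define Ts where "Ts u x = (if x \<in> carrier G then \<Sum>z\<in>carrier G. cnj (f z) * u (x \<otimes> z) else 0)"
    for u :: "'a \<Rightarrow> complex" and x
  have adj: "ip (convolution_op f u) v = ip u (Ts v)" for u v
  proof -
    have "ip (convolution_op f u) v = (\<Sum>x\<in>carrier G. \<Sum>y\<in>carrier G. f y * u (x \<otimes> inv y) * cnj (v x))"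
      by (simp add: ip_def convolution_op_def sum_distrib_right)
    also have "\<dots> = (\<Sum>y\<in>carrier G. \<Sum>x\<in>carrier G. f y * u (x \<otimes> inv y) * cnj (v x))"
      by (rule sum.swap)
    also have "\<dots> = (\<Sum>y\<in>carrier G. \<Sum>x\<in>carrier G. f y * u (x \<otimes> y \<otimes> inv y) * cnj (v (x \<otimes> y)))"
      by (intro sum.cong refl sum_right_translate[symmetric])
    also have "\<dots> = (\<Sum>y\<in>carrier G. \<Sum>x\<in>carrier G. u x * (f y * cnj (v (x \<otimes> y))))"
      by (intro sum.cong refl) (simp add: m_assoc mult_ac)
    also have "\<dots> = (\<Sum>x\<in>carrier G. \<Sum>y\<in>carrier G. u x * (f y * cnj (v (x \<otimes> y))))"
      by (rule sum.swap)
    also have "\<dots> = ip u (Ts v)"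
      by (simp add: ip_def Ts_def sum_distrib_left)
    finally show ?thesis .
  qed
  have pos: "u = (\<lambda>x. 0)" if "ip u u = 0" "u \<in> funs_on (carrier G)" for u
  proof
    fix x
    have "complex_of_real (\<Sum>x\<in>carrier G. (cmod (u x))\<^sup>2) = ip u u"
      by (simp add: ip_def complex_norm_square[symmetric])
    then have "(\<Sum>x\<in>carrier G. (cmod (u x))\<^sup>2) = 0" using that(1) by (simp only: of_real_eq_0_iff)
    then have "\<forall>x\<in>carrier G. (cmod (u x))\<^sup>2 = 0" by (subst (asm) sum_nonneg_eq_0_iff) auto
    then show "u x = 0" using that(2) by (cases "x \<in> carrier G") (auto simp: funs_on_def)
  qed
  define u where "u = convolution_op f a"
  have u: "convolution_op f u = (\<lambda>x. 0)" using zero by (simp add: u_def)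
  \<comment> \<open>\<open>Ts\<close> is a combination of right translations, which commute with \<open>convolution_op f\<close>\<close>
  have "convolution_op f (Ts u) = (\<lambda>x. 0)"
  proof
    fix x
    show "convolution_op f (Ts u) x = 0"
    proof (cases "x \<in> carrier G")
      case x: True
      have "convolution_op f (Ts u) x =
          (\<Sum>y\<in>carrier G. \<Sum>z\<in>carrier G. cnj (f z) * (f y * right_translate z u (x \<otimes> inv y)))"
        using x by (simp add: convolution_op_def Ts_def right_translate_def sum_distrib_left mult_ac)
      also have "\<dots> = (\<Sum>z\<in>carrier G. \<Sum>y\<in>carrier G. cnj (f z) * (f y * right_translate z u (x \<otimes> inv y)))"
        by (rule sum.swap)
      also have "\<dots> = (\<Sum>z\<in>carrier G. cnj (f z) * convolution_op f (right_translate z u) x)"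
        using x by (simp add: convolution_op_def sum_distrib_left)
      also have "\<dots> = 0"
        by (intro sum.neutral) (simp add: convolution_op_commutes[OF f] u right_translate_def)
      finally show ?thesis .
    qed (simp add: convolution_op_def)
  qed
  then have "ip (Ts u) (Ts u) = 0" using adj[of "Ts u" u] by (simp add: ip_def)
  then have "Ts u = (\<lambda>x. 0)" by (rule pos) (simp add: funs_on_def Ts_def)
  then have "ip u u = 0" using adj[of a u] by (simp add: u_def ip_def)
  then show ?thesis unfolding u_def by (rule pos) (simp add: funs_on_def convolution_op_def)
qed

text \<open>Suppose that \<open>f\<close> is not zero. Then the range \<open>I\<close> of \<open>convolution_op f\<close> contains \<open>f\<close>, is invariant
  under right translation, and so contains a minimal nonzero invariant subspace \<open>W\<close>. By Schur's
  lemma \<open>convolution_op f\<close> acts on \<open>W\<close> as a scalar \<open>\<mu>\<close>, and its trace there is the pairing of \<open>f\<close> with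
  the character of \<open>W\<close>, which is zero by hypothesis. So \<open>\<mu>\<close> is zero, and each element of \<open>W\<close>, being
  of the form \<open>convolution_op f a\<close>, is zero by normality.\<close>

lemma class_function_eq_zero:
  assumes f: "f \<in> class_functions G"
    and orth: "\<And>\<chi>. \<chi> \<in> Irr G \<Longrightarrow> (\<Sum>x\<in>carrier G. f x * \<chi> (inv x)) = 0"
  shows "f = (\<lambda>x. 0)"
proof (rule ccontr)
  assume fnz: "f \<noteq> (\<lambda>x. 0)"
  let ?C = "(\<lambda>a x. if x = a then 1 else 0) ` carrier G :: ('a \<Rightarrow> complex) set"
  let ?F = "funs_on (carrier G)"
  define I where "I = convolution_op f ` ?F"
  have IF: "I \<subseteq> ?F" by (auto simp: I_def funs_on_def convolution_op_def)
  have Ispan: "I \<subseteq> cfun.span ?C" using IF funs_on_subset_span[OF finite_carrier] by (rule subset_trans)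
  define good where "good W \<longleftrightarrow> cfun.subspace W \<and> W \<subseteq> I \<and> W \<noteq> {\<lambda>x. 0} \<and>
    (\<forall>g\<in>carrier G. \<forall>w\<in>W. right_translate g w \<in> W)" for W
  have "good I"
    unfolding good_def
  proof (intro conjI ballI)
    show "cfun.subspace I"
    proof (rule cfun.subspaceI)
      show "0 \<in> I" unfolding I_def
        by (rule image_eqI[of _ _ "\<lambda>x. 0"]) (auto simp: convolution_op_def funs_on_def)
      show "u + w \<in> I" if uw: "u \<in> I" "w \<in> I" for u w
      proof -
        from uw obtain a b where ab: "a \<in> ?F" "b \<in> ?F" "u = convolution_op f a" "w = convolution_op f b"
          by (auto simp: I_def)
        then have "u + w = convolution_op f (a + b)"
          by (simp add: fun_eq_iff convolution_op_def distrib_left sum.distrib)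
        moreover have "a + b \<in> ?F" using ab by (simp add: funs_on_def)
        ultimately show ?thesis unfolding I_def by (rule image_eqI)
      qed
      show "(\<lambda>x. c * u x) \<in> I" if u: "u \<in> I" for c u
      proof -
        from u obtain a where a: "a \<in> ?F" "u = convolution_op f a"
          by (auto simp: I_def)
        then have "(\<lambda>x. c * u x) = convolution_op f (\<lambda>x. c * a x)"
          by (simp add: fun_eq_iff convolution_op_def sum_distrib_left mult_ac)
        moreover have "(\<lambda>x. c * a x) \<in> ?F" using a by (simp add: funs_on_def)
        ultimately show ?thesis unfolding I_def by (rule image_eqI)
      qed
    qed
    have "f = convolution_op f (\<lambda>x. if x = \<one> then 1 else 0)"
    proof
      fix x
      show "f x = convolution_op f (\<lambda>x. if x = \<one> then 1 else 0) x"
      proof (cases "x \<in> carrier G")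
        case x: True
        have "f y * (if x \<otimes> inv y = \<one> then 1 else 0) = (if x = y then f y else 0)"
          if "y \<in> carrier G" for y
        proof -
          have "x \<otimes> inv y = \<one> \<longleftrightarrow> x = y"
            using x that inv_equality[of x "inv y"] by auto
          then show ?thesis by simp
        qed
        then show ?thesis using x by (simp add: convolution_op_def)
      qed (use f in \<open>simp add: convolution_op_def class_functions_def\<close>)
    qed
    moreover have "(\<lambda>x. if x = \<one> then 1 else 0) \<in> ?F" by (auto simp: funs_on_def)
    ultimately have "f \<in> I" unfolding I_def by (rule image_eqI)
    then show "I \<noteq> {\<lambda>x. 0}" using fnz by blast
    show "right_translate g w \<in> I" if g: "g \<in> carrier G" and "w \<in> I" for g w
    proof -
      from that obtain a where a: "a \<in> ?F" "w = convolution_op f a" by (auto simp: I_def)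
      then have "right_translate g w = convolution_op f (right_translate g a)"
        by (simp add: convolution_op_commutes[OF f g])
      moreover have "right_translate g a \<in> ?F" by (simp add: funs_on_def right_translate_def)
      ultimately show ?thesis unfolding I_def by (rule image_eqI)
    qed
  qed simp
  \<comment> \<open>minimal dimension serves as minimality under inclusion\<close>
  define W where "W = (ARG_MIN cfun.dim W. good W)"
  have "good W" and W_min: "\<And>U. good U \<Longrightarrow> cfun.dim W \<le> cfun.dim U"
    unfolding W_def by (rule arg_min_natI[of good, OF \<open>good I\<close>], rule arg_min_nat_le)
  then have W: "cfun.subspace W" "W \<subseteq> I" "W \<noteq> {\<lambda>x. 0}"
    and Winv: "\<And>g w. g \<in> carrier G \<Longrightarrow> w \<in> W \<Longrightarrow> right_translate g w \<in> W"
    unfolding good_def by simp_all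
  have Wspan: "W \<subseteq> cfun.span ?C" using W(2) Ispan by (rule subset_trans)
  obtain n \<rho> b where irr: "irreducible_representation G n \<rho>"
    and b: "W = range (\<lambda>c x. \<Sum>i<n. c i * b i x)"
    and \<rho>b: "\<And>g j x. g \<in> carrier G \<Longrightarrow> j < n \<Longrightarrow>
       right_translate g (b j) x = (\<Sum>i<n. \<rho> g $$ (i, j) * b i x)"
  proof (rule irreducible_representation_on_minimal_subspace[OF W(1) Wspan _ W(3), of right_translate])
    show "finite ?C" by simp
    show "U = {\<lambda>x. 0} \<or> U = W" if "cfun.subspace U" "U \<subseteq> W"
      "\<And>g u. g \<in> carrier G \<Longrightarrow> u \<in> U \<Longrightarrow> right_translate g u \<in> U" for U
    proof (rule disjCI)
      assume "U \<noteq> W"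
      then have "\<not> cfun.dim W \<le> cfun.dim U"
        using subspace_subset_if_dim_le[OF that(1,2) Wspan finite_imageI[OF finite_carrier]] that(2)
        by blast
      then have "\<not> good U" using W_min[of U] by blast
      moreover have "U \<subseteq> I" using that(2) W(2) by (rule subset_trans)
      ultimately show "U = {\<lambda>x. 0}" using that(1,3) unfolding good_def by blast
    qed
    show "right_translate \<one> w = w" if "w \<in> W" for w
    proof -
      have "w \<in> ?F" using that W(2) IF by blast
      then show ?thesis by (auto simp: right_translate_def funs_on_def fun_eq_iff)
    qed
    show "right_translate g (\<lambda>x. \<Sum>i<n. c i * b i x) =
        (\<lambda>x. \<Sum>i<n. c i * right_translate g (b i) x)" for g n c b
      by (simp add: right_translate_def fun_eq_iff)
    show "right_translate (g \<otimes> h) w = right_translate g (right_translate h w)"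
      if "g \<in> carrier G" "h \<in> carrier G" for g h w
      using that by (simp add: right_translate_def fun_eq_iff m_assoc)
    show "right_translate g w \<in> W" if "g \<in> carrier G" "w \<in> W" for g w
      using that by (rule Winv)
  qed (rule that)
  have n: "n > 0" and rep: "representation G n \<rho>"
    using irr by (auto simp: irreducible_representation_def)
  define \<Phi> where "\<Phi> = mat n n (\<lambda>(i, j). \<Sum>y\<in>carrier G. f y * \<rho> (inv y) $$ (i, j))"
  have \<Phi>c: "\<Phi> \<in> carrier_mat n n" by (simp add: \<Phi>_def)
  have comm: "\<rho> g * \<Phi> = \<Phi> * \<rho> g" if g: "g \<in> carrier G" for g
  proof (rule eq_matI)
    note c = representation_carrier[OF rep g]
    fix i j assume "i < dim_row (\<Phi> * \<rho> g)" "j < dim_col (\<Phi> * \<rho> g)"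
    then have ij: "i < n" "j < n" using \<Phi>c c by auto
    have "(\<rho> g * \<Phi>) $$ (i, j) = (\<Sum>k<n. \<Sum>y\<in>carrier G. f y * (\<rho> g $$ (i, k) * \<rho> (inv y) $$ (k, j)))"
      unfolding mult_mat_entry[OF c \<Phi>c ij] using ij
      by (intro sum.cong refl) (simp add: \<Phi>_def sum_distrib_left mult_ac)
    also have "\<dots> = (\<Sum>y\<in>carrier G. f y * \<rho> (g \<otimes> inv y) $$ (i, j))"
      by (subst sum.swap) (simp add: representation_mult_entry[OF rep g _ ij] sum_distrib_left)
    also have "\<dots> = (\<Sum>y\<in>carrier G. f y * \<rho> (inv y \<otimes> g) $$ (i, j))"
      by (rule class_function_commute[OF f g, symmetric])
    also have "\<dots> = (\<Sum>y\<in>carrier G. \<Sum>k<n. f y * (\<rho> (inv y) $$ (i, k) * \<rho> g $$ (k, j)))"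
      by (simp add: representation_mult_entry[OF rep _ g ij] sum_distrib_left)
    also have "\<dots> = (\<Sum>k<n. \<Sum>y\<in>carrier G. f y * (\<rho> (inv y) $$ (i, k) * \<rho> g $$ (k, j)))"
      by (rule sum.swap)
    also have "\<dots> = (\<Phi> * \<rho> g) $$ (i, j)"
      unfolding mult_mat_entry[OF \<Phi>c c ij] using ij
      by (intro sum.cong refl) (simp add: \<Phi>_def sum_distrib_right mult.assoc)
    finally show "(\<rho> g * \<Phi>) $$ (i, j) = (\<Phi> * \<rho> g) $$ (i, j)" .
  qed (use \<Phi>c representation_carrier[OF rep g] in auto)
  obtain \<mu> where \<mu>: "\<Phi> = \<mu> \<cdot>\<^sub>m 1\<^sub>m n"
    by (rule Schur_scalar[OF irr \<Phi>c comm])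
  have "of_nat n * \<mu> = (\<Sum>i<n. \<Phi> $$ (i, i))" by (simp add: \<mu>)
  also have "\<dots> = (\<Sum>i<n. \<Sum>y\<in>carrier G. f y * \<rho> (inv y) $$ (i, i))" by (simp add: \<Phi>_def)
  also have "\<dots> = (\<Sum>y\<in>carrier G. f y * character_of G n \<rho> (inv y))"
    by (subst sum.swap) (simp add: character_of_def sum_distrib_left)
  also have "\<dots> = 0" using orth irr by (auto simp: Irr_def)
  finally have \<Phi>0: "\<Phi> $$ (i, j) = 0" if "i < n" "j < n" for i j
    using n that by (simp add: \<mu>)
  have Tb: "convolution_op f (b j) x = 0" if j: "j < n" for j x
  proof (cases "x \<in> carrier G")
    case x: True
    have "convolution_op f (b j) x = (\<Sum>y\<in>carrier G. f y * right_translate (inv y) (b j) x)"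
      using x by (simp add: convolution_op_def right_translate_def)
    also have "\<dots> = (\<Sum>y\<in>carrier G. \<Sum>i<n. f y * \<rho> (inv y) $$ (i, j) * b i x)"
      using j by (simp add: \<rho>b sum_distrib_left mult.assoc)
    also have "\<dots> = (\<Sum>i<n. \<Sum>y\<in>carrier G. f y * \<rho> (inv y) $$ (i, j) * b i x)"
      by (rule sum.swap)
    also have "\<dots> = (\<Sum>i<n. \<Phi> $$ (i, j) * b i x)"
      using j by (simp add: \<Phi>_def sum_distrib_right)
    finally show ?thesis using j by (simp add: \<Phi>0)
  qed (simp add: convolution_op_def)
  have "w = (\<lambda>x. 0)" if w: "w \<in> W" for w
  proof -
    from w obtain c where c: "w = (\<lambda>x. \<Sum>i<n. c i * b i x)" unfolding b by (rule rangeE)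
    have "convolution_op f w x = (\<Sum>i<n. c i * convolution_op f (b i) x)" for x
    proof (cases "x \<in> carrier G")
      case x: True
      have "convolution_op f w x = (\<Sum>y\<in>carrier G. \<Sum>i<n. c i * (f y * b i (x \<otimes> inv y)))"
        using x by (simp add: convolution_op_def c sum_distrib_left mult.left_commute)
      also have "\<dots> = (\<Sum>i<n. \<Sum>y\<in>carrier G. c i * (f y * b i (x \<otimes> inv y)))"
        by (rule sum.swap)
      finally show ?thesis using x by (simp add: convolution_op_def sum_distrib_left)
    qed (simp add: convolution_op_def)
    then have "convolution_op f w = (\<lambda>x. 0)" by (simp add: Tb fun_eq_iff)
    moreover from w W(2) obtain a where "a \<in> ?F" "w = convolution_op f a" by (auto simp: I_def)
    ultimately show ?thesis using convolution_op_kernel_square[OF f] by simp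
  qed
  moreover have "(\<lambda>x. 0) \<in> W" using cfun.subspace_0[OF W(1)] by (simp add: zero_fun_def)
  ultimately have "W = {\<lambda>x. 0}" by blast
  then show False using W(3) by contradiction
qed

end


section \<open>Spaces of functions that are constant on the blocks of a partition\<close>

abbreviation ind :: "'a set \<Rightarrow> 'a \<Rightarrow> complex" where
  "ind K \<equiv> (\<lambda>x. if x \<in> K then 1 else 0)"

text \<open>The functions vanish outside the union of the blocks, in accordance with the convention for
  functions on a group; with this convention the space determines the partition.\<close>

definition block_functions :: "'a set set \<Rightarrow> ('a \<Rightarrow> complex) set" where
  "block_functions P = {f \<in> funs_on (\<Union>P). \<forall>K\<in>P. \<forall>x\<in>K. \<forall>y\<in>K. f x = f y}"

lemma block_functionsI:
  assumes "f \<in> funs_on (\<Union>P)" and "\<And>K x y. K \<in> P \<Longrightarrow> x \<in> K \<Longrightarrow> y \<in> K \<Longrightarrow> f x = f y"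
  shows "f \<in> block_functions P"
  unfolding block_functions_def using assms by blast

lemma block_functionsD:
  "f \<in> block_functions P \<Longrightarrow> K \<in> P \<Longrightarrow> x \<in> K \<Longrightarrow> y \<in> K \<Longrightarrow> f x = f y"
  unfolding block_functions_def by blast

lemma block_functions_funs_on: "f \<in> block_functions P \<Longrightarrow> f \<in> funs_on (\<Union>P)"
  by (simp add: block_functions_def)

lemma subspace_block_functions: "cfun.subspace (block_functions P)"
proof (rule cfun.subspaceI)
  show "0 \<in> block_functions P" by (rule block_functionsI) (simp_all add: funs_on_def)
next
  fix u v assume uv: "u \<in> block_functions P" "v \<in> block_functions P"
  show "u + v \<in> block_functions P"
  proof (rule block_functionsI)
    show "u + v \<in> funs_on (\<Union>P)" using uv[THEN block_functions_funs_on] by (simp add: funs_on_def)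
    show "(u + v) x = (u + v) y" if "K \<in> P" "x \<in> K" "y \<in> K" for K x y
      using block_functionsD[OF uv(1) that] block_functionsD[OF uv(2) that] by simp
  qed
next
  fix c :: complex and u assume u: "u \<in> block_functions P"
  show "(\<lambda>x. c * u x) \<in> block_functions P"
  proof (rule block_functionsI)
    show "(\<lambda>x. c * u x) \<in> funs_on (\<Union>P)" using u[THEN block_functions_funs_on] by (simp add: funs_on_def)
    show "c * u x = c * u y" if "K \<in> P" "x \<in> K" "y \<in> K" for K x y
      using block_functionsD[OF u that] by simp
  qed
qed

lemma ind_block_function:
  assumes "disjoint P" "K \<in> P"
  shows "ind K \<in> block_functions P"
proof -
  have iff: "x \<in> K \<longleftrightarrow> y \<in> K" if "L \<in> P" "x \<in> L" "y \<in> L" for L x y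
  proof (cases "L = K")
    case False
    then have "L \<inter> K = {}" using assms that(1) by (auto simp: disjoint_def)
    then show ?thesis using that by blast
  qed (use that in simp)
  have "ind K x = ind K y" if "L \<in> P" "x \<in> L" "y \<in> L" for L x y
    unfolding iff[OF that] ..
  moreover have "ind K \<in> funs_on (\<Union>P)" using assms(2) by (auto simp: funs_on_def)
  ultimately show ?thesis by (intro block_functionsI)
qed

lemma span_family:
  assumes "finite I"
  shows "cfun.span (F ` I) = range (\<lambda>u x. \<Sum>i\<in>I. u i * F i x)"
proof
  show "cfun.span (F ` I) \<subseteq> range (\<lambda>u x. \<Sum>i\<in>I. u i * F i x)"
  proof (rule cfun.span_minimal)
    show "F ` I \<subseteq> range (\<lambda>u x. \<Sum>i\<in>I. u i * F i x)"
    proof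
      fix f assume "f \<in> F ` I"
      then obtain j where j: "j \<in> I" "f = F j" by blast
      have "(\<Sum>i\<in>I. (if i = j then 1 else 0) * F i x) = (\<Sum>i\<in>I. if i = j then F i x else 0)" for x
        by (intro sum.cong) auto
      then have "f = (\<lambda>x. \<Sum>i\<in>I. (if i = j then 1 else 0) * F i x)"
        using j assms by (simp add: fun_eq_iff)
      then show "f \<in> range (\<lambda>u x. \<Sum>i\<in>I. u i * F i x)"
        by (intro image_eqI[of _ _ "\<lambda>i. if i = j then 1 else 0"]) simp_all
    qed
    show "cfun.subspace (range (\<lambda>u x. \<Sum>i\<in>I. u i * F i x))"
    proof (rule cfun.subspaceI)
      show "0 \<in> range (\<lambda>u x. \<Sum>i\<in>I. u i * F i x)"
        by (rule image_eqI[of _ _ "\<lambda>i. 0"]) (simp_all add: fun_eq_iff)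
    next
      fix f g assume "f \<in> range (\<lambda>u x. \<Sum>i\<in>I. u i * F i x)" "g \<in> range (\<lambda>u x. \<Sum>i\<in>I. u i * F i x)"
      then obtain u v where "f = (\<lambda>x. \<Sum>i\<in>I. u i * F i x)" "g = (\<lambda>x. \<Sum>i\<in>I. v i * F i x)"
        by (elim rangeE)
      then show "f + g \<in> range (\<lambda>u x. \<Sum>i\<in>I. u i * F i x)"
        by (intro image_eqI[of _ _ "\<lambda>i. u i + v i"])
           (simp_all add: fun_eq_iff distrib_right sum.distrib)
    next
      fix c :: complex and f assume "f \<in> range (\<lambda>u x. \<Sum>i\<in>I. u i * F i x)"
      then obtain u where "f = (\<lambda>x. \<Sum>i\<in>I. u i * F i x)" by (elim rangeE)
      then show "(\<lambda>x. c * f x) \<in> range (\<lambda>u x. \<Sum>i\<in>I. u i * F i x)"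
        by (intro image_eqI[of _ _ "\<lambda>i. c * u i"])
           (simp_all add: fun_eq_iff sum_distrib_left mult.assoc)
    qed
  qed
  show "range (\<lambda>u x. \<Sum>i\<in>I. u i * F i x) \<subseteq> cfun.span (F ` I)"
  proof
    fix f assume "f \<in> range (\<lambda>u x. \<Sum>i\<in>I. u i * F i x)"
    then obtain u where "f = (\<lambda>x. \<Sum>i\<in>I. u i * F i x)" by (elim rangeE)
    then have "f = (\<Sum>i\<in>I. (\<lambda>x. u i * F i x))" by (simp add: fun_eq_iff sum_fun_apply)
    also have "\<dots> \<in> cfun.span (F ` I)"
      by (intro cfun.span_sum cfun.span_scale cfun.span_base) auto
    finally show "f \<in> cfun.span (F ` I)" .
  qed
qed

lemma dim_span_family:
  assumes fin: "finite I"
    and ind: "\<And>u i. (\<And>x. (\<Sum>i\<in>I. u i * F i x) = 0) \<Longrightarrow> i \<in> I \<Longrightarrow> u i = 0"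
  shows "cfun.dim (cfun.span (F ` I)) = card I"
proof -
  have delta: "(\<Sum>k\<in>I. (if k = i then c else 0) * F k x) = c * F i x" if "i \<in> I" for i c x
  proof -
    have "(\<Sum>k\<in>I. (if k = i then c else 0) * F k x) = (\<Sum>k\<in>I. if k = i then c * F k x else 0)"
      by (intro sum.cong) auto
    then show ?thesis using that fin by simp
  qed
  have inj: "inj_on F I"
  proof (rule inj_onI, rule ccontr)
    fix i j assume ij: "i \<in> I" "j \<in> I" "F i = F j" "i \<noteq> j"
    define u where "u k = (if k = i then 1 else 0) + (if k = j then -1 else (0::complex))" for k
    have "(\<Sum>k\<in>I. u k * F k x) = 0" for x
      using delta[OF ij(1), of 1 x] delta[OF ij(2), of "-1" x] ij(3)
      by (simp add: u_def distrib_right sum.distrib)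
    from ind[OF this ij(1)] show False using ij(4) by (simp add: u_def)
  qed
  have "cfun.independent (F ` I)"
  proof (rule cfun.independent_if_scalars_zero)
    fix u v assume u: "(\<Sum>v\<in>F ` I. (\<lambda>x. u v * v x)) = 0" and "v \<in> F ` I"
    then obtain i where i: "i \<in> I" "v = F i" by blast
    have "(\<Sum>k\<in>I. u (F k) * F k x) = 0" for x
    proof -
      have "(\<Sum>k\<in>I. u (F k) * F k x) = (\<Sum>v\<in>F ` I. (\<lambda>x. u v * v x)) x"
        by (simp add: sum_fun_apply sum.reindex[OF inj])
      then show ?thesis by (simp add: u)
    qed
    from ind[OF this i(1)] show "u v = 0" by (simp add: i(2))
  qed (simp add: fin)
  then show ?thesis using card_image[OF inj] cfun.dim_eq_card_independent[of "F ` I"]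
    by simp
qed

lemma sum_ind_block:
  assumes "finite P" "disjoint P" "K \<in> P" "x \<in> K"
  shows "(\<Sum>L\<in>P. u L * ind L x) = u K"
proof -
  have "u L * ind L x = (if L = K then u K else 0)" if "L \<in> P" for L
  proof (cases "L = K")
    case False
    then have "L \<inter> K = {}" using assms(2,3) that unfolding disjoint_def by blast
    then have "x \<notin> L" using assms(4) by blast
    then show ?thesis using False by simp
  qed (use assms(4) in simp)
  then have "(\<Sum>L\<in>P. u L * ind L x) = (\<Sum>L\<in>P. if L = K then u K else 0)"
    by (rule sum.cong[OF refl])
  then show ?thesis using assms by simp
qed

lemma block_functions_eq_span:
  assumes P: "partition_on A P" and fin: "finite P"
  shows "block_functions P = cfun.span (ind ` P)"
proof
  have disj: "disjoint P" using P by (simp add: partition_on_def)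
  show "cfun.span (ind ` P) \<subseteq> block_functions P"
    by (intro cfun.span_minimal subspace_block_functions image_subsetI ind_block_function[OF disj])
  show "block_functions P \<subseteq> cfun.span (ind ` P)"
  proof
    fix f assume f: "f \<in> block_functions P"
    define u where "u K = f (SOME x. x \<in> K)" for K
    have "f x = (\<Sum>K\<in>P. u K * ind K x)" for x
    proof (cases "x \<in> \<Union>P")
      case True
      then obtain K where K: "K \<in> P" "x \<in> K" by blast
      have "(SOME x. x \<in> K) \<in> K" using K(2) by (rule someI)
      then have "f x = u K" unfolding u_def by (rule block_functionsD[OF f K])
      then show ?thesis using sum_ind_block[OF fin disj K] by simp
    next
      case False
      then have "(\<Sum>K\<in>P. u K * ind K x) = 0" by (intro sum.neutral) auto
      then show ?thesis using False block_functions_funs_on[OF f] by (simp add: funs_on_def)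
    qed
    then show "f \<in> cfun.span (ind ` P)"
      unfolding span_family[OF fin] by (intro image_eqI[of _ _ u]) (simp_all add: fun_eq_iff)
  qed
qed

lemma dim_block_functions:
  assumes P: "partition_on A P" and fin: "finite P"
  shows "cfun.dim (block_functions P) = card P"
  unfolding block_functions_eq_span[OF assms]
proof (rule dim_span_family[OF fin])
  fix u K assume z: "\<And>x. (\<Sum>K\<in>P. u K * ind K x) = 0" and K: "K \<in> P"
  from P K have "K \<noteq> {}" by (auto simp: partition_on_def)
  then obtain x where "x \<in> K" by blast
  then show "u K = 0"
    using sum_ind_block[OF fin _ K, of x u] z[of x] P by (simp add: partition_on_def)
qed

lemma partition_block_subset: "partition_on A P \<Longrightarrow> K \<in> P \<Longrightarrow> K \<subseteq> A"
  by (auto simp: partition_on_def)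

text \<open>The blocks are the level sets of the whole space, since it contains their indicator functions.\<close>

lemma partition_of_block_functions:
  assumes P: "partition_on A P"
  shows "P = (\<lambda>x. {y \<in> A. \<forall>f\<in>block_functions P. f x = f y}) ` A"
proof -
  have disj: "disjoint P" and A: "A = \<Union>P" using P by (auto simp: partition_on_def)
  have block: "{y \<in> A. \<forall>f\<in>block_functions P. f x = f y} = K" if K: "K \<in> P" and x: "x \<in> K" for K x
  proof
    show "{y \<in> A. \<forall>f\<in>block_functions P. f x = f y} \<subseteq> K"
    proof
      fix y assume "y \<in> {y \<in> A. \<forall>f\<in>block_functions P. f x = f y}"
      then have "\<forall>f\<in>block_functions P. f x = f y" by simp
      then have "ind K x = ind K y" using ind_block_function[OF disj K] by (rule bspec)
      then show "y \<in> K" using x by (simp split: if_splits)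
    qed
    show "K \<subseteq> {y \<in> A. \<forall>f\<in>block_functions P. f x = f y}"
    proof
      fix y assume y: "y \<in> K"
      have "f x = f y" if "f \<in> block_functions P" for f
        using that K x y by (rule block_functionsD)
      then show "y \<in> {y \<in> A. \<forall>f\<in>block_functions P. f x = f y}" using y K A by blast
    qed
  qed
  show ?thesis
  proof
    show "P \<subseteq> (\<lambda>x. {y \<in> A. \<forall>f\<in>block_functions P. f x = f y}) ` A"
    proof
      fix K assume K: "K \<in> P"
      with P have "K \<noteq> {}" by (auto simp: partition_on_def)
      then obtain x where "x \<in> K" by blast
      then show "K \<in> (\<lambda>x. {y \<in> A. \<forall>f\<in>block_functions P. f x = f y}) ` A"
        using block[OF K, of x] K A by (intro image_eqI[of _ _ x]) blast+
    qed
    show "(\<lambda>x. {y \<in> A. \<forall>f\<in>block_functions P. f x = f y}) ` A \<subseteq> P"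
    proof
      fix L assume "L \<in> (\<lambda>x. {y \<in> A. \<forall>f\<in>block_functions P. f x = f y}) ` A"
      then obtain x where x: "x \<in> A" "L = {y \<in> A. \<forall>f\<in>block_functions P. f x = f y}" by blast
      then obtain K where K: "K \<in> P" "x \<in> K" using A by blast
      show "L \<in> P" unfolding x(2) block[OF K] by (rule K(1))
    qed
  qed
qed

lemma block_functions_inject:
  assumes "partition_on A P" "partition_on A Q" "block_functions P = block_functions Q"
  shows "P = Q"
proof -
  have "P = (\<lambda>x. {y \<in> A. \<forall>f\<in>block_functions Q. f x = f y}) ` A"
    unfolding assms(3)[symmetric] by (rule partition_of_block_functions[OF assms(1)])
  also have "\<dots> = Q" by (rule partition_of_block_functions[OF assms(2), symmetric])
  finally show ?thesis .
qed

text \<open>The finite case of the Stone--Weierstrass theorem. A product of interpolation factors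
  \<open>(f - f t) / (f x - f t)\<close>, one for each point \<open>t\<close> that some \<open>f\<close> in \<open>S\<close> separates from \<open>x\<close>, is the
  indicator function of the level set of \<open>x\<close>.\<close>

lemma function_algebra_block_functions:
  assumes fin: "finite A" and sub: "cfun.subspace S" and SA: "S \<subseteq> funs_on A"
    and mult: "\<And>f g. f \<in> S \<Longrightarrow> g \<in> S \<Longrightarrow> (\<lambda>x. f x * g x) \<in> S"
    and one: "ind A \<in> S"
  obtains P where "partition_on A P" "S = block_functions P"
proof -
  define cls where "cls x = {y \<in> A. \<forall>f\<in>S. f x = f y}" for x
  define P where "P = cls ` A"
  have cls_refl: "x \<in> cls x" if "x \<in> A" for x using that by (simp add: cls_def)
  have eq: "cls x = cls y" if z: "z \<in> cls x" "z \<in> cls y" for x y z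
  proof -
    have xy: "f x = f y" if f: "f \<in> S" for f
    proof -
      have "f x = f z" "f y = f z" using z f unfolding cls_def by blast+
      then show ?thesis by (rule trans[OF _ sym])
    qed
    have "(\<forall>f\<in>S. f x = f w) = (\<forall>f\<in>S. f y = f w)" for w
    proof (rule ball_cong[OF refl])
      fix f assume "f \<in> S"
      from xy[OF this] show "(f x = f w) = (f y = f w)" by simp
    qed
    then show ?thesis by (simp only: cls_def)
  qed
  have P: "partition_on A P"
    unfolding partition_on_def
  proof (intro conjI)
    show "\<Union>P = A"
    proof
      show "\<Union>P \<subseteq> A" unfolding P_def cls_def by (rule UN_least) (rule Collect_restrict)
      show "A \<subseteq> \<Union>P" unfolding P_def using cls_refl by (intro subsetI UN_I)
    qed
    show "disjoint P"
    proof (rule disjointI)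
      fix K L assume KL: "K \<in> P" "L \<in> P" "K \<noteq> L"
      then obtain x y where xy: "K = cls x" "L = cls y" by (auto simp: P_def)
      show "K \<inter> L = {}"
      proof (rule equals0I)
        fix z assume "z \<in> K \<inter> L"
        then have "K = L" using eq[of z x y] by (simp add: xy)
        then show False using KL(3) by contradiction
      qed
    qed
    show "{} \<notin> P"
    proof
      assume "{} \<in> P"
      then obtain x where "x \<in> A" "{} = cls x" unfolding P_def by (elim imageE)
      then show False using cls_refl[of x] by simp
    qed
  qed
  have sep: "\<exists>e\<in>S. e x = 1 \<and> (\<forall>t\<in>T. e t = 0)"
    if x: "x \<in> A" and "finite T" "T \<subseteq> A - cls x" for x T
    using that(2,3)
  proof (induction T rule: finite_induct)
    case empty
    then show ?case using x one by (intro bexI[of _ "ind A"]) simp_all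
  next
    case (insert t T)
    then obtain e where e: "e \<in> S" "e x = 1" "\<forall>t\<in>T. e t = 0" by blast
    from insert.prems have "t \<in> A" "t \<notin> cls x" by blast+
    then obtain f where f: "f \<in> S" "f x \<noteq> f t" unfolding cls_def by blast
    \<comment> \<open>the factor that is 1 at \<open>x\<close> and 0 at \<open>t\<close>; \<open>ind A\<close> plays the part of the constant 1\<close>
    define g where "g = (\<lambda>y. inverse (f x - f t) * (f y - f t * ind A y))"
    have "g = (\<lambda>y. inverse (f x - f t) * (f - (\<lambda>y. f t * ind A y)) y)" by (simp add: g_def)
    also have "\<dots> \<in> S"
      using f(1) one by (intro cfun.subspace_scale[OF sub] cfun.subspace_diff[OF sub])
    finally have "(\<lambda>y. e y * g y) \<in> S" by (rule mult[OF e(1)])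
    moreover have "g x = 1" "g t = 0" using x \<open>t \<in> A\<close> f(2) by (simp_all add: g_def)
    ultimately show ?case using e(2,3) by (intro bexI[of _ "\<lambda>y. e y * g y"]) simp_all
  qed
  have ind_S: "ind K \<in> S" if "K \<in> P" for K
  proof -
    from that obtain x where x: "x \<in> A" "K = cls x" by (auto simp: P_def)
    have "\<exists>e\<in>S. e x = 1 \<and> (\<forall>t\<in>A - cls x. e t = 0)"
      by (rule sep[OF x(1) _ subset_refl]) (simp add: fin)
    then obtain e where e: "e \<in> S" "e x = 1" "\<forall>t\<in>A - cls x. e t = 0" by blast
    have "e = ind K"
    proof
      fix y
      consider "y \<in> K" | "y \<in> A - K" | "y \<notin> A" by blast
      then show "e y = ind K y"
      proof cases
        case 1
        then have "e x = e y" using e(1) unfolding x(2) cls_def by blast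
        then show ?thesis using 1 e(2) by simp
      next
        case 2
        then show ?thesis using e(3) by (simp add: x(2))
      next
        case 3
        then have "e y = 0" using e(1) SA by (auto simp: funs_on_def)
        then show ?thesis using 3 by (simp add: x(2) cls_def)
      qed
    qed
    then show ?thesis using e(1) by simp
  qed
  have finP: "finite P" using fin by (simp add: P_def)
  have "S = block_functions P"
  proof
    show "S \<subseteq> block_functions P"
    proof
      fix f assume f: "f \<in> S"
      show "f \<in> block_functions P"
      proof (rule block_functionsI)
        show "f \<in> funs_on (\<Union>P)" using f SA P by (auto simp: partition_on_def)
        show "f y = f z" if "K \<in> P" "y \<in> K" "z \<in> K" for K y z
      proof -
        from that obtain x where "K = cls x" by (auto simp: P_def)
        then have "f x = f y" "f x = f z" using that f unfolding cls_def by blast+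
        then show ?thesis by simp
      qed
      qed
    qed
    show "block_functions P \<subseteq> S"
      unfolding block_functions_eq_span[OF P finP]
    proof (rule cfun.span_minimal[OF _ sub])
      show "ind ` P \<subseteq> S" using ind_S by (rule image_subsetI)
    qed
  qed
  with P show thesis by (rule that)
qed


section \<open>The two partitions of a supercharacter theory\<close>

context finite_group
begin

lemma class_functions_funs_on: "class_functions G \<subseteq> funs_on (carrier G)"
  by (auto simp: class_functions_def funs_on_def)

lemma class_functionsI:
  assumes "\<And>g. g \<notin> carrier G \<Longrightarrow> f g = 0"
    and "\<And>g h. g \<in> carrier G \<Longrightarrow> h \<in> carrier G \<Longrightarrow> f (h \<otimes> g \<otimes> inv h) = f g"
  shows "f \<in> class_functions G"
  unfolding class_functions_def using assms by blast

lemma class_functions_conjugate: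
  "f \<in> class_functions G \<Longrightarrow> g \<in> carrier G \<Longrightarrow> h \<in> carrier G \<Longrightarrow> f (h \<otimes> g \<otimes> inv h) = f g"
  unfolding class_functions_def by blast

lemma class_functions_outside: "f \<in> class_functions G \<Longrightarrow> g \<notin> carrier G \<Longrightarrow> f g = 0"
  unfolding class_functions_def by blast

lemma convolution_sum_left:
  "convolution G (\<lambda>x. \<Sum>i\<in>I. c i * F i x) \<beta> g = (\<Sum>i\<in>I. c i * convolution G (F i) \<beta> g)"
proof (cases "g \<in> carrier G")
  case True
  have "(\<Sum>x\<in>carrier G. (\<Sum>i\<in>I. c i * F i (x \<otimes> g)) * \<beta> (inv x)) =
      (\<Sum>x\<in>carrier G. \<Sum>i\<in>I. c i * (F i (x \<otimes> g) * \<beta> (inv x)))"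
    by (simp add: sum_distrib_right mult.assoc)
  also have "\<dots> = (\<Sum>i\<in>I. \<Sum>x\<in>carrier G. c i * (F i (x \<otimes> g) * \<beta> (inv x)))"
    by (rule sum.swap)
  finally show ?thesis using True
    by (simp add: convolution_def sum_distrib_left sum_divide_distrib)
qed (simp add: convolution_def)

lemma convolution_sum_right:
  "convolution G \<alpha> (\<lambda>x. \<Sum>i\<in>I. c i * F i x) g = (\<Sum>i\<in>I. c i * convolution G \<alpha> (F i) g)"
proof (cases "g \<in> carrier G")
  case True
  have "(\<Sum>x\<in>carrier G. \<alpha> (x \<otimes> g) * (\<Sum>i\<in>I. c i * F i (inv x))) =
      (\<Sum>x\<in>carrier G. \<Sum>i\<in>I. c i * (\<alpha> (x \<otimes> g) * F i (inv x)))"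
    by (simp add: sum_distrib_left mult.left_commute)
  also have "\<dots> = (\<Sum>i\<in>I. \<Sum>x\<in>carrier G. c i * (\<alpha> (x \<otimes> g) * F i (inv x)))"
    by (rule sum.swap)
  finally show ?thesis using True
    by (simp add: convolution_def sum_distrib_left sum_divide_distrib)
qed (simp add: convolution_def)

lemma Irr_class_function:
  assumes "\<chi> \<in> Irr G"
  shows "\<chi> \<in> class_functions G"
proof -
  from assms obtain n \<rho> where r: "irreducible_representation G n \<rho>" "\<chi> = character_of G n \<rho>"
    by (rule IrrE)
  have rep: "representation G n \<rho>" using r(1) by (simp add: irreducible_representation_def)
  \<comment> \<open>the trace of a product does not depend on the order of the factors\<close>
  have tr: "\<chi> (a \<otimes> b) = \<chi> (b \<otimes> a)" if ab: "a \<in> carrier G" "b \<in> carrier G" for a b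
  proof -
    have "\<chi> (a \<otimes> b) = (\<Sum>i<n. \<Sum>k<n. \<rho> a $$ (i, k) * \<rho> b $$ (k, i))"
      using ab by (simp add: r(2) character_of_def representation_mult_entry[OF rep])
    also have "\<dots> = (\<Sum>k<n. \<Sum>i<n. \<rho> a $$ (i, k) * \<rho> b $$ (k, i))" by (rule sum.swap)
    also have "\<dots> = (\<Sum>k<n. \<Sum>i<n. \<rho> b $$ (k, i) * \<rho> a $$ (i, k))" by (simp only: mult.commute)
    also have "\<dots> = \<chi> (b \<otimes> a)"
      using ab by (simp add: r(2) character_of_def representation_mult_entry[OF rep])
    finally show ?thesis .
  qed
  have "\<chi> (h \<otimes> g \<otimes> inv h) = \<chi> g" if gh: "g \<in> carrier G" "h \<in> carrier G" for g h
  proof -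
    have "\<chi> (h \<otimes> g \<otimes> inv h) = \<chi> (inv h \<otimes> (h \<otimes> g))" using gh by (intro tr) simp_all
    also have "inv h \<otimes> (h \<otimes> g) = g" using gh by (simp add: m_assoc[symmetric])
    finally show ?thesis .
  qed
  moreover have "\<chi> g = 0" if "g \<notin> carrier G" for g
    using that by (simp add: r(2) character_of_def)
  ultimately show ?thesis by (simp add: class_functions_def)
qed

text \<open>Convolution with \<open>\<psi>\<close> extracts the coefficient of \<open>\<psi>\<close> from a linear combination, so the
  irreducible characters are independent in a finite-dimensional space.\<close>

lemma finite_Irr: "finite (Irr G)"
proof -
  have "cfun.independent (Irr G)"
    unfolding cfun.independent_explicit_finite_subsets
  proof (intro allI impI ballI)
    fix A u \<psi>
    assume A: "A \<subseteq> Irr G" "finite A" and z: "(\<Sum>\<chi>\<in>A. (\<lambda>x. u \<chi> * \<chi> x)) = 0" and \<psi>: "\<psi> \<in> A"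
    have z': "(\<lambda>x. \<Sum>\<chi>\<in>A. u \<chi> * \<chi> x) = (\<lambda>x. 0)"
      using z by (simp add: fun_eq_iff sum_fun_apply)
    have "0 = convolution G (\<lambda>x. \<Sum>\<chi>\<in>A. u \<chi> * \<chi> x) \<psi> \<one>"
      unfolding z' by (simp add: convolution_def)
    also have "\<dots> = (\<Sum>\<chi>\<in>A. u \<chi> * convolution G \<chi> \<psi> \<one>)" by (rule convolution_sum_left)
    also have "\<dots> = (\<Sum>\<chi>\<in>A. if \<chi> = \<psi> then u \<chi> else 0)"
    proof (rule sum.cong[OF refl])
      fix \<chi> assume "\<chi> \<in> A"
      then have "\<chi> \<in> Irr G" "\<psi> \<in> Irr G" using A \<psi> by blast+
      then show "u \<chi> * convolution G \<chi> \<psi> \<one> = (if \<chi> = \<psi> then u \<chi> else 0)"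
        by (simp add: convolution_Irr Irr_one_nonzero)
    qed
    also have "\<dots> = u \<psi>" using A(2) \<psi> by simp
    finally show "u \<psi> = 0" by simp
  qed
  moreover have "Irr G \<subseteq> cfun.span ((\<lambda>a x. if x = a then 1 else 0) ` carrier G)"
    using Irr_class_function class_functions_funs_on funs_on_subset_span[OF finite_carrier] by blast
  ultimately show ?thesis
    using cfun.independent_span_bound[OF finite_imageI[OF finite_carrier]] by blast
qed

text \<open>The factor \<open>\<chi> \<one>\<close> makes \<open>\<chi> \<one> * \<chi> g\<close> an idempotent for the convolution, so that pointwise
  multiplication of coefficients becomes convolution of functions.\<close>

definition inverse_fourier :: "(('a \<Rightarrow> complex) \<Rightarrow> complex) \<Rightarrow> 'a \<Rightarrow> complex" where
  "inverse_fourier c = (\<lambda>g. \<Sum>\<chi>\<in>Irr G. c \<chi> * \<chi> \<one> * \<chi> g)"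

lemma convolution_inverse_fourier_Irr:
  assumes "\<psi> \<in> Irr G"
  shows "convolution G (inverse_fourier c) \<psi> g = c \<psi> * \<psi> g"
proof -
  have "convolution G (inverse_fourier c) \<psi> g = (\<Sum>\<chi>\<in>Irr G. c \<chi> * \<chi> \<one> * convolution G \<chi> \<psi> g)"
    unfolding inverse_fourier_def by (rule convolution_sum_left)
  also have "\<dots> = (\<Sum>\<chi>\<in>Irr G. if \<chi> = \<psi> then c \<psi> * \<psi> g else 0)"
    using assms by (intro sum.cong refl) (simp add: convolution_Irr Irr_one_nonzero)
  also have "\<dots> = c \<psi> * \<psi> g" using assms finite_Irr by simp
  finally show ?thesis .
qed

lemma inverse_fourier_convolution: "convolution G (inverse_fourier c) (inverse_fourier d) = inverse_fourier (\<lambda>\<chi>. c \<chi> * d \<chi>)"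
proof
  fix g
  have "convolution G (inverse_fourier c) (inverse_fourier d) g = (\<Sum>\<psi>\<in>Irr G. d \<psi> * \<psi> \<one> * convolution G (inverse_fourier c) \<psi> g)"
    unfolding inverse_fourier_def[of d] by (rule convolution_sum_right)
  also have "\<dots> = inverse_fourier (\<lambda>\<chi>. c \<chi> * d \<chi>) g"
    unfolding inverse_fourier_def[of "\<lambda>\<chi>. c \<chi> * d \<chi>"]
    by (intro sum.cong refl) (simp add: convolution_inverse_fourier_Irr mult_ac)
  finally show "convolution G (inverse_fourier c) (inverse_fourier d) g = inverse_fourier (\<lambda>\<chi>. c \<chi> * d \<chi>) g" .
qed

lemma inverse_fourier_eq_zeroD:
  assumes "\<And>g. inverse_fourier c g = 0" "\<psi> \<in> Irr G"
  shows "c \<psi> = 0"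
proof -
  have "inverse_fourier c = (\<lambda>g. 0)" using assms(1) by (rule ext)
  then have "c \<psi> * \<psi> \<one> = convolution G (\<lambda>g. 0) \<psi> \<one>"
    using convolution_inverse_fourier_Irr[OF assms(2), of c \<one>] by simp
  then show ?thesis using Irr_one_nonzero[OF assms(2)] by (simp add: convolution_def)
qed

lemma inverse_fourier_add: "inverse_fourier (\<lambda>\<chi>. c \<chi> + d \<chi>) = (\<lambda>g. inverse_fourier c g + inverse_fourier d g)"
  by (simp add: inverse_fourier_def fun_eq_iff distrib_right sum.distrib)

lemma inverse_fourier_scale: "inverse_fourier (\<lambda>\<chi>. a * c \<chi>) = (\<lambda>g. a * inverse_fourier c g)"
  by (simp add: inverse_fourier_def fun_eq_iff sum_distrib_left mult.assoc)

lemma inverse_fourier_sum: "inverse_fourier (\<lambda>\<chi>. \<Sum>i\<in>I. u i * F i \<chi>) g = (\<Sum>i\<in>I. u i * inverse_fourier (F i) g)"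
proof -
  have "inverse_fourier (\<lambda>\<chi>. \<Sum>i\<in>I. u i * F i \<chi>) g = (\<Sum>\<chi>\<in>Irr G. \<Sum>i\<in>I. u i * (F i \<chi> * \<chi> \<one> * \<chi> g))"
    by (simp add: inverse_fourier_def sum_distrib_right mult.assoc)
  also have "\<dots> = (\<Sum>i\<in>I. \<Sum>\<chi>\<in>Irr G. u i * (F i \<chi> * \<chi> \<one> * \<chi> g))" by (rule sum.swap)
  finally show ?thesis by (simp add: inverse_fourier_def sum_distrib_left)
qed

lemma inverse_fourier_inject:
  assumes "c \<in> funs_on (Irr G)" "d \<in> funs_on (Irr G)" "inverse_fourier c = inverse_fourier d"
  shows "c = d"
proof
  fix \<psi>
  show "c \<psi> = d \<psi>"
  proof (cases "\<psi> \<in> Irr G")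
    case True
    have "inverse_fourier (\<lambda>\<chi>. c \<chi> - d \<chi>) g = 0" for g
      using fun_cong[OF assms(3), of g] by (simp add: inverse_fourier_def left_diff_distrib sum_subtractf)
    from inverse_fourier_eq_zeroD[OF this True] show ?thesis by simp
  next
    case False
    then show ?thesis using assms(1,2) by (simp add: funs_on_def)
  qed
qed

lemma inverse_fourier_class_function: "inverse_fourier c \<in> class_functions G"
proof (rule class_functionsI)
  show "inverse_fourier c g = 0" if "g \<notin> carrier G" for g
    unfolding inverse_fourier_def
    using class_functions_outside[OF Irr_class_function that] by (intro sum.neutral) simp
  show "inverse_fourier c (h \<otimes> g \<otimes> inv h) = inverse_fourier c g" if "g \<in> carrier G" "h \<in> carrier G" for g h
    unfolding inverse_fourier_def
    using class_functions_conjugate[OF Irr_class_function that] by (intro sum.cong refl) simp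
qed

definition fourier_coeff :: "('a \<Rightarrow> complex) \<Rightarrow> ('a \<Rightarrow> complex) \<Rightarrow> complex" where
  "fourier_coeff f \<chi> = (if \<chi> \<in> Irr G
     then (\<Sum>x\<in>carrier G. f x * \<chi> (inv x)) / (of_nat (Coset.order G) * \<chi> \<one>) else 0)"

text \<open>The difference of both sides pairs to zero with all irreducible characters.\<close>

lemma inverse_fourier_coeff:
  assumes f: "f \<in> class_functions G"
  shows "inverse_fourier (fourier_coeff f) = f"
proof -
  have cf: "(\<lambda>x. f x - inverse_fourier (fourier_coeff f) x) \<in> class_functions G"
    using f inverse_fourier_class_function[of "fourier_coeff f"]
    by (intro class_functionsI) (simp_all add: class_functions_outside class_functions_conjugate)
  have "(\<lambda>x. f x - inverse_fourier (fourier_coeff f) x) = (\<lambda>x. 0)"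
  proof (rule class_function_eq_zero[OF cf])
    fix \<psi> assume \<psi>: "\<psi> \<in> Irr G"
    have "(\<Sum>x\<in>carrier G. inverse_fourier (fourier_coeff f) x * \<psi> (inv x)) =
        of_nat (Coset.order G) * convolution G (inverse_fourier (fourier_coeff f)) \<psi> \<one>"
      by (simp add: convolution_def)
    also have "\<dots> = (\<Sum>x\<in>carrier G. f x * \<psi> (inv x))"
      using Irr_one_nonzero[OF \<psi>] \<psi> by (simp add: convolution_inverse_fourier_Irr fourier_coeff_def)
    finally show "(\<Sum>x\<in>carrier G. (f x - inverse_fourier (fourier_coeff f) x) * \<psi> (inv x)) = 0"
      by (simp add: left_diff_distrib sum_subtractf)
  qed
  then show ?thesis by (simp add: fun_eq_iff)
qed

lemma fourier_coeff_funs_on: "fourier_coeff f \<in> funs_on (Irr G)"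
  by (simp add: fourier_coeff_def funs_on_def)

text \<open>The decomposition of the regular character; the right side is the identity for convolution.\<close>

lemma inverse_fourier_one: "inverse_fourier (ind (Irr G)) = (\<lambda>g. if g = \<one> then of_nat (Coset.order G) else 0)"
proof -
  let ?d = "\<lambda>g. if g = \<one> then of_nat (Coset.order G) else (0::complex)"
  have conj_one: "h \<otimes> g \<otimes> inv h = \<one> \<longleftrightarrow> g = \<one>" if "g \<in> carrier G" "h \<in> carrier G" for g h
  proof
    assume "h \<otimes> g \<otimes> inv h = \<one>"
    then have "h \<otimes> g = h" using that inv_equality[of "h \<otimes> g" "inv h"] by simp
    then show "g = \<one>" using that by simp
  qed (use that in simp)
  have "?d \<in> class_functions G"
  proof (rule class_functionsI)
    show "?d g = 0" if "g \<notin> carrier G" for g using that by auto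
    show "?d (h \<otimes> g \<otimes> inv h) = ?d g" if "g \<in> carrier G" "h \<in> carrier G" for g h
      unfolding conj_one[OF that] ..
  qed
  then have "inverse_fourier (fourier_coeff ?d) = ?d" by (rule inverse_fourier_coeff)
  moreover have "fourier_coeff ?d = ind (Irr G)"
  proof
    fix \<chi>
    show "fourier_coeff ?d \<chi> = ind (Irr G) \<chi>"
    proof (cases "\<chi> \<in> Irr G")
      case True
      have "(\<Sum>x\<in>carrier G. ?d x * \<chi> (inv x)) = (\<Sum>x\<in>carrier G. if x = \<one> then of_nat (Coset.order G) * \<chi> \<one> else 0)"
        by (intro sum.cong refl) simp
      also have "\<dots> = of_nat (Coset.order G) * \<chi> \<one>" by simp
      finally show ?thesis using True Irr_one_nonzero[OF True] by (simp add: fourier_coeff_def)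
    qed (simp add: fourier_coeff_def)
  qed
  ultimately show ?thesis by simp
qed

lemma sigma_char_eq_inverse_fourier:
  assumes "X \<subseteq> Irr G"
  shows "sigma_char G X = inverse_fourier (ind X)"
proof
  fix g
  have "inverse_fourier (ind X) g = (\<Sum>\<chi>\<in>Irr G. if \<chi> \<in> X then \<chi> \<one> * \<chi> g else 0)"
    unfolding inverse_fourier_def by (intro sum.cong refl) simp
  also have "\<dots> = (\<Sum>\<chi>\<in>Irr G \<inter> X. \<chi> \<one> * \<chi> g)" using finite_Irr by (rule sum.inter_restrict[symmetric])
  also have "Irr G \<inter> X = X" using assms by blast
  finally show "sigma_char G X g = inverse_fourier (ind X) g" by (simp add: sigma_char_def)
qed

lemma finite_partition_Irr: "partition_on (Irr G) \<X> \<Longrightarrow> finite \<X>"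
  by (rule finite_elements[OF finite_Irr])

lemma span_sigma_char:
  assumes X: "partition_on (Irr G) \<X>"
  shows "cfun.span (sigma_char G ` \<X>) = inverse_fourier ` block_functions \<X>"
proof -
  note fin = finite_partition_Irr[OF X]
  have s: "sigma_char G Y = inverse_fourier (ind Y)" if "Y \<in> \<X>" for Y
    by (rule sigma_char_eq_inverse_fourier[OF partition_block_subset[OF X that]])
  have "inverse_fourier (\<lambda>\<chi>. \<Sum>Y\<in>\<X>. u Y * ind Y \<chi>) = (\<lambda>g. \<Sum>Y\<in>\<X>. u Y * sigma_char G Y g)" for u
  proof
    fix g
    show "inverse_fourier (\<lambda>\<chi>. \<Sum>Y\<in>\<X>. u Y * ind Y \<chi>) g = (\<Sum>Y\<in>\<X>. u Y * sigma_char G Y g)"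
      unfolding inverse_fourier_sum by (rule sum.cong[OF refl]) (simp only: s)
  qed
  then show ?thesis
    unfolding block_functions_eq_span[OF X fin] span_family[OF fin] image_image by simp
qed

lemma dim_span_sigma_char:
  assumes X: "partition_on (Irr G) \<X>"
  shows "cfun.dim (cfun.span (sigma_char G ` \<X>)) = card \<X>"
proof (rule dim_span_family[OF finite_partition_Irr[OF X]])
  fix u Y assume z: "\<And>g. (\<Sum>Y\<in>\<X>. u Y * sigma_char G Y g) = 0" and Y: "Y \<in> \<X>"
  have "inverse_fourier (\<lambda>\<chi>. \<Sum>Y\<in>\<X>. u Y * ind Y \<chi>) g = 0" for g
  proof -
    have "inverse_fourier (\<lambda>\<chi>. \<Sum>Y\<in>\<X>. u Y * ind Y \<chi>) g = (\<Sum>Y\<in>\<X>. u Y * sigma_char G Y g)"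
      unfolding inverse_fourier_sum
      by (rule sum.cong[OF refl]) (simp only: sigma_char_eq_inverse_fourier[OF partition_block_subset[OF X]])
    then show ?thesis by (simp only: z)
  qed
  note zero = inverse_fourier_eq_zeroD[OF this]
  from X Y have "Y \<noteq> {}" by (auto simp: partition_on_def)
  then obtain \<chi> where \<chi>: "\<chi> \<in> Y" by blast
  then have "\<chi> \<in> Irr G" using partition_block_subset[OF X Y] by blast
  from zero[OF this] show "u Y = 0"
    using sum_ind_block[OF finite_partition_Irr[OF X] _ Y \<chi>, of u] X by (simp add: partition_on_def)
qed

text \<open>The second equation is Fourier inversion. It also shows that the dimension of \<open>S\<close> is the number of
  blocks of \<open>\<X>\<close>, hence the number of blocks of \<open>\<K>\<close>, so that the inclusion of \<open>S\<close> into the functions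
  that are constant on the blocks of \<open>\<K>\<close> is an equality.\<close>

lemma supercharacter_partitions_spaces:
  assumes "supercharacter_partitions G S \<K> \<X>"
  shows "S = block_functions \<K>" and "S = inverse_fourier ` block_functions \<X>"
proof -
  from assms have K: "partition_on (carrier G) \<K>" and X: "partition_on (Irr G) \<X>"
    and card: "card \<X> = card \<K>" and S: "S = cfun.span (sigma_char G ` \<X>)"
    and const: "\<And>X K g h. X \<in> \<X> \<Longrightarrow> K \<in> \<K> \<Longrightarrow> g \<in> K \<Longrightarrow> h \<in> K \<Longrightarrow>
      sigma_char G X g = sigma_char G X h"
    unfolding supercharacter_partitions_def by blast+
  have finK: "finite \<K>" by (rule finite_elements[OF finite_carrier K])
  show "S = inverse_fourier ` block_functions \<X>" unfolding S by (rule span_sigma_char[OF X])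
  have sub: "S \<subseteq> block_functions \<K>"
    unfolding S
  proof (intro cfun.span_minimal subspace_block_functions image_subsetI block_functionsI)
    fix Y assume "Y \<in> \<X>"
    then have "sigma_char G Y = inverse_fourier (ind Y)"
      by (rule sigma_char_eq_inverse_fourier[OF partition_block_subset[OF X]])
    then have "sigma_char G Y \<in> funs_on (carrier G)"
      using inverse_fourier_class_function class_functions_funs_on by auto
    then show "sigma_char G Y \<in> funs_on (\<Union>\<K>)" using K by (simp add: partition_on_def)
  qed (rule const)
  have "block_functions \<K> \<subseteq> S"
  proof (rule subspace_subset_if_dim_le[OF _ sub])
    show "cfun.subspace S" unfolding S by (rule cfun.subspace_span)
    show "block_functions \<K> \<subseteq> cfun.span (ind ` \<K>)"
      unfolding block_functions_eq_span[OF K finK] by (rule subset_refl)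
    show "finite (ind ` \<K>)" using finK by (rule finite_imageI)
    show "cfun.dim (block_functions \<K>) \<le> cfun.dim S"
      unfolding dim_block_functions[OF K finK] S dim_span_sigma_char[OF X] card by (rule order_refl)
  qed
  with sub show "S = block_functions \<K>" by (rule subset_antisym)
qed

lemma supercharacter_partitions_unique:
  assumes 1: "supercharacter_partitions G S \<K> \<X>" and 2: "supercharacter_partitions G S \<K>' \<X>'"
  shows "\<K>' = \<K>" and "\<X>' = \<X>"
proof -
  from 1 2 have K: "partition_on (carrier G) \<K>" "partition_on (carrier G) \<K>'"
    and X: "partition_on (Irr G) \<X>" "partition_on (Irr G) \<X>'"
    unfolding supercharacter_partitions_def by blast+
  have "block_functions \<K>' = block_functions \<K>"
    using supercharacter_partitions_spaces(1)[OF 1] supercharacter_partitions_spaces(1)[OF 2] by simp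
  with K show "\<K>' = \<K>" by (intro block_functions_inject)
  have *: "inverse_fourier ` block_functions \<X>' = inverse_fourier ` block_functions \<X>"
    using supercharacter_partitions_spaces(2)[OF 1] supercharacter_partitions_spaces(2)[OF 2] by simp
  have f: "block_functions Y \<subseteq> funs_on (Irr G)" if "partition_on (Irr G) Y" for Y
    using that block_functions_funs_on[of _ Y] by (auto simp: partition_on_def)
  have "inj_on inverse_fourier (funs_on (Irr G))" by (intro inj_onI inverse_fourier_inject)
  from inj_on_image_eq_iff[OF this f[OF X(2)] f[OF X(1)]] *
  have "block_functions \<X>' = block_functions \<X>" by simp
  with X show "\<X>' = \<X>" by (intro block_functions_inject)
qed

text \<open>The partition of the group comes from the pointwise product. The Fourier coefficients of members of
  \<open>S\<close> form a function algebra \<open>T\<close> on the irreducible characters, with unit coming from the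
  identity for convolution, and the other partition comes from \<open>T\<close>. Both numbers of blocks are the
  dimension of \<open>S\<close>.\<close>

lemma supercharacter_partitions_exist:
  assumes S: "supercharacter_theory G S"
  obtains \<K> \<X> where "supercharacter_partitions G S \<K> \<X>"
proof -
  from S have cls: "S \<subseteq> class_functions G" and sub: "cfun.subspace S"
    and mult: "\<And>f g. f \<in> S \<Longrightarrow> g \<in> S \<Longrightarrow> (\<lambda>x. f x * g x) \<in> S"
    and conv: "\<And>f g. f \<in> S \<Longrightarrow> g \<in> S \<Longrightarrow> convolution G f g \<in> S"
    and one: "ind (carrier G) \<in> S"
    and unit: "(\<lambda>g. if g = \<one> then of_nat (Coset.order G) else 0) \<in> S"
    unfolding supercharacter_theory_def by blast+
  obtain \<K> where K: "partition_on (carrier G) \<K>" "S = block_functions \<K>"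
    using function_algebra_block_functions[OF finite_carrier sub _ mult one]
      subset_trans[OF cls class_functions_funs_on] by metis
  define T where "T = {c \<in> funs_on (Irr G). inverse_fourier c \<in> S}"
  have "cfun.subspace T"
  proof (rule cfun.subspaceI)
    have "inverse_fourier (\<lambda>\<chi>. 0) = 0" by (simp add: inverse_fourier_def fun_eq_iff)
    then show "0 \<in> T" using cfun.subspace_0[OF sub] by (simp add: T_def funs_on_def zero_fun_def)
  next
    fix c d assume cd: "c \<in> T" "d \<in> T"
    then have "inverse_fourier (c + d) \<in> S"
      using cfun.subspace_add[OF sub, of "inverse_fourier c" "inverse_fourier d"]
      by (simp add: T_def plus_fun_def inverse_fourier_add)
    then show "c + d \<in> T" using cd by (simp add: T_def funs_on_def)
  next
    fix a :: complex and c assume c: "c \<in> T"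
    then have "inverse_fourier (\<lambda>\<chi>. a * c \<chi>) \<in> S"
      using cfun.subspace_scale[OF sub, of "inverse_fourier c" a] by (simp add: T_def inverse_fourier_scale)
    then show "(\<lambda>\<chi>. a * c \<chi>) \<in> T" using c by (simp add: T_def funs_on_def)
  qed
  moreover have "T \<subseteq> funs_on (Irr G)" by (simp add: T_def)
  moreover have "(\<lambda>\<chi>. c \<chi> * d \<chi>) \<in> T" if "c \<in> T" "d \<in> T" for c d
    using that conv[of "inverse_fourier c" "inverse_fourier d"] by (simp add: T_def inverse_fourier_convolution funs_on_def)
  moreover have "ind (Irr G) \<in> T" using unit inverse_fourier_one by (simp add: T_def funs_on_def)
  ultimately obtain \<X> where X: "partition_on (Irr G) \<X>" "T = block_functions \<X>"
    by (rule function_algebra_block_functions[OF finite_Irr])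
  have ST: "S = inverse_fourier ` T"
  proof
    show "S \<subseteq> inverse_fourier ` T"
    proof
      fix f assume f: "f \<in> S"
      then have "inverse_fourier (fourier_coeff f) = f" using cls by (intro inverse_fourier_coeff) blast
      then show "f \<in> inverse_fourier ` T" using f fourier_coeff_funs_on[of f]
        by (intro image_eqI[of _ _ "fourier_coeff f"]) (simp_all add: T_def)
    qed
  qed (auto simp: T_def)
  have span: "S = cfun.span (sigma_char G ` \<X>)"
    unfolding span_sigma_char[OF X(1)] ST X(2) ..
  have finK: "finite \<K>" by (rule finite_elements[OF finite_carrier K(1)])
  have "card \<X> = card \<K>"
    using dim_span_sigma_char[OF X(1)] dim_block_functions[OF K(1) finK] span K(2) by simp
  moreover have "{\<one>} \<in> \<K>"
  proof -
    obtain K where oneK: "K \<in> \<K>" "\<one> \<in> K" using K(1) one_closed by (auto simp: partition_on_def)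
    have "g = \<one>" if "g \<in> K" for g
      using block_functionsD[OF unit[unfolded K(2)] oneK(1) that oneK(2)]
      by (simp split: if_splits)
    then have "K = {\<one>}" using oneK(2) by blast
    then show ?thesis using oneK(1) by simp
  qed
  moreover have "sigma_char G X g = sigma_char G X h"
    if "X \<in> \<X>" "K \<in> \<K>" "g \<in> K" "h \<in> K" for X K g h
  proof -
    have "sigma_char G X \<in> S" unfolding span using that(1) by (intro cfun.span_base imageI)
    then show ?thesis using block_functionsD[of "sigma_char G X" \<K> K g h] that(2-4) K(2) by simp
  qed
  ultimately have "supercharacter_partitions G S \<K> \<X>"
    unfolding supercharacter_partitions_def using K(1) X(1) span by blast
  then show thesis by (rule that)
qed

lemma supercharacter_partitions_superclasses:
  assumes "supercharacter_theory G S"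
  shows "supercharacter_partitions G S (superclasses G S) (irr_blocks G S)"
proof -
  obtain \<K> \<X> where KX: "supercharacter_partitions G S \<K> \<X>"
    by (rule supercharacter_partitions_exist[OF assms])
  have "superclasses G S = \<K>"
    unfolding superclasses_def
    by (rule the_equality) (use KX supercharacter_partitions_unique(1)[OF KX] in blast)+
  moreover have "irr_blocks G S = \<X>"
    unfolding irr_blocks_def
    by (rule the_equality) (use KX supercharacter_partitions_unique(2)[OF KX] in blast)+
  ultimately show ?thesis using KX by simp
qed

lemma partition_on_superclasses:
  "supercharacter_theory G S \<Longrightarrow> partition_on (carrier G) (superclasses G S)"
  using supercharacter_partitions_superclasses unfolding supercharacter_partitions_def by blast

lemma supercharacter_theory_eq_block_functions:
  "supercharacter_theory G S \<Longrightarrow> S = block_functions (superclasses G S)"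
  by (rule supercharacter_partitions_spaces(1)[OF supercharacter_partitions_superclasses])

text \<open>Used to identify the superclasses of the restricted theory and of the quotient theory.\<close>

lemma superclasses_eqI:
  assumes "supercharacter_theory G S" "partition_on (carrier G) P" "S = block_functions P"
  shows "superclasses G S = P"
  using partition_on_superclasses[OF assms(1)] assms(2)
  by (rule block_functions_inject)
     (simp only: supercharacter_theory_eq_block_functions[OF assms(1), symmetric] assms(3)[symmetric])

end


section \<open>Restriction to a supernormal subgroup and passage to the quotient\<close>

lemma theory_of_classes_eq_block_functions:
  assumes "\<Union>P = carrier G" "block_functions P \<subseteq> class_functions G"
  shows "theory_of_classes G P = block_functions P"
proof
  show "theory_of_classes G P \<subseteq> block_functions P"
  proof
    fix f assume f: "f \<in> theory_of_classes G P"
    show "f \<in> block_functions P"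
    proof (rule block_functionsI)
      show "f \<in> funs_on (\<Union>P)"
        unfolding assms(1) using f by (auto simp: theory_of_classes_def class_functions_def funs_on_def)
      show "f x = f y" if "K \<in> P" "x \<in> K" "y \<in> K" for K x y
        using f that unfolding theory_of_classes_def by blast
    qed
  qed
  show "block_functions P \<subseteq> theory_of_classes G P"
  proof
    fix f assume f: "f \<in> block_functions P"
    have "\<forall>K\<in>P. \<forall>g\<in>K. \<forall>h\<in>K. f g = f h" using f unfolding block_functions_def by blast
    then show "f \<in> theory_of_classes G P"
      unfolding theory_of_classes_def using f assms(2) by blast
  qed
qed

context finite_group
begin

lemma supernormal_subgroup: "supernormal G S N \<Longrightarrow> subgroup N G"
  by (simp add: supernormal_def)

lemma supernormal_superclass:
  assumes S: "supercharacter_theory G S" and N: "supernormal G S N"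
    and K: "K \<in> superclasses G S" and "x \<in> K" "x \<in> N"
  shows "K \<subseteq> N"
proof -
  from N obtain \<C> where C: "\<C> \<subseteq> superclasses G S" "N = \<Union>\<C>"
    unfolding supernormal_def by blast
  then obtain L where L: "L \<in> \<C>" "x \<in> L" using assms(5) by blast
  have "disjoint (superclasses G S)"
    using partition_on_superclasses[OF S] by (simp add: partition_on_def)
  then have "L = K" using L C(1) K assms(4) unfolding disjoint_def by blast
  then show ?thesis using L(1) C(2) by blast
qed

lemma supercharacter_theoryD:
  assumes "supercharacter_theory G S"
  shows "S \<subseteq> class_functions G" "cfun.subspace S"
    and "\<And>f g. f \<in> S \<Longrightarrow> g \<in> S \<Longrightarrow> (\<lambda>x. f x * g x) \<in> S"
    and "\<And>f g. f \<in> S \<Longrightarrow> g \<in> S \<Longrightarrow> convolution G f g \<in> S"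
    and "ind (carrier G) \<in> S"
    and "(\<lambda>g. if g = \<one> then of_nat (Coset.order G) else 0) \<in> S"
  using assms unfolding supercharacter_theory_def by blast+

lemma superclass_constant:
  assumes S: "supercharacter_theory G S" and f: "f \<in> S"
    and K: "K \<in> superclasses G S" "x \<in> K" "y \<in> K"
  shows "f x = f y"
proof -
  have "f \<in> block_functions (superclasses G S)"
    using f supercharacter_theory_eq_block_functions[OF S] by simp
  then show ?thesis using K by (rule block_functionsD)
qed

lemma in_theoryI:
  assumes S: "supercharacter_theory G S" and f: "f \<in> funs_on (carrier G)"
    and "\<And>K x y. K \<in> superclasses G S \<Longrightarrow> x \<in> K \<Longrightarrow> y \<in> K \<Longrightarrow> f x = f y"
  shows "f \<in> S"
proof -
  have "f \<in> block_functions (superclasses G S)"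
  proof (rule block_functionsI)
    show "f \<in> funs_on (\<Union>(superclasses G S))"
      using f partition_on_superclasses[OF S] by (simp add: partition_on_def)
  qed (rule assms(3))
  then show ?thesis using supercharacter_theory_eq_block_functions[OF S] by simp
qed

lemma superclass_ex:
  assumes S: "supercharacter_theory G S" and "g \<in> carrier G"
  obtains K where "K \<in> superclasses G S" "g \<in> K"
  using assms(2) partition_on_superclasses[OF S] by (auto simp: partition_on_def)

lemma superclass_subset: "supercharacter_theory G S \<Longrightarrow> K \<in> superclasses G S \<Longrightarrow> K \<subseteq> carrier G"
  by (rule partition_block_subset[OF partition_on_superclasses])

lemma ind_supernormal:
  assumes S: "supercharacter_theory G S" and N: "supernormal G S N"
  shows "ind N \<in> S"
proof (rule in_theoryI[OF S])
  show "ind N \<in> funs_on (carrier G)"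
    using subgroup.subset[OF supernormal_subgroup[OF N]] by (auto simp: funs_on_def)
  fix K x y assume K: "K \<in> superclasses G S" "x \<in> K" "y \<in> K"
  have "x \<in> N \<longleftrightarrow> y \<in> N"
    using supernormal_superclass[OF S N K(1)] K(2,3) by blast
  then show "ind N x = ind N y" by simp
qed

lemma supernormal_normal:
  assumes S: "supercharacter_theory G S" and N: "supernormal G S N"
  shows "N \<lhd> G"
proof -
  have sub: "subgroup N G" using N by (rule supernormal_subgroup)
  have cf: "ind N \<in> class_functions G" using ind_supernormal[OF S N] supercharacter_theoryD(1)[OF S] by blast
  have "x \<otimes> h \<otimes> inv x \<in> N" if "x \<in> carrier G" "h \<in> N" for x h
  proof -
    have "h \<in> carrier G" using that(2) subgroup.subset[OF sub] by blast
    from class_functions_conjugate[OF cf this that(1)] that(2) show ?thesis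
      by (simp split: if_splits)
  qed
  then show ?thesis using sub by (simp add: normal_inv_iff)
qed

lemma finite_group_subgroup: "subgroup N G \<Longrightarrow> finite_group (G\<lparr>carrier := N\<rparr>)"
  using finite_subset[OF subgroup.subset finite_carrier]
  by (intro finite_group.intro subgroup.subgroup_is_group finite_group_axioms.intro is_group) simp_all

text \<open>A function on \<open>N\<close> is already a function on \<open>G\<close> that vanishes outside \<open>N\<close>, so the restricted theory
  is a subspace of \<open>S\<close>.\<close>

lemma restricted_blocks:
  assumes S: "supercharacter_theory G S" and N: "supernormal G S N"
  shows "partition_on N {K \<in> superclasses G S. K \<subseteq> N}"
    and "block_functions {K \<in> superclasses G S. K \<subseteq> N} = S \<inter> funs_on N"
proof -
  let ?P = "{K \<in> superclasses G S. K \<subseteq> N}"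
  have sub: "N \<subseteq> carrier G" by (rule subgroup.subset[OF supernormal_subgroup[OF N]])
  have union: "\<Union>?P = N"
  proof
    show "N \<subseteq> \<Union>?P"
    proof
      fix x assume x: "x \<in> N"
      then obtain K where K: "K \<in> superclasses G S" "x \<in> K"
        using superclass_ex[OF S] sub by blast
      then show "x \<in> \<Union>?P" using supernormal_superclass[OF S N K x] by blast
    qed
  qed blast
  show "partition_on N ?P"
    unfolding partition_on_def union
    using partition_on_superclasses[OF S] by (auto simp: partition_on_def disjoint_def)
  show "block_functions ?P = S \<inter> funs_on N"
  proof
    show "block_functions ?P \<subseteq> S \<inter> funs_on N"
    proof
      fix f assume f: "f \<in> block_functions ?P"
      have fN: "f \<in> funs_on N" using block_functions_funs_on[OF f] unfolding union .
      have "f \<in> S"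
      proof (rule in_theoryI[OF S])
        show "f \<in> funs_on (carrier G)" using fN sub unfolding funs_on_def by blast
        fix K x y assume K: "K \<in> superclasses G S" "x \<in> K" "y \<in> K"
        show "f x = f y"
        proof (cases "K \<subseteq> N")
          case True
          then show ?thesis using K by (intro block_functionsD[OF f, of K]) simp_all
        next
          case False
          then have "x \<notin> N" "y \<notin> N" using supernormal_superclass[OF S N K(1)] K(2,3) by blast+
          then show ?thesis using fN by (simp add: funs_on_def)
        qed
      qed
      with fN show "f \<in> S \<inter> funs_on N" by blast
    qed
    show "S \<inter> funs_on N \<subseteq> block_functions ?P"
    proof
      fix f assume f: "f \<in> S \<inter> funs_on N"
      show "f \<in> block_functions ?P"
      proof (rule block_functionsI)
        show "f \<in> funs_on (\<Union>?P)" unfolding union using f by blast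
        show "f x = f y" if "K \<in> ?P" "x \<in> K" "y \<in> K" for K x y
          using that f by (intro superclass_constant[OF S, of f K]) simp_all
      qed
    qed
  qed
qed

text \<open>The closure properties of the restricted theory come from those of \<open>S\<close>: for functions that vanish
  outside \<open>N\<close>, the convolutions on \<open>N\<close> and on \<open>G\<close> differ only by the normalising factor.\<close>

lemma superclasses_restricted_theory:
  assumes S: "supercharacter_theory G S" and N: "supernormal G S N"
  shows "superclasses (G\<lparr>carrier := N\<rparr>) (restricted_theory G S N) = {K \<in> superclasses G S. K \<subseteq> N}"
proof -
  let ?H = "G\<lparr>carrier := N\<rparr>" and ?P = "{K \<in> superclasses G S. K \<subseteq> N}"
  have sub: "subgroup N G" using N by (rule supernormal_subgroup)
  have NG: "N \<subseteq> carrier G" using sub by (rule subgroup.subset)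
  note SD = supercharacter_theoryD[OF S]
  note part = restricted_blocks(1)[OF S N] and U = restricted_blocks(2)[OF S N]
  interpret H: finite_group ?H by (rule finite_group_subgroup[OF sub])
  have cls: "S \<inter> funs_on N \<subseteq> class_functions ?H"
  proof
    fix f assume f: "f \<in> S \<inter> funs_on N"
    then have cf: "f \<in> class_functions G" using SD(1) by blast
    show "f \<in> class_functions ?H"
    proof (rule H.class_functionsI)
      show "f g = 0" if "g \<notin> carrier ?H" for g using that f by (simp add: funs_on_def)
      show "f (h \<otimes>\<^bsub>?H\<^esub> g \<otimes>\<^bsub>?H\<^esub> inv\<^bsub>?H\<^esub> h) = f g" if gh: "g \<in> carrier ?H" "h \<in> carrier ?H" for g h
      proof -
        have "g \<in> carrier G" "h \<in> carrier G" using gh NG by auto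
        from class_functions_conjugate[OF cf this] show ?thesis
          using gh by (simp add: m_inv_consistent[OF sub])
      qed
    qed
  qed
  have restr: "restricted_theory G S N = S \<inter> funs_on N"
    unfolding restricted_theory_def U[symmetric]
    using part cls unfolding U
    by (subst theory_of_classes_eq_block_functions) (simp_all add: U partition_on_def)
  have conv: "convolution ?H f f' \<in> S \<inter> funs_on N" if f: "f \<in> S \<inter> funs_on N" and f': "f' \<in> S \<inter> funs_on N" for f f'
  proof -
    have off: "f g = 0" "f' g = 0" if "g \<notin> N" for g using that f f' by (simp_all add: funs_on_def)
    have eq: "convolution ?H f f' g =
        of_nat (Coset.order G) / of_nat (Coset.order ?H) * convolution G f f' g" for g
    proof (cases "g \<in> N")
      case True
      have "(\<Sum>x\<in>carrier G. f (x \<otimes> g) * f' (inv x)) = (\<Sum>x\<in>N. f (x \<otimes> g) * f' (inv x))"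
      proof (rule sum.mono_neutral_right[OF finite_carrier NG], rule ballI)
        fix x assume x: "x \<in> carrier G - N"
        have "inv x \<notin> N"
        proof
          assume "inv x \<in> N"
          then have "inv (inv x) \<in> N" by (rule subgroup.m_inv_closed[OF sub])
          then show False using x by simp
        qed
        then show "f (x \<otimes> g) * f' (inv x) = 0" by (simp add: off)
      qed
      also have "\<dots> = (\<Sum>x\<in>N. f (x \<otimes> g) * f' (inv\<^bsub>?H\<^esub> x))"
        by (intro sum.cong refl) (simp add: m_inv_consistent[OF sub])
      finally show ?thesis using True NG by (auto simp: convolution_def)
    next
      case False
      have "(\<Sum>x\<in>carrier G. f (x \<otimes> g) * f' (inv x)) = 0" if g: "g \<in> carrier G"
      proof (intro sum.neutral ballI)
        fix x assume x: "x \<in> carrier G"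
        show "f (x \<otimes> g) * f' (inv x) = 0"
        proof (cases "inv x \<in> N \<and> x \<otimes> g \<in> N")
          case True
          then have "inv x \<otimes> (x \<otimes> g) \<in> N" using subgroup.m_closed[OF sub] by blast
          then have "g \<in> N" using x g by (simp add: m_assoc[symmetric])
          then show ?thesis using False by contradiction
        next
          case False
          then show ?thesis using off by auto
        qed
      qed
      then show ?thesis using False by (simp add: convolution_def)
    qed
    have "(\<lambda>g. of_nat (Coset.order G) / of_nat (Coset.order ?H) * convolution G f f' g) \<in> S"
      using SD(4)[of f f'] f f' by (intro cfun.subspace_scale[OF SD(2)]) simp
    then have "convolution ?H f f' \<in> S" unfolding eq[symmetric] .
    moreover have "convolution ?H f f' \<in> funs_on N" by (simp add: funs_on_def convolution_def)
    ultimately show ?thesis by blast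
  qed
  have "supercharacter_theory ?H (S \<inter> funs_on N)"
    unfolding supercharacter_theory_def
  proof (intro conjI ballI cls conv)
    show "cfun.subspace (S \<inter> funs_on N)" unfolding U[symmetric] by (rule subspace_block_functions)
    show "(\<lambda>g. f g * f' g) \<in> S \<inter> funs_on N" if "f \<in> S \<inter> funs_on N" "f' \<in> S \<inter> funs_on N" for f f'
      using that SD(3)[of f f'] by (simp add: funs_on_def)
    show "ind (carrier ?H) \<in> S \<inter> funs_on N"
      using ind_supernormal[OF S N] by (simp add: funs_on_def)
    let ?c = "of_nat (Coset.order ?H) / of_nat (Coset.order G) :: complex"
    have "(\<lambda>g. ?c * (if g = \<one> then of_nat (Coset.order G) else 0)) \<in> S"
      by (rule cfun.subspace_scale[OF SD(2) SD(6)])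
    also have "(\<lambda>g. ?c * (if g = \<one> then of_nat (Coset.order G) else 0)) =
        (\<lambda>g. if g = \<one>\<^bsub>?H\<^esub> then of_nat (Coset.order ?H) else 0)"
      by (simp add: fun_eq_iff)
    finally show "(\<lambda>g. if g = \<one>\<^bsub>?H\<^esub> then of_nat (Coset.order ?H) else 0) \<in> S \<inter> funs_on N"
      using subgroup.one_closed[OF sub] by (auto simp: funs_on_def)
  qed
  then show ?thesis
    unfolding restr using part U by (intro H.superclasses_eqI) simp_all
qed

text \<open>Up to the factor \<open>card M\<close> this averages \<open>f\<close> over the coset of \<open>g\<close>. Being a multiple of
  the convolution with the indicator function of \<open>M\<close>, it maps \<open>S\<close> to itself.\<close>

definition coset_sum :: "'a set \<Rightarrow> ('a \<Rightarrow> complex) \<Rightarrow> 'a \<Rightarrow> complex" where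
  "coset_sum M f g = (if g \<in> carrier G then \<Sum>m\<in>M. f (m \<otimes> g) else 0)"

lemma coset_sum_eq_convolution:
  assumes M: "subgroup M G"
  shows "coset_sum M f = (\<lambda>g. of_nat (Coset.order G) * convolution G f (ind M) g)"
proof
  fix g
  show "coset_sum M f g = of_nat (Coset.order G) * convolution G f (ind M) g"
  proof (cases "g \<in> carrier G")
    case True
    have "f (x \<otimes> g) * ind M (inv x) = (if x \<in> M then f (x \<otimes> g) else 0)" if "x \<in> carrier G" for x
      using subgroup.m_inv_closed[OF M, of x] subgroup.m_inv_closed[OF M, of "inv x"] that by auto
    then have "(\<Sum>x\<in>carrier G. f (x \<otimes> g) * ind M (inv x)) =
        (\<Sum>x\<in>carrier G. if x \<in> M then f (x \<otimes> g) else 0)"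
      by (rule sum.cong[OF refl])
    also have "\<dots> = (\<Sum>x\<in>carrier G \<inter> M. f (x \<otimes> g))"
      by (rule sum.inter_restrict[OF finite_carrier, symmetric])
    also have "carrier G \<inter> M = M" using subgroup.subset[OF M] by blast
    finally show ?thesis using True by (simp add: coset_sum_def convolution_def)
  qed (simp add: coset_sum_def convolution_def)
qed

lemma coset_sum_closed:
  assumes S: "supercharacter_theory G S" and M: "supernormal G S M" and f: "f \<in> S"
  shows "coset_sum M f \<in> S"
  unfolding coset_sum_eq_convolution[OF supernormal_subgroup[OF M]]
  by (intro cfun.subspace_scale supercharacter_theoryD[OF S] f ind_supernormal[OF S M])


lemma r_coset_eq_iff:
  assumes "subgroup M G" "x \<in> carrier G" "y \<in> carrier G"
  shows "M #> x = M #> y \<longleftrightarrow> (\<exists>m\<in>M. x = m \<otimes> y)"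
proof
  assume "M #> x = M #> y"
  then have "x \<in> M #> y" using rcos_self[OF assms(2,1)] by simp
  then show "\<exists>m\<in>M. x = m \<otimes> y" by (auto simp: r_coset_def)
next
  assume "\<exists>m\<in>M. x = m \<otimes> y"
  then have "x \<in> M #> y" by (auto simp: r_coset_def)
  then show "M #> x = M #> y" using repr_independence[OF _ assms(3,1)] by simp
qed

lemma r_coset_translate:
  "subgroup M G \<Longrightarrow> m \<in> M \<Longrightarrow> x \<in> carrier G \<Longrightarrow> M #> (m \<otimes> x) = M #> x"
  using subgroup.subset[of M G] by (subst r_coset_eq_iff) auto

text \<open>The coset sum of the indicator function of \<open>K\<close> lies in \<open>S\<close>, and it is nonzero exactly at the
  elements whose coset meets \<open>K\<close>. Its support is a union of superclasses, so with one element it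
  contains all of \<open>L\<close>. Hence the images of superclasses in the quotient are equal or disjoint.\<close>

lemma coset_image_subset:
  assumes S: "supercharacter_theory G S" and M: "supernormal G S M"
    and K: "K \<in> superclasses G S" and L: "L \<in> superclasses G S"
    and xy: "x \<in> K" "y \<in> L" "M #> x = M #> y"
  shows "(\<lambda>g. M #> g) ` L \<subseteq> (\<lambda>g. M #> g) ` K"
proof (rule image_subsetI, rule ccontr)
  fix z assume z: "z \<in> L" "M #> z \<notin> (\<lambda>g. M #> g) ` K"
  have sub: "subgroup M G" using M by (rule supernormal_subgroup)
  have MG: "M \<subseteq> carrier G" using sub by (rule subgroup.subset)
  have finM: "finite M" using MG finite_carrier by (rule finite_subset)
  have car: "x \<in> carrier G" "y \<in> carrier G" "z \<in> carrier G"
    using xy z superclass_subset[OF S K] superclass_subset[OF S L] by blast+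
  have "disjoint (superclasses G S)"
    using partition_on_superclasses[OF S] by (simp add: partition_on_def)
  then have "ind K \<in> S"
    using ind_block_function[OF _ K] supercharacter_theory_eq_block_functions[OF S] by simp
  then have "coset_sum M (ind K) \<in> S" by (rule coset_sum_closed[OF S M])
  then have const: "coset_sum M (ind K) y = coset_sum M (ind K) z"
    using L xy(2) z(1) by (rule superclass_constant[OF S])
  have "ind K (m \<otimes> z) = 0" if m: "m \<in> M" for m
  proof -
    have "m \<otimes> z \<notin> K"
    proof
      assume "m \<otimes> z \<in> K"
      then have "M #> (m \<otimes> z) \<in> (\<lambda>g. M #> g) ` K" by (rule imageI)
      then show False using z(2) r_coset_translate[OF sub m car(3)] by simp
    qed
    then show ?thesis by simp
  qed
  then have "coset_sum M (ind K) z = 0" by (simp add: coset_sum_def)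
  moreover have "coset_sum M (ind K) y = of_nat (card (M \<inter> {m. m \<otimes> y \<in> K}))"
    using car(2) finM by (simp add: coset_sum_def sum.If_cases)
  ultimately have "(of_nat (card (M \<inter> {m. m \<otimes> y \<in> K})) :: complex) = 0" using const by simp
  then have "card (M \<inter> {m. m \<otimes> y \<in> K}) = 0" by (simp only: of_nat_eq_0_iff)
  moreover obtain m where "m \<in> M" "x = m \<otimes> y"
    using r_coset_eq_iff[OF sub car(1,2)] xy(3) by blast
  ultimately show False using finM xy(1) by auto
qed

definition pullback :: "'a set \<Rightarrow> ('a set \<Rightarrow> complex) \<Rightarrow> 'a \<Rightarrow> complex" where
  "pullback M F g = (if g \<in> carrier G then F (M #> g) else 0)"

text \<open>A function on the quotient is described by its pullback, which is constant on superclasses exactly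
  when the function is constant on their images.\<close>

lemma quotient_blocks:
  assumes S: "supercharacter_theory G S" and M: "supernormal G S M"
  shows "partition_on (carrier (G Mod M)) ((\<lambda>K. (\<lambda>g. M #> g) ` K) ` superclasses G S)"
    and "F \<in> block_functions ((\<lambda>K. (\<lambda>g. M #> g) ` K) ` superclasses G S) \<longleftrightarrow>
      F \<in> funs_on (carrier (G Mod M)) \<and> pullback M F \<in> S"
proof -
  let ?\<pi> = "\<lambda>g. M #> g"
  let ?P = "(\<lambda>K. ?\<pi> ` K) ` superclasses G S"
  note part = partition_on_superclasses[OF S]
  have "\<Union>?P = ?\<pi> ` \<Union>(superclasses G S)" by blast
  then have union: "\<Union>?P = carrier (G Mod M)"
    using part by (simp add: carrier_FactGroup partition_on_def)
  show "partition_on (carrier (G Mod M)) ?P"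
    unfolding partition_on_def
  proof (intro conjI union)
    show "{} \<notin> ?P" using part by (auto simp: partition_on_def)
    show "disjoint ?P"
    proof (rule disjointI)
      fix A B assume AB: "A \<in> ?P" "B \<in> ?P" "A \<noteq> B"
      then obtain K L where KL: "K \<in> superclasses G S" "L \<in> superclasses G S"
        "A = ?\<pi> ` K" "B = ?\<pi> ` L" by blast
      show "A \<inter> B = {}"
      proof (rule equals0I)
        fix C assume "C \<in> A \<inter> B"
        then obtain x y where xy: "x \<in> K" "y \<in> L" "C = M #> x" "C = M #> y" using KL(3,4) by blast
        have "B \<subseteq> A" "A \<subseteq> B"
          unfolding KL(3,4)
          using coset_image_subset[OF S M KL(1,2) xy(1,2)] coset_image_subset[OF S M KL(2,1) xy(2,1)] xy(3,4)
          by simp_all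
        then show False using AB(3) by blast
      qed
    qed
  qed
  show "F \<in> block_functions ?P \<longleftrightarrow> F \<in> funs_on (carrier (G Mod M)) \<and> pullback M F \<in> S"
  proof
    assume F: "F \<in> block_functions ?P"
    have "pullback M F \<in> S"
    proof (rule in_theoryI[OF S])
      show "pullback M F \<in> funs_on (carrier G)" by (simp add: pullback_def funs_on_def)
      fix K x y assume K: "K \<in> superclasses G S" "x \<in> K" "y \<in> K"
      have "F (M #> x) = F (M #> y)"
        using K by (intro block_functionsD[OF F, of "?\<pi> ` K"] imageI)
      moreover have "x \<in> carrier G" "y \<in> carrier G" using K superclass_subset[OF S K(1)] by blast+
      ultimately show "pullback M F x = pullback M F y" by (simp add: pullback_def)
    qed
    then show "F \<in> funs_on (carrier (G Mod M)) \<and> pullback M F \<in> S"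
      using block_functions_funs_on[OF F] unfolding union by blast
  next
    assume F: "F \<in> funs_on (carrier (G Mod M)) \<and> pullback M F \<in> S"
    show "F \<in> block_functions ?P"
    proof (rule block_functionsI)
      show "F \<in> funs_on (\<Union>?P)" unfolding union using F by blast
      fix A C D assume "A \<in> ?P" "C \<in> A" "D \<in> A"
      then obtain K x y where K: "K \<in> superclasses G S" "x \<in> K" "y \<in> K" "C = M #> x" "D = M #> y"
        by blast
      have "pullback M F x = pullback M F y" using F K(1-3) by (intro superclass_constant[OF S, of _ K]) simp_all
      moreover have "x \<in> carrier G" "y \<in> carrier G" using K superclass_subset[OF S K(1)] by blast+
      ultimately show "F C = F D" by (simp add: pullback_def K(4,5))
    qed
  qed
qed

lemma sum_over_cosets:
  fixes h :: "'a set \<Rightarrow> complex"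
  assumes M: "subgroup M G"
  shows "(\<Sum>x\<in>carrier G. h (M #> x)) = of_nat (card M) * (\<Sum>C\<in>carrier (G Mod M). h C)"
proof -
  have "(\<Sum>x\<in>carrier G. h (M #> x)) =
      (\<Sum>C\<in>(\<lambda>g. M #> g) ` carrier G. \<Sum>x\<in>{x. x \<in> carrier G \<and> M #> x = C}. h (M #> x))"
    by (rule sum.image_gen[OF finite_carrier])
  also have "\<dots> = (\<Sum>C\<in>carrier (G Mod M). of_nat (card M) * h C)"
    unfolding carrier_FactGroup
  proof (rule sum.cong[OF refl])
    fix C assume C: "C \<in> (\<lambda>g. M #> g) ` carrier G"
    then obtain g where g: "g \<in> carrier G" "C = M #> g" by blast
    have CG: "C \<subseteq> carrier G" unfolding g(2) by (rule r_coset_subset_G[OF subgroup.subset[OF M] g(1)])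
    have "{x. x \<in> carrier G \<and> M #> x = C} = C"
    proof
      show "{x. x \<in> carrier G \<and> M #> x = C} \<subseteq> C" using rcos_self[OF _ M] by blast
      show "C \<subseteq> {x. x \<in> carrier G \<and> M #> x = C}"
      proof
        fix x assume x: "x \<in> C"
        then have "M #> g = M #> x" unfolding g(2) using repr_independence[OF _ g(1) M] by blast
        then show "x \<in> {x. x \<in> carrier G \<and> M #> x = C}" using x CG g(2) by blast
      qed
    qed
    moreover have "card M = card C"
      using C subgroup.subset[OF M] by (intro card_rcosets_equal) (auto simp: RCOSETS_def)
    moreover have "(\<Sum>x\<in>{x. x \<in> carrier G \<and> M #> x = C}. h (M #> x)) =
        (\<Sum>x\<in>{x. x \<in> carrier G \<and> M #> x = C}. h C)"
      by (intro sum.cong) auto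
    ultimately show "(\<Sum>x\<in>{x. x \<in> carrier G \<and> M #> x = C}. h (M #> x)) = of_nat (card M) * h C"
      by simp
  qed
  finally show ?thesis by (simp add: sum_distrib_left)
qed

text \<open>The pullback embeds the quotient theory into \<open>S\<close>. It respects both products, since each coset
  contributes \<open>card M\<close> equal summands to a convolution on \<open>G\<close> and the order of \<open>G\<close> is larger by the
  same factor.\<close>

lemma superclasses_quotient_theory:
  assumes S: "supercharacter_theory G S" and M: "supernormal G S M"
  shows "superclasses (G Mod M) (quotient_theory G S M) =
    (\<lambda>K. (\<lambda>g. M #> g) ` K) ` superclasses G S"
proof -
  let ?Q = "G Mod M" and ?P = "(\<lambda>K. (\<lambda>g. M #> g) ` K) ` superclasses G S"
  have sub: "subgroup M G" using M by (rule supernormal_subgroup)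
  note SD = supercharacter_theoryD[OF S]
  note part = quotient_blocks(1)[OF S M] and V = quotient_blocks(2)[OF S M]
  interpret M: normal M G by (rule supernormal_normal[OF S M])
  interpret Q: finite_group ?Q
    by (intro finite_group.intro M.factorgroup_is_group finite_group_axioms.intro)
       (simp add: carrier_FactGroup)
  have inv: "inv\<^bsub>?Q\<^esub> (M #> x) = M #> (inv x)" if "x \<in> carrier G" for x
    using that by (simp add: M.inv_FactGroup carrier_FactGroup M.rcos_inv)
  have one: "\<one>\<^bsub>?Q\<^esub> = M" by (simp add: FactGroup_def)
  have cls: "block_functions ?P \<subseteq> class_functions ?Q"
  proof
    fix F assume F: "F \<in> block_functions ?P"
    then have F': "F \<in> funs_on (carrier ?Q)" and l: "pullback M F \<in> class_functions G"
      using V SD(1) by blast+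
    show "F \<in> class_functions ?Q"
    proof (rule Q.class_functionsI)
      show "F C = 0" if "C \<notin> carrier ?Q" for C using that F' by (simp add: funs_on_def)
      show "F (D \<otimes>\<^bsub>?Q\<^esub> C \<otimes>\<^bsub>?Q\<^esub> inv\<^bsub>?Q\<^esub> D) = F C" if CD: "C \<in> carrier ?Q" "D \<in> carrier ?Q" for C D
      proof -
        from CD obtain g h where gh: "g \<in> carrier G" "h \<in> carrier G" "C = M #> g" "D = M #> h"
          unfolding carrier_FactGroup by blast
        have "D \<otimes>\<^bsub>?Q\<^esub> C \<otimes>\<^bsub>?Q\<^esub> inv\<^bsub>?Q\<^esub> D = M #> (h \<otimes> g \<otimes> inv h)"
          using gh(1,2) by (simp add: gh(3,4) M.rcos_sum inv)
        then show ?thesis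
          using class_functions_conjugate[OF l gh(1,2)] gh(1,2) by (simp add: pullback_def gh(3))
      qed
    qed
  qed
  have quot: "quotient_theory G S M = block_functions ?P"
    unfolding quotient_theory_def
    using part cls by (intro theory_of_classes_eq_block_functions) (simp_all add: partition_on_def)
  have order_eq: "Coset.order G = card M * Coset.order ?Q"
    using lagrange_finite[OF finite_carrier sub]
    by (simp add: Coset.order_def FactGroup_def mult.commute)
  then have card_M: "card M \<noteq> 0" using order_nonzero by (metis mult_0)
  have pullback_conv: "pullback M (convolution ?Q F F') = convolution G (pullback M F) (pullback M F')" for F F'
  proof
    fix g
    show "pullback M (convolution ?Q F F') g = convolution G (pullback M F) (pullback M F') g"
    proof (cases "g \<in> carrier G")
      case g: True
      have "(\<Sum>x\<in>carrier G. pullback M F (x \<otimes> g) * pullback M F' (inv x)) =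
          (\<Sum>x\<in>carrier G. F ((M #> x) \<otimes>\<^bsub>?Q\<^esub> (M #> g)) * F' (inv\<^bsub>?Q\<^esub> (M #> x)))"
        using g by (intro sum.cong refl) (simp add: pullback_def M.rcos_sum inv)
      also have "\<dots> = of_nat (card M) *
          (\<Sum>C\<in>carrier ?Q. F (C \<otimes>\<^bsub>?Q\<^esub> (M #> g)) * F' (inv\<^bsub>?Q\<^esub> C))"
        by (rule sum_over_cosets[OF sub])
      finally show ?thesis
        using g card_M by (simp add: pullback_def convolution_def carrier_FactGroup order_eq)
    qed (simp add: pullback_def convolution_def)
  qed
  have "supercharacter_theory ?Q (block_functions ?P)"
    unfolding supercharacter_theory_def
  proof (intro conjI ballI cls subspace_block_functions)
    fix F F' assume F: "F \<in> block_functions ?P" and F': "F' \<in> block_functions ?P"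
    have "pullback M (\<lambda>C. F C * F' C) = (\<lambda>g. pullback M F g * pullback M F' g)"
      by (simp add: pullback_def fun_eq_iff)
    then have "pullback M (\<lambda>C. F C * F' C) \<in> S" using F F' SD(3) by (simp add: V)
    then show "(\<lambda>C. F C * F' C) \<in> block_functions ?P" using F by (simp add: V funs_on_def)
    have "pullback M (convolution ?Q F F') \<in> S" using F F' SD(4) by (simp add: V pullback_conv)
    then show "convolution ?Q F F' \<in> block_functions ?P"
      by (simp add: V funs_on_def convolution_def)
  next
    have "pullback M (ind (carrier ?Q)) = ind (carrier G)"
      by (simp add: pullback_def fun_eq_iff carrier_FactGroup)
    then show "ind (carrier ?Q) \<in> block_functions ?P" using SD(5) by (simp add: V funs_on_def)
  next
    let ?d = "\<lambda>C. if C = \<one>\<^bsub>?Q\<^esub> then of_nat (Coset.order ?Q) else (0 :: complex)"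
    have "pullback M ?d = (\<lambda>g. of_nat (Coset.order ?Q) * ind M g)"
    proof
      fix g
      show "pullback M ?d g = of_nat (Coset.order ?Q) * ind M g"
      proof (cases "g \<in> carrier G")
        case True
        have "M #> g = M \<longleftrightarrow> g \<in> M"
          using coset_join2[OF True sub] rcos_self[OF True sub] by auto
        then show ?thesis using True by (simp add: pullback_def one)
      next
        case False
        then show ?thesis using subgroup.subset[OF sub] by (auto simp: pullback_def)
      qed
    qed
    then have "pullback M ?d \<in> S"
      using cfun.subspace_scale[OF SD(2) ind_supernormal[OF S M]] by simp
    then show "?d \<in> block_functions ?P"
      using Q.one_closed by (auto simp: V funs_on_def)
  qed
  then show ?thesis
    unfolding quot by (rule Q.superclasses_eqI[OF _ part refl])
qed

end


section \<open>\<open>\<Delta>\<close>-products and the vanishing of supercharacters\<close>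

context finite_group
begin

lemma supercharacters_span:
  assumes S: "supercharacter_theory G S"
  shows "S = cfun.span (supercharacters G S)"
  using supercharacter_partitions_superclasses[OF S]
  unfolding supercharacter_partitions_def supercharacters_def by blast

lemma supercharacter_in_theory:
  "supercharacter_theory G S \<Longrightarrow> \<chi> \<in> supercharacters G S \<Longrightarrow> \<chi> \<in> S"
  using supercharacters_span cfun.span_base by blast

text \<open>The value is the sum of the squares of the degrees of the constituents.\<close>

lemma supercharacter_one_nonzero:
  assumes S: "supercharacter_theory G S" and \<chi>: "\<chi> \<in> supercharacters G S"
  shows "\<chi> \<one> \<noteq> 0"
proof -
  have part: "partition_on (Irr G) (irr_blocks G S)"
    using supercharacter_partitions_superclasses[OF S] unfolding supercharacter_partitions_def by blast
  from \<chi> obtain X where X: "X \<in> irr_blocks G S" "\<chi> = sigma_char G X"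
    unfolding supercharacters_def by blast
  have sub: "X \<subseteq> Irr G" by (rule partition_block_subset[OF part X(1)])
  have fin: "finite X" using sub finite_Irr by (rule finite_subset)
  define d where "d \<xi> = Re (\<xi> \<one>)" for \<xi> :: "'a \<Rightarrow> complex"
  have d: "\<xi> \<one> = of_real (d \<xi>)" "d \<xi> > 0" if "\<xi> \<in> X" for \<xi>
  proof -
    have "\<xi> \<in> Irr G" using sub that by blast
    then obtain n where "n > 0" "\<xi> \<one> = of_nat n" by (rule IrrE)
    then show "\<xi> \<one> = of_real (d \<xi>)" "d \<xi> > 0" by (simp_all add: d_def)
  qed
  have "\<chi> \<one> = of_real (\<Sum>\<xi>\<in>X. d \<xi> * d \<xi>)"
    unfolding X(2) sigma_char_def of_real_sum of_real_mult
    by (rule sum.cong[OF refl]) (simp only: d(1))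
  moreover have "(\<Sum>\<xi>\<in>X. d \<xi> * d \<xi>) > 0"
  proof (rule sum_pos[OF fin])
    show "X \<noteq> {}" using part X(1) by (auto simp: partition_on_def)
    show "0 < d \<xi> * d \<xi>" if "\<xi> \<in> X" for \<xi> using d(2)[OF that] by simp
  qed
  ultimately show ?thesis by (simp only: of_real_eq_0_iff less_irrefl)
qed

text \<open>The Fourier coefficients of \<open>f\<close> are constant on the block that belongs to \<open>\<chi>\<close>.\<close>

lemma convolution_supercharacter:
  assumes S: "supercharacter_theory G S" and \<chi>: "\<chi> \<in> supercharacters G S" and f: "f \<in> S"
  obtains c where "\<And>g. convolution G \<chi> f g = c * \<chi> g"
proof -
  note parts = supercharacter_partitions_superclasses[OF S]
  have part: "partition_on (Irr G) (irr_blocks G S)"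
    using parts unfolding supercharacter_partitions_def by blast
  from \<chi> obtain X where X: "X \<in> irr_blocks G S" "\<chi> = sigma_char G X"
    unfolding supercharacters_def by blast
  have \<chi>X: "\<chi> = inverse_fourier (ind X)"
    unfolding X(2) by (rule sigma_char_eq_inverse_fourier[OF partition_block_subset[OF part X(1)]])
  from f obtain e where e: "e \<in> block_functions (irr_blocks G S)" "f = inverse_fourier e"
    using supercharacter_partitions_spaces(2)[OF parts] by blast
  from part X(1) have "X \<noteq> {}" by (auto simp: partition_on_def)
  then obtain \<xi> where \<xi>: "\<xi> \<in> X" by blast
  have eq: "ind X \<psi> * e \<psi> = e \<xi> * ind X \<psi>" for \<psi>
  proof (cases "\<psi> \<in> X")
    case True
    then show ?thesis using block_functionsD[OF e(1) X(1) True \<xi>] by simp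
  qed simp
  have "convolution G \<chi> f = inverse_fourier (\<lambda>\<psi>. e \<xi> * ind X \<psi>)"
    unfolding \<chi>X e(2) inverse_fourier_convolution eq ..
  also have "\<dots> = (\<lambda>g. e \<xi> * \<chi> g)" unfolding \<chi>X by (rule inverse_fourier_scale)
  finally show thesis using that[of "e \<xi>"] by simp
qed

lemma coset_sum_translate:
  assumes M: "subgroup M G" and m: "m \<in> M" and g: "g \<in> carrier G"
  shows "coset_sum M f (m \<otimes> g) = coset_sum M f g"
proof -
  have car: "x \<in> carrier G" if "x \<in> M" for x using subgroup.subset[OF M] that by blast
  have "(\<Sum>x\<in>M. f (x \<otimes> (m \<otimes> g))) = (\<Sum>x\<in>M. f (x \<otimes> g))"
  proof (rule sum.reindex_bij_witness[of _ "\<lambda>x. x \<otimes> inv m" "\<lambda>x. x \<otimes> m"])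
    show "x \<otimes> m \<in> M" "x \<otimes> inv m \<in> M" if "x \<in> M" for x
      using subgroup.m_closed[OF M] subgroup.m_inv_closed[OF M] m that by blast+
  qed (use car m g in \<open>simp_all add: m_assoc\<close>)
  then show ?thesis using car[OF m] g by (simp add: coset_sum_def)
qed

text \<open>The coset sum of \<open>\<chi>\<close> is \<open>c * \<chi>\<close> for a scalar \<open>c\<close>, which is zero or the order of \<open>M\<close>. If it is the
  order of \<open>M\<close>, then \<open>\<chi>\<close> inherits from its coset sum that it is constant on cosets. The sum of \<open>\<chi>\<close>
  over \<open>M\<close> itself decides which case holds.\<close>

lemma supercharacter_coset_dichotomy:
  assumes S: "supercharacter_theory G S" and M: "supernormal G S M"
    and \<chi>: "\<chi> \<in> supercharacters G S" and g: "g \<in> carrier G"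
  shows "M \<subseteq> char_kernel G \<chi> \<Longrightarrow> m \<in> M \<Longrightarrow> \<chi> (m \<otimes> g) = \<chi> g"
    and "\<not> M \<subseteq> char_kernel G \<chi> \<Longrightarrow> (\<Sum>m\<in>M. \<chi> (m \<otimes> g)) = 0"
proof -
  have sub: "subgroup M G" using M by (rule supernormal_subgroup)
  have MG: "M \<subseteq> carrier G" using sub by (rule subgroup.subset)
  have finM: "finite M" using MG finite_carrier by (rule finite_subset)
  have cardM: "(of_nat (card M) :: complex) \<noteq> 0"
    using finM subgroup.one_closed[OF sub] by auto
  have one: "\<chi> \<one> \<noteq> 0" by (rule supercharacter_one_nonzero[OF S \<chi>])
  obtain c0 where "\<And>h. convolution G \<chi> (ind M) h = c0 * \<chi> h"
    by (rule convolution_supercharacter[OF S \<chi> ind_supernormal[OF S M]]) (rule that)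
  moreover define c where "c = of_nat (Coset.order G) * c0"
  ultimately have c: "coset_sum M \<chi> h = c * \<chi> h" for h
    unfolding coset_sum_eq_convolution[OF sub] by simp
  \<comment> \<open>summing twice over the coset multiplies the sum by the order of M\<close>
  have "c * (c * \<chi> \<one>) = of_nat (card M) * (c * \<chi> \<one>)"
  proof -
    have "c * (c * \<chi> \<one>) = c * (\<Sum>m\<in>M. \<chi> m)"
      using c[of \<one>] MG by (simp add: coset_sum_def subset_iff)
    also have "\<dots> = (\<Sum>m\<in>M. coset_sum M \<chi> m)" by (simp add: c sum_distrib_left)
    also have "\<dots> = (\<Sum>m\<in>M. coset_sum M \<chi> \<one>)"
    proof (rule sum.cong[OF refl])
      fix m assume m: "m \<in> M"
      then have "m \<in> carrier G" using MG by blast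
      then show "coset_sum M \<chi> m = coset_sum M \<chi> \<one>"
        using coset_sum_translate[OF sub m one_closed, of \<chi>] by simp
    qed
    also have "\<dots> = of_nat (card M) * (c * \<chi> \<one>)" by (simp add: c)
    finally show ?thesis .
  qed
  then have cases: "c = 0 \<or> c = of_nat (card M)" using one by auto
  have ker: "c = of_nat (card M) \<Longrightarrow> m \<in> M \<Longrightarrow> h \<in> carrier G \<Longrightarrow> \<chi> (m \<otimes> h) = \<chi> h" for m h
    using coset_sum_translate[OF sub, of m h \<chi>] cardM by (simp add: c)
  show "(\<Sum>m\<in>M. \<chi> (m \<otimes> g)) = 0" if not_ker: "\<not> M \<subseteq> char_kernel G \<chi>"
  proof -
    have "c \<noteq> of_nat (card M)"
    proof
      assume "c = of_nat (card M)"
      then have "\<chi> m = \<chi> \<one>" if "m \<in> M" for m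
        using ker[of m \<one>] that MG by (simp add: subset_iff)
      then have "M \<subseteq> char_kernel G \<chi>" using MG unfolding char_kernel_def by blast
      then show False using not_ker by contradiction
    qed
    then have "coset_sum M \<chi> g = 0" using cases c[of g] by simp
    then show ?thesis using g by (simp add: coset_sum_def)
  qed
  show "\<chi> (m \<otimes> g) = \<chi> g" if in_ker: "M \<subseteq> char_kernel G \<chi>" and m: "m \<in> M"
  proof -
    have "c * \<chi> \<one> = (\<Sum>m\<in>M. \<chi> (m \<otimes> \<one>))" using c[of \<one>] by (simp add: coset_sum_def)
    also have "\<dots> = (\<Sum>m\<in>M. \<chi> \<one>)"
      using in_ker by (intro sum.cong refl) (auto simp: char_kernel_def)
    also have "\<dots> = of_nat (card M) * \<chi> \<one>" by simp
    finally have "c = of_nat (card M)" using one by simp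
    then show ?thesis using m g by (rule ker)
  qed
qed

text \<open>The complement of \<open>N\<close> is a union of cosets of \<open>M\<close>. A supercharacter whose kernel does not contain
  \<open>M\<close> has sum zero on each of them, so it is constant there only if it vanishes. Conversely, the
  condition on the right is linear in \<open>f\<close> and needs to be tested only on the supercharacters, which
  span \<open>S\<close>.\<close>

lemma vanishing_iff_constant_on_cosets:
  assumes S: "supercharacter_theory G S" and M: "supernormal G S M" and N: "subgroup N G"
    and MN: "M \<subseteq> N"
  shows "(\<forall>g\<in>carrier G - N. \<forall>\<chi>\<in>supercharacters G S. \<not> M \<subseteq> char_kernel G \<chi> \<longrightarrow> \<chi> g = 0) \<longleftrightarrow>
    (\<forall>f\<in>S. \<forall>g\<in>carrier G - N. \<forall>m\<in>M. f (m \<otimes> g) = f g)" (is "?van \<longleftrightarrow> ?const")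
proof
  have sub: "subgroup M G" using M by (rule supernormal_subgroup)
  have MG: "M \<subseteq> carrier G" using sub by (rule subgroup.subset)
  have off: "m \<otimes> g \<in> carrier G - N" if "g \<in> carrier G - N" "m \<in> M" for m g
  proof -
    have m: "m \<in> N" "m \<in> carrier G" using that(2) MN MG by blast+
    have "m \<otimes> g \<notin> N"
    proof
      assume "m \<otimes> g \<in> N"
      then have "inv m \<otimes> (m \<otimes> g) \<in> N"
        using subgroup.m_inv_closed[OF N m(1)] subgroup.m_closed[OF N] by blast
      then show False using that m by (simp add: m_assoc[symmetric])
    qed
    then show ?thesis using that m by simp
  qed
  show ?const if van: ?van
  proof -
    define T :: "('a \<Rightarrow> complex) set" where "T = {f. \<forall>g\<in>carrier G - N. \<forall>m\<in>M. f (m \<otimes> g) = f g}"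
    have "cfun.span (supercharacters G S) \<subseteq> T"
    proof (rule cfun.span_minimal)
      show "cfun.subspace T"
        by (rule cfun.subspaceI) (simp_all add: T_def)
      show "supercharacters G S \<subseteq> T"
      proof
        fix \<chi> assume \<chi>: "\<chi> \<in> supercharacters G S"
        have "\<chi> (m \<otimes> g) = \<chi> g" if g: "g \<in> carrier G - N" and m: "m \<in> M" for m g
        proof (cases "M \<subseteq> char_kernel G \<chi>")
          case True
          show ?thesis using g by (intro supercharacter_coset_dichotomy(1)[OF S M \<chi> _ True m]) blast
        next
          case False
          then have "\<chi> g = 0" "\<chi> (m \<otimes> g) = 0" using van \<chi> g off[OF g m] by blast+
          then show ?thesis by simp
        qed
        then show "\<chi> \<in> T" unfolding T_def by blast
      qed
    qed
    with supercharacters_span[OF S] have "S \<subseteq> T" by (rule ord_eq_le_trans)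
    then show ?thesis unfolding T_def by blast
  qed
  show ?van if const: ?const
  proof (intro ballI impI)
    fix g \<chi> assume g: "g \<in> carrier G - N" and \<chi>: "\<chi> \<in> supercharacters G S"
      and ker: "\<not> M \<subseteq> char_kernel G \<chi>"
    have "\<chi> \<in> S" by (rule supercharacter_in_theory[OF S \<chi>])
    then have eq: "\<chi> (m \<otimes> g) = \<chi> g" if "m \<in> M" for m using const g that by blast
    have "0 = (\<Sum>m\<in>M. \<chi> (m \<otimes> g))"
      using g by (intro supercharacter_coset_dichotomy(2)[OF S M \<chi> _ ker, symmetric]) blast
    also have "\<dots> = (\<Sum>m\<in>M. \<chi> g)" by (rule sum.cong[OF refl]) (rule eq)
    also have "\<dots> = of_nat (card M) * \<chi> g" by simp
    finally show "\<chi> g = 0"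
      using finite_subset[OF MG finite_carrier] subgroup.one_closed[OF sub] by auto
  qed
qed

lemma theory_of_classes_constant:
  "f \<in> theory_of_classes G P \<Longrightarrow> A \<in> P \<Longrightarrow> x \<in> A \<Longrightarrow> y \<in> A \<Longrightarrow> f x = f y"
  unfolding theory_of_classes_def by blast

text \<open>The classes of the \<open>\<Delta>\<close>-product are the superclasses inside \<open>N\<close> and, for each superclass \<open>K\<close> outside
  \<open>N\<close>, the union of the cosets that meet \<open>K\<close>. A member of \<open>S\<close> is constant on this union exactly when
  it is constant on cosets of elements of \<open>K\<close>.\<close>

lemma Delta_product_iff_constant_on_cosets:
  assumes S: "supercharacter_theory G S" and M: "supernormal G S M" and N: "supernormal G S N"
    and MN: "M \<subseteq> N"
  shows "is_Delta_product G S M N \<longleftrightarrow> (\<forall>f\<in>S. \<forall>g\<in>carrier G - N. \<forall>m\<in>M. f (m \<otimes> g) = f g)"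
    (is "_ \<longleftrightarrow> ?const")
proof -
  let ?\<pi> = "\<lambda>g. M #> g"
  let ?D = "{K \<in> superclasses G S. K \<subseteq> N} \<union>
    {\<Union>C | C. C \<in> (\<lambda>K. ?\<pi> ` K) ` superclasses G S \<and> \<not> C \<subseteq> ?\<pi> ` N}"
  have subM: "subgroup M G" using M by (rule supernormal_subgroup)
  have subN: "subgroup N G" using N by (rule supernormal_subgroup)
  have MG: "M \<subseteq> carrier G" using subM by (rule subgroup.subset)
  have Delta: "is_Delta_product G S M N \<longleftrightarrow> S = theory_of_classes G ?D"
    unfolding is_Delta_product_def Delta_product_def
      superclasses_restricted_theory[OF S N] superclasses_quotient_theory[OF S M] ..
  have outer: "\<not> ?\<pi> ` K \<subseteq> ?\<pi> ` N" if K: "K \<in> superclasses G S" "\<not> K \<subseteq> N" for K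
  proof
    assume sub: "?\<pi> ` K \<subseteq> ?\<pi> ` N"
    from K(2) obtain g where g: "g \<in> K" "g \<notin> N" by blast
    then obtain n where n: "n \<in> N" "M #> g = M #> n" using sub by blast
    have "g \<in> carrier G" "n \<in> carrier G"
      using g(1) superclass_subset[OF S K(1)] n(1) subgroup.subset[OF subN] by blast+
    then obtain m where "m \<in> M" "g = m \<otimes> n" using r_coset_eq_iff[OF subM] n(2) by blast
    then have "g \<in> N" using MN n(1) subgroup.m_closed[OF subN] by blast
    then show False using g(2) by contradiction
  qed
  have coset: "x \<in> \<Union>(?\<pi> ` K) \<longleftrightarrow> (\<exists>k\<in>K. \<exists>m\<in>M. x = m \<otimes> k)" for x K
    by (auto simp: r_coset_def)
  have const_if_Delta: ?const if SD: "S = theory_of_classes G ?D"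
  proof (intro ballI)
    fix f g m assume f: "f \<in> S" and g: "g \<in> carrier G - N" and m: "m \<in> M"
    then obtain K where K: "K \<in> superclasses G S" "g \<in> K" using superclass_ex[OF S] by blast
    then have "\<not> K \<subseteq> N" using g by blast
    from outer[OF K(1) this] have D: "\<Union>(?\<pi> ` K) \<in> ?D" using K(1) by blast
    have fD: "f \<in> theory_of_classes G ?D" unfolding SD[symmetric] by (rule f)
    show "f (m \<otimes> g) = f g"
    proof (rule theory_of_classes_constant[OF fD D])
      show "m \<otimes> g \<in> \<Union>(?\<pi> ` K)" unfolding coset using K(2) m by blast
      have "g = \<one> \<otimes> g" using g by simp
      then show "g \<in> \<Union>(?\<pi> ` K)" unfolding coset using K(2) subgroup.one_closed[OF subM] by blast
    qed
  qed
  have Delta_if_const: "S = theory_of_classes G ?D" if const: ?const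
  proof
    show "S \<subseteq> theory_of_classes G ?D"
    proof
      fix f assume f: "f \<in> S"
      have "f x = f y" if A: "A \<in> ?D" "x \<in> A" "y \<in> A" for A x y
      proof -
        from A(1) consider (inner) "A \<in> superclasses G S"
          | (outer) K where "K \<in> superclasses G S" "A = \<Union>(?\<pi> ` K)" "\<not> ?\<pi> ` K \<subseteq> ?\<pi> ` N"
          by blast
        then show ?thesis
        proof cases
          case inner
          then show ?thesis using A(2,3) by (intro superclass_constant[OF S f])
        next
          case outer
          have "\<not> K \<subseteq> N" using outer(3) by blast
          then have off: "k \<in> carrier G - N" if "k \<in> K" for k
            using supernormal_superclass[OF S N outer(1) that] superclass_subset[OF S outer(1)] that
            by blast
          from A(2,3) obtain k m k' m' where km: "k \<in> K" "m \<in> M" "x = m \<otimes> k"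
            "k' \<in> K" "m' \<in> M" "y = m' \<otimes> k'"
            unfolding outer(2) coset by blast
          have "f x = f k" "f y = f k'" using const f off km by blast+
          moreover have "f k = f k'" by (rule superclass_constant[OF S f outer(1) km(1,4)])
          ultimately show ?thesis by simp
        qed
      qed
      moreover have "f \<in> class_functions G" using f supercharacter_theoryD(1)[OF S] by blast
      ultimately show "f \<in> theory_of_classes G ?D" unfolding theory_of_classes_def by blast
    qed
    show "theory_of_classes G ?D \<subseteq> S"
    proof
      fix f assume f: "f \<in> theory_of_classes G ?D"
      have D: "f x = f y" if "A \<in> ?D" "x \<in> A" "y \<in> A" for A x y
        using f that by (rule theory_of_classes_constant)
      show "f \<in> S"
      proof (rule in_theoryI[OF S])
        have "f \<in> class_functions G" using f unfolding theory_of_classes_def by blast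
        then show "f \<in> funs_on (carrier G)" using class_functions_funs_on by blast
        fix K x y assume K: "K \<in> superclasses G S" "x \<in> K" "y \<in> K"
        show "f x = f y"
        proof (cases "K \<subseteq> N")
          case True
          then show ?thesis using K by (intro D[of K]) simp_all
        next
          case False
          have A: "\<Union>(?\<pi> ` K) \<in> ?D" using K outer[OF K(1) False] by blast
          have "z \<in> \<Union>(?\<pi> ` K)" if "z \<in> K" for z
            using rcos_self[OF _ subM, of z] superclass_subset[OF S K(1)] that by blast
          then show ?thesis using K by (intro D[OF A])
        qed
      qed
    qed
  qed
  show ?thesis unfolding Delta using const_if_Delta Delta_if_const by (rule iffI)
qed

end

theorem theorem1:
  fixes G :: "('a, 'b) monoid_scheme"
    and S :: "('a \<Rightarrow> complex) set"
    and M N :: "'a set"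
  assumes "group G" and "finite (carrier G)"
    and "supercharacter_theory G S"
    and "supernormal G S M" and "supernormal G S N" and "M \<subseteq> N"
  shows "(is_Delta_product G S M N \<longleftrightarrow>
            (\<forall>g\<in>carrier G - N. \<forall>\<chi>\<in>supercharacters G S. \<not> M \<subseteq> char_kernel G \<chi> \<longrightarrow> \<chi> g = 0)) \<and>
         ((\<forall>g\<in>carrier G - N. \<forall>\<chi>\<in>supercharacters G S. \<not> M \<subseteq> char_kernel G \<chi> \<longrightarrow> \<chi> g = 0) \<longleftrightarrow>
            vanishing_off G S M \<subseteq> N)"
proof -
  interpret finite_group G
    using assms(1,2) by (intro finite_group.intro finite_group_axioms.intro)
  have N: "subgroup N G" using assms(5) by (rule supernormal_subgroup)
  let ?van = "\<forall>g\<in>carrier G - N. \<forall>\<chi>\<in>supercharacters G S. \<not> M \<subseteq> char_kernel G \<chi> \<longrightarrow> \<chi> g = 0"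
  have "is_Delta_product G S M N \<longleftrightarrow> ?van"
    unfolding Delta_product_iff_constant_on_cosets[OF assms(3-6)]
      vanishing_iff_constant_on_cosets[OF assms(3,4) N assms(6)] ..
  moreover have "?van \<longleftrightarrow> vanishing_off G S M \<subseteq> N"
  proof
    assume ?van
    then have "{g \<in> carrier G. \<exists>\<chi>\<in>supercharacters_over G S M. \<chi> g \<noteq> 0} \<subseteq> N"
      unfolding supercharacters_over_def by blast
    then show "vanishing_off G S M \<subseteq> N"
      unfolding vanishing_off_def using N by (rule generate_subgroup_incl)
  next
    assume V: "vanishing_off G S M \<subseteq> N"
    show ?van
    proof (intro ballI impI, rule ccontr)
      fix g \<chi> assume g: "g \<in> carrier G - N" and \<chi>: "\<chi> \<in> supercharacters G S"
        "\<not> M \<subseteq> char_kernel G \<chi>" "\<chi> g \<noteq> 0"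
      have "\<chi> \<in> supercharacters_over G S M" using \<chi>(1,2) by (simp add: supercharacters_over_def)
      then have "g \<in> vanishing_off G S M"
        unfolding vanishing_off_def using g \<chi>(3) by (intro generate.incl) blast
      then show False using V g by blast
    qed
  qed
  ultimately show ?thesis by (rule conjI)
qed

end
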